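(* Let $\mathbb{F}$ be an algebraically closed field. Let $n \ge 2$ and let $R_1, \ldots, R_n$ be affine commutative $\mathbb{F}$-algebras which are domains. Let $D_1, \ldots, D_n$ be positive integers, and consider the following two conditions: (1) for every $1 \le i \le n$, every prime ideal $P$ of $R_i$ and every integer $r>0$, $P^{(D_i r)} \subseteq P^r$; (2) for every $1 \le i \le n$, every prime ideal $P$ of $R_i$ and every integer $r>0$, $P^{(D_i (r-1)+1)} \subseteq P^r$. Fix any $n$ prime ideals $P_i \subseteq R_i$ ($1 \le i \le n$), and consider the expanded ideals $P_i' = P_i T$ in the affine domain $T = R_1 \otimes_{\mathbb{F}} \cdots \otimes_{\mathbb{F}} R_n$, along with their sum $Q = \sum_{i=1}^n P_i'$ in $T$. Then: - If (1) holds, then $Q^{(Dr)} \subseteq Q^r$ for all integers $r>0$, where $D = D_1 + \cdots + D_n$. - If (2) holds, then $Q^{(D(r-1)+1)} \subseteq Q^r$ for all integers $r>0$, where $D = \max\{D_1, \ldots, D_n\}$.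
   Context: All rings are Noetherian and commutative with identity. An affine $\mathbb{F}$-algebra is a commutative $\mathbb{F}$-algebra of finite type over $\mathbb{F}$. For a prime ideal $P$ in a Noetherian ring $R$ and an integer $a>0$, the $a$-th symbolic power is $P^{(a)} = P^a R_P \cap R = \{ f \in R : uf \in P^a \text{ for some } u \in R \setminus P\}$; also $P^{(0)} = P^0 = R$. For an ideal $I$ of $R_i$, $IT$ denotes the ideal of $T$ generated by the image of $I$ under the natural map $R_i \to T$. Since $\mathbb{F}$ is algebraically closed, $T$ is a domain, and the ideals $P_iT$ and $Q$ are prime in $T$. *)

theory Defs
  imports "HOL-Algebra.Algebra" "HOL-Algebra.Algebraic_Closure"
begin

section \<open>Affine algebras\<close>

locale affine_algebra = algebra F A for F (structure) and A (structure) +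
  assumes finite_type:
    "\<exists>S \<subseteq> carrier A. finite S \<and>
       carrier A = generate_ring A (S \<union> {c \<odot>\<^bsub>A\<^esub> \<one>\<^bsub>A\<^esub> | c. c \<in> carrier F})"

section \<open>Symbolic powers and extension of ideals\<close>

text \<open>Ordinary powers of an ideal \<open>I\<close> of \<open>R\<close> are taken in the multiplicative monoid
  \<^const>\<open>ideals_set\<close> of ideals of \<open>R\<close>, so that \<open>I [^]\<^bsub>ideals_set R\<^esub> 0\<close> is the unit
  ideal \<open>carrier R\<close>.\<close>

definition symbolic_power :: "('a, 'm) ring_scheme \<Rightarrow> 'a set \<Rightarrow> nat \<Rightarrow> 'a set" where
  "symbolic_power R P a =
     {f \<in> carrier R. \<exists>u \<in> carrier R - P. u \<otimes>\<^bsub>R\<^esub> f \<in> P [^]\<^bsub>ideals_set R\<^esub> a}"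

definition extended_ideal :: "('b, 'm) ring_scheme \<Rightarrow> ('a \<Rightarrow> 'b) \<Rightarrow> 'a set \<Rightarrow> 'b set" where
  "extended_ideal T \<phi> I = Idl\<^bsub>T\<^esub> (\<phi> ` I)"

section \<open>Tensor products of commutative algebras\<close>

text \<open>The monoid algebra \<open>F[M]\<close>: finitely supported functions from \<open>M\<close> to \<open>F\<close>,
  with convolution as multiplication.\<close>

definition monomial :: "('f, 'c) ring_scheme \<Rightarrow> 'f \<Rightarrow> 'x \<Rightarrow> 'x \<Rightarrow> 'f" where
  "monomial F c x = (\<lambda>z. if z = x then c else \<zero>\<^bsub>F\<^esub>)"

definition coeff_support :: "('f, 'c) ring_scheme \<Rightarrow> ('x \<Rightarrow> 'f) \<Rightarrow> 'x set" where
  "coeff_support F f = {x. f x \<noteq> \<zero>\<^bsub>F\<^esub>}"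

definition monoid_algebra ::
  "('f, 'c) ring_scheme \<Rightarrow> ('x, 'd) monoid_scheme \<Rightarrow> ('x \<Rightarrow> 'f) ring" where
  "monoid_algebra F M =
     \<lparr>carrier = {f. (\<forall>x. f x \<in> carrier F) \<and> coeff_support F f \<subseteq> carrier M
                    \<and> finite (coeff_support F f)},
      monoid.mult = (\<lambda>f g z. \<Oplus>\<^bsub>F\<^esub>x \<in> coeff_support F f. \<Oplus>\<^bsub>F\<^esub>y \<in> coeff_support F g.
                       if x \<otimes>\<^bsub>M\<^esub> y = z then f x \<otimes>\<^bsub>F\<^esub> g y else \<zero>\<^bsub>F\<^esub>),
      monoid.one = monomial F \<one>\<^bsub>F\<^esub> \<one>\<^bsub>M\<^esub>,
      ring.zero = (\<lambda>_. \<zero>\<^bsub>F\<^esub>),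
      ring.add = (\<lambda>f g z. f z \<oplus>\<^bsub>F\<^esub> g z)\<rparr>"

text \<open>\<open>\<Otimes>\<^sub>F R\<^sub>i\<close> is the free \<open>F\<close>-module on the set \<open>\<Prod>\<^sub>i R\<^sub>i\<close> modulo the relations that make
  \<open>x \<mapsto> [x]\<close> multilinear, with \<open>[x] [y] = [x y]\<close>. Here that free module is the monoid algebra of
  the product of the multiplicative monoids of the \<open>R\<^sub>i\<close> (\<^const>\<open>product_group\<close> only
  needs monoids). The \<open>F\<close>-submodule spanned by the relations is stable under multiplication
  by each \<open>[y]\<close>, hence equal to the ideal they generate.\<close>

abbreviation pure_algebra ::
  "('f, 'c) ring_scheme \<Rightarrow> 'i set \<Rightarrow> ('i \<Rightarrow> ('f, 'a, 'm) module_scheme) \<Rightarrow> (('i \<Rightarrow> 'a) \<Rightarrow> 'f) ring"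
  where "pure_algebra F I R \<equiv> monoid_algebra F (product_group I R)"

definition tensor_relations ::
  "('f, 'c) ring_scheme \<Rightarrow> 'i set \<Rightarrow> ('i \<Rightarrow> ('f, 'a, 'm) module_scheme) \<Rightarrow> (('i \<Rightarrow> 'a) \<Rightarrow> 'f) set"
  where "tensor_relations F I R =
     {monomial F \<one>\<^bsub>F\<^esub> (x(i := a \<oplus>\<^bsub>R i\<^esub> b))
        \<ominus>\<^bsub>pure_algebra F I R\<^esub>
        (monomial F \<one>\<^bsub>F\<^esub> (x(i := a)) \<oplus>\<^bsub>pure_algebra F I R\<^esub> monomial F \<one>\<^bsub>F\<^esub> (x(i := b)))
      | x i a b. x \<in> (\<Pi>\<^sub>E j\<in>I. carrier (R j)) \<and> i \<in> I \<and> a \<in> carrier (R i) \<and> b \<in> carrier (R i)}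
   \<union> {monomial F \<one>\<^bsub>F\<^esub> (x(i := c \<odot>\<^bsub>R i\<^esub> a)) \<ominus>\<^bsub>pure_algebra F I R\<^esub> monomial F c (x(i := a))
      | x i c a. x \<in> (\<Pi>\<^sub>E j\<in>I. carrier (R j)) \<and> i \<in> I \<and> c \<in> carrier F \<and> a \<in> carrier (R i)}"

definition tensor_ideal ::
  "('f, 'c) ring_scheme \<Rightarrow> 'i set \<Rightarrow> ('i \<Rightarrow> ('f, 'a, 'm) module_scheme) \<Rightarrow> (('i \<Rightarrow> 'a) \<Rightarrow> 'f) set"
  where "tensor_ideal F I R = Idl\<^bsub>pure_algebra F I R\<^esub> (tensor_relations F I R)"

definition tensor_product ::
  "('f, 'c) ring_scheme \<Rightarrow> 'i set \<Rightarrow> ('i \<Rightarrow> ('f, 'a, 'm) module_scheme)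
     \<Rightarrow> (('i \<Rightarrow> 'a) \<Rightarrow> 'f) set ring"
  where "tensor_product F I R = pure_algebra F I R Quot tensor_ideal F I R"

definition pure_tensor ::
  "('f, 'c) ring_scheme \<Rightarrow> 'i set \<Rightarrow> ('i \<Rightarrow> ('f, 'a, 'm) module_scheme)
     \<Rightarrow> ('i \<Rightarrow> 'a) \<Rightarrow> (('i \<Rightarrow> 'a) \<Rightarrow> 'f) set"
  where "pure_tensor F I R x =
     tensor_ideal F I R +>\<^bsub>pure_algebra F I R\<^esub> monomial F \<one>\<^bsub>F\<^esub> x"

text \<open>The natural map \<open>R\<^sub>i \<rightarrow> \<Otimes>\<^sub>F R\<^sub>j\<close>, sending \<open>a\<close> to \<open>1 \<otimes> \<dots> \<otimes> a \<otimes> \<dots> \<otimes> 1\<close>.\<close>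

definition tensor_incl ::
  "('f, 'c) ring_scheme \<Rightarrow> 'i set \<Rightarrow> ('i \<Rightarrow> ('f, 'a, 'm) module_scheme)
     \<Rightarrow> 'i \<Rightarrow> 'a \<Rightarrow> (('i \<Rightarrow> 'a) \<Rightarrow> 'f) set"
  where "tensor_incl F I R i a = pure_tensor F I R ((\<lambda>j\<in>I. \<one>\<^bsub>R j\<^esub>)(i := a))"

end

theory Submission
  imports Defs
begin

text \<open>Filter each \<open>R\<^sub>i\<close> by the symbolic powers \<open>V\<^sub>i a = P\<^sub>i\<^sup>(\<^sup>a\<^sup>)\<close> and give \<open>T\<close> the product filtration:
  \<open>W k\<close> is spanned by the pure tensors \<open>\<tau> x\<close> with \<open>x\<^sub>i \<in> V\<^sub>i a\<^sub>i\<close> for exponents \<open>a\<^sub>i\<close> whose sum is at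
  least \<open>k\<close>. Multiplying tensors adds exponents, so \<open>W k \<cdot> W m \<subseteq> W (k + m)\<close>; moreover \<open>W 1 = Q\<close>,
  and hence \<open>Q\<^sup>N \<subseteq> W N\<close>. The theorem follows from two facts.

  The first fact is \<open>Q\<^sup>(\<^sup>N\<^sup>) \<subseteq> W N\<close> (\<open>symbolic_power_subset_W\<close>). It holds because \<open>u f \<in> W N\<close> and \<open>u \<notin> W 1\<close>
  force \<open>f \<in> W N\<close>. In terms of the associated graded ring, a nonzero element of
  \<open>\<Otimes> R\<^sub>i/P\<^sub>i\<close> must not annihilate a nonzero element of
  \<open>\<Otimes> V\<^sub>i a\<^sub>i / V\<^sub>i (a\<^sub>i + 1)\<close>. Every factor of the latter is a torsion-free module over the domain
  \<open>R\<^sub>i/P\<^sub>i\<close>, and over an algebraically closed field a tensor product of torsion-free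
  modules stays torsion-free.

  The second fact is \<open>W N \<subseteq> Q\<^sup>r\<close> for the values of \<open>N\<close> in question, and it is a pigeonhole argument. Under
  the first hypothesis, exponents with \<open>\<Sum> a\<^sub>i \<ge> D r\<close> and \<open>D = \<Sum> D\<^sub>i\<close> satisfy \<open>a\<^sub>j \<ge> D\<^sub>j r\<close> for some \<open>j\<close>, so already the
  factor \<open>x\<^sub>j\<close> lies in \<open>P\<^sub>j\<^sup>r\<close>. Under the second, \<open>x\<^sub>i\<close> lies in the power of \<open>P\<^sub>i\<close> with exponent \<open>a\<^sub>i / D\<^sub>i\<close>
  rounded up, and these exponents add up to at least \<open>N / max D\<^sub>i > r - 1\<close>.

  The torsion-freeness is proved by evaluation (\<open>mult_not_killed\<close>). The Nullstellensatz
  (\<open>points_of_domain\<close>) provides \<open>F\<close>-algebra homomorphisms \<open>\<epsilon>\<^sub>i : R\<^sub>i \<rightarrow> F\<close> that kill \<open>P\<^sub>i\<close>, and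
  torsion-freeness provides linear forms \<open>\<mu>\<^sub>i\<close> on \<open>R\<^sub>i\<close> that kill \<open>V\<^sub>i (a\<^sub>i + 1)\<close> and satisfy
  \<open>\<mu>\<^sub>i (r w) = \<epsilon>\<^sub>i r \<cdot> \<mu>\<^sub>i w\<close> for the finitely many \<open>w \<in> V\<^sub>i a\<^sub>i\<close> that occur in a given representation of \<open>f\<close>
  (\<open>layer_point\<close>). Then \<open>\<Theta> = \<Otimes> \<mu>\<^sub>i\<close> satisfies \<open>\<Theta> (u f) = (\<Otimes> \<epsilon>\<^sub>i) u \<cdot> \<Theta> f\<close>. To make both factors
  nonzero, \<open>u\<close> and \<open>f\<close> are first detected by products of arbitrary linear forms
  (\<open>detecting_product_form\<close>), and these forms are then replaced by \<open>\<epsilon>\<^sub>i\<close> and \<open>\<mu>\<^sub>i\<close> one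
  coordinate at a time.

  Elements of \<open>T\<close> are represented by finitely supported functions \<open>g\<close> on tuples, and a multilinear form
  \<open>\<Phi>\<close> is applied to \<open>g\<close> by summing \<open>g x \<cdot> \<Phi> x\<close>. This vanishes on the tensor relations
  (\<open>ev_tensor_ideal\<close>), and conversely linear forms on \<open>T\<close> are multilinear forms on tuples
  (\<open>linear_form_multilinear\<close>).\<close>

section \<open>Linear forms that separate a point from a subspace\<close>

definition linear_form ::
  "('f, 'c) ring_scheme \<Rightarrow> ('f, 'v, 'm) module_scheme \<Rightarrow> ('v \<Rightarrow> 'f) \<Rightarrow> bool" where
  "linear_form F V \<phi> \<longleftrightarrow> \<phi> \<in> carrier V \<rightarrow> carrier F
     \<and> (\<forall>x\<in>carrier V. \<forall>y\<in>carrier V. \<phi> (x \<oplus>\<^bsub>V\<^esub> y) = \<phi> x \<oplus>\<^bsub>F\<^esub> \<phi> y)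
     \<and> (\<forall>c\<in>carrier F. \<forall>x\<in>carrier V. \<phi> (c \<odot>\<^bsub>V\<^esub> x) = c \<otimes>\<^bsub>F\<^esub> \<phi> x)"

lemma linear_formD:
  assumes "linear_form F V \<phi>"
  shows "x \<in> carrier V \<Longrightarrow> \<phi> x \<in> carrier F"
    and "x \<in> carrier V \<Longrightarrow> y \<in> carrier V \<Longrightarrow> \<phi> (x \<oplus>\<^bsub>V\<^esub> y) = \<phi> x \<oplus>\<^bsub>F\<^esub> \<phi> y"
    and "c \<in> carrier F \<Longrightarrow> x \<in> carrier V \<Longrightarrow> \<phi> (c \<odot>\<^bsub>V\<^esub> x) = c \<otimes>\<^bsub>F\<^esub> \<phi> x"
  using assms unfolding linear_form_def by auto

locale vec_space = F: field F + module F V for F (structure) and V (structure)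
begin

lemma V_minus_zero: "\<ominus>\<^bsub>V\<^esub> \<zero>\<^bsub>V\<^esub> = \<zero>\<^bsub>V\<^esub>"
  by (metis M.r_neg M.l_zero M.zero_closed M.a_inv_closed)

lemma submoduleD:
  assumes "submodule U F V"
  shows "U \<subseteq> carrier V" "\<zero>\<^bsub>V\<^esub> \<in> U" "x \<in> U \<Longrightarrow> y \<in> U \<Longrightarrow> x \<oplus>\<^bsub>V\<^esub> y \<in> U"
    "c \<in> carrier F \<Longrightarrow> x \<in> U \<Longrightarrow> c \<odot>\<^bsub>V\<^esub> x \<in> U" "x \<in> U \<Longrightarrow> \<ominus>\<^bsub>V\<^esub> x \<in> U"
    "x \<in> U \<Longrightarrow> y \<in> U \<Longrightarrow> x \<ominus>\<^bsub>V\<^esub> y \<in> U"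
proof -
  note E = submoduleE[OF assms]
  obtain u where "u \<in> U" using E(2) by blast
  then have "\<zero> \<odot>\<^bsub>V\<^esub> u \<in> U" "u \<in> carrier V" using E(1,4) by auto
  then show "\<zero>\<^bsub>V\<^esub> \<in> U" by simp
qed (use submoduleE[OF assms] in \<open>auto simp: a_minus_def\<close>)

lemma submodule_addI:
  assumes "U \<subseteq> carrier V" "\<zero>\<^bsub>V\<^esub> \<in> U" "\<And>x y. x \<in> U \<Longrightarrow> y \<in> U \<Longrightarrow> x \<oplus>\<^bsub>V\<^esub> y \<in> U"
    "\<And>c x. c \<in> carrier F \<Longrightarrow> x \<in> U \<Longrightarrow> c \<odot>\<^bsub>V\<^esub> x \<in> U"
  shows "submodule U F V"
proof (rule submoduleI)
  fix x assume "x \<in> U"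
  then have "(\<ominus> \<one>) \<odot>\<^bsub>V\<^esub> x \<in> U" "x \<in> carrier V" using assms by auto
  then show "\<ominus>\<^bsub>V\<^esub> x \<in> U" using smult_l_minus[of "\<one>" x] by simp
qed (use assms in auto)

lemma linear_form_zero:
  assumes "linear_form F V \<phi>" shows "\<phi> \<zero>\<^bsub>V\<^esub> = \<zero>"
  using linear_formD(3)[OF assms, of "\<zero>" "\<zero>\<^bsub>V\<^esub>"] linear_formD(1)[OF assms] by simp

lemma adjoin_submodule:
  assumes W: "submodule W F V" and x: "x \<in> carrier V"
  defines "W' \<equiv> {w \<oplus>\<^bsub>V\<^esub> c \<odot>\<^bsub>V\<^esub> x | w c. w \<in> W \<and> c \<in> carrier F}"
  shows "submodule W' F V" "W \<subseteq> W'" "x \<in> W'"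
proof -
  note WD = submoduleD[OF W]
  show "W \<subseteq> W'"
  proof
    fix w assume w: "w \<in> W"
    then have "w = w \<oplus>\<^bsub>V\<^esub> \<zero> \<odot>\<^bsub>V\<^esub> x" using x WD(1) by auto
    then show "w \<in> W'" unfolding W'_def using w by blast
  qed
  have "x = \<zero>\<^bsub>V\<^esub> \<oplus>\<^bsub>V\<^esub> \<one> \<odot>\<^bsub>V\<^esub> x" using x by simp
  then show "x \<in> W'" unfolding W'_def using WD(2) by blast
  show "submodule W' F V"
  proof (rule submodule_addI)
    show "W' \<subseteq> carrier V" unfolding W'_def using WD(1) x by auto
    show "\<zero>\<^bsub>V\<^esub> \<in> W'" using \<open>W \<subseteq> W'\<close> WD(2) by auto
  next
    fix a b assume "a \<in> W'" "b \<in> W'"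
    then obtain w c w' c' where *: "w \<in> W" "c \<in> carrier F" "w' \<in> W" "c' \<in> carrier F"
      "a = w \<oplus>\<^bsub>V\<^esub> c \<odot>\<^bsub>V\<^esub> x" "b = w' \<oplus>\<^bsub>V\<^esub> c' \<odot>\<^bsub>V\<^esub> x" unfolding W'_def by blast
    have "w \<in> carrier V" "w' \<in> carrier V" using * WD(1) by auto
    then have "a \<oplus>\<^bsub>V\<^esub> b = (w \<oplus>\<^bsub>V\<^esub> w') \<oplus>\<^bsub>V\<^esub> (c \<oplus> c') \<odot>\<^bsub>V\<^esub> x"
      using * x by (simp add: smult_l_distr M.a_ac)
    then show "a \<oplus>\<^bsub>V\<^esub> b \<in> W'" unfolding W'_def using * WD(3) by blast
  next
    fix d a assume d: "d \<in> carrier F" "a \<in> W'"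
    then obtain w c where *: "w \<in> W" "c \<in> carrier F" "a = w \<oplus>\<^bsub>V\<^esub> c \<odot>\<^bsub>V\<^esub> x"
      unfolding W'_def by blast
    have "w \<in> carrier V" using * WD(1) by auto
    then have "d \<odot>\<^bsub>V\<^esub> a = d \<odot>\<^bsub>V\<^esub> w \<oplus>\<^bsub>V\<^esub> (d \<otimes> c) \<odot>\<^bsub>V\<^esub> x"
      using * x d by (simp add: smult_r_distr smult_assoc1)
    then show "d \<odot>\<^bsub>V\<^esub> a \<in> W'" unfolding W'_def using * WD(4) d by blast
  qed
qed

text \<open>A subspace that contains \<open>U\<close> and is maximal among those missing \<open>v\<close> (Zorn) is a hyperplane: adjoining
  any further vector captures \<open>v\<close>. The form is the coordinate along \<open>v\<close> modulo this hyperplane.\<close>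

theorem separating_linear_form:
  assumes U: "submodule U F V" and v: "v \<in> carrier V" "v \<notin> U"
  obtains \<phi> where "linear_form F V \<phi>" "\<And>u. u \<in> U \<Longrightarrow> \<phi> u = \<zero>" "\<phi> v = \<one>"
proof -
  define C0 where "C0 = {W. submodule W F V \<and> U \<subseteq> W \<and> v \<notin> W}"
  have "\<exists>W\<in>C0. \<forall>Y1\<in>C0. W \<subseteq> Y1 \<longrightarrow> Y1 = W"
  proof (rule subset_Zorn_nonempty)
    show "C0 \<noteq> {}" unfolding C0_def using U v by blast
  next
    fix C assume ne: "C \<noteq> {}" and ch: "subset.chain C0 C"
    have sub: "\<And>W. W \<in> C \<Longrightarrow> submodule W F V \<and> U \<subseteq> W \<and> v \<notin> W"
      using ch unfolding subset.chain_def C0_def by blast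
    obtain W0 where W0: "W0 \<in> C" using ne by blast
    have "submodule (\<Union>C) F V"
    proof (rule submodule_addI)
      show "\<Union>C \<subseteq> carrier V" using sub submoduleD(1) by blast
      show "\<zero>\<^bsub>V\<^esub> \<in> \<Union>C" using sub[OF W0] submoduleD(2) W0 by blast
    next
      fix x y assume "x \<in> \<Union>C" "y \<in> \<Union>C"
      then obtain Y1 Y2 where XY: "Y1 \<in> C" "Y2 \<in> C" "x \<in> Y1" "y \<in> Y2" by blast
      then have "Y1 \<subseteq> Y2 \<or> Y2 \<subseteq> Y1" using ch unfolding subset.chain_def by blast
      then show "x \<oplus>\<^bsub>V\<^esub> y \<in> \<Union>C" using XY sub submoduleD(3) by (metis UnionI subsetD)
    next
      fix c x assume "c \<in> carrier F" "x \<in> \<Union>C"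
      then show "c \<odot>\<^bsub>V\<^esub> x \<in> \<Union>C" using sub submoduleD(4) by (metis UnionE UnionI)
    qed
    moreover have "U \<subseteq> \<Union>C" using W0 sub by blast
    ultimately show "\<Union>C \<in> C0" unfolding C0_def using sub by blast
  qed
  then obtain W where W: "submodule W F V" "U \<subseteq> W" "v \<notin> W"
    and max: "\<And>Y1. submodule Y1 F V \<Longrightarrow> W \<subseteq> Y1 \<Longrightarrow> v \<notin> Y1 \<Longrightarrow> Y1 = W"
    unfolding C0_def by (smt (verit, ccfv_SIG) mem_Collect_eq order_trans)
  note WD = submoduleD[OF W(1)]
  have ex: "\<exists>c\<in>carrier F. x \<ominus>\<^bsub>V\<^esub> c \<odot>\<^bsub>V\<^esub> v \<in> W" if x: "x \<in> carrier V" for x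
  proof (cases "x \<in> W")
    case True
    then have "x \<ominus>\<^bsub>V\<^esub> \<zero> \<odot>\<^bsub>V\<^esub> v \<in> W" using v x by (simp add: a_minus_def V_minus_zero)
    then show ?thesis by blast
  next
    case False
    note adj = adjoin_submodule[OF W(1) x]
    have "v \<in> {w \<oplus>\<^bsub>V\<^esub> c \<odot>\<^bsub>V\<^esub> x | w c. w \<in> W \<and> c \<in> carrier F}"
      using max[OF adj(1,2)] adj(3) False by blast
    then obtain w c where wc: "w \<in> W" "c \<in> carrier F" "v = w \<oplus>\<^bsub>V\<^esub> c \<odot>\<^bsub>V\<^esub> x" by blast
    have wV: "w \<in> carrier V" using wc WD(1) by blast
    have "c \<noteq> \<zero>" using wc wV x W(3) by auto
    then have c: "c \<in> Units F" using wc F.field_Units by blast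
    define d where "d = inv c"
    have d: "d \<in> carrier F" "d \<otimes> c = \<one>" unfolding d_def using c by auto
    have "d \<odot>\<^bsub>V\<^esub> v = d \<odot>\<^bsub>V\<^esub> w \<oplus>\<^bsub>V\<^esub> x"
      using wc d x wV smult_assoc1[of d c x] by (simp add: smult_r_distr)
    then have "x \<ominus>\<^bsub>V\<^esub> d \<odot>\<^bsub>V\<^esub> v = \<ominus>\<^bsub>V\<^esub> (d \<odot>\<^bsub>V\<^esub> w)"
      using x wV d by (simp add: a_minus_def M.minus_add M.a_ac M.r_neg1 M.r_neg2)
    then have "x \<ominus>\<^bsub>V\<^esub> d \<odot>\<^bsub>V\<^esub> v \<in> W" using WD(4,5) wc d by auto
    then show ?thesis using d by blast
  qed
  have uniq: "c = c'" if c: "c \<in> carrier F" "c' \<in> carrier F" "x \<in> carrier V"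
    "x \<ominus>\<^bsub>V\<^esub> c \<odot>\<^bsub>V\<^esub> v \<in> W" "x \<ominus>\<^bsub>V\<^esub> c' \<odot>\<^bsub>V\<^esub> v \<in> W" for c c' x
  proof (rule ccontr)
    assume ne: "c \<noteq> c'"
    define d where "d = c' \<ominus> c"
    have dF: "d \<in> carrier F" "d \<noteq> \<zero>" unfolding d_def using c ne by (auto simp: F.r_right_minus_eq)
    have dU: "d \<in> Units F" using dF F.field_Units by blast
    have "(x \<ominus>\<^bsub>V\<^esub> c \<odot>\<^bsub>V\<^esub> v) \<ominus>\<^bsub>V\<^esub> (x \<ominus>\<^bsub>V\<^esub> c' \<odot>\<^bsub>V\<^esub> v) = d \<odot>\<^bsub>V\<^esub> v"
      unfolding d_def using c v
      by (simp add: a_minus_def smult_l_distr smult_l_minus M.minus_add M.a_ac M.r_neg1 M.r_neg2)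
    then have "d \<odot>\<^bsub>V\<^esub> v \<in> W" using WD(6)[OF c(4,5)] by simp
    then have "inv d \<odot>\<^bsub>V\<^esub> (d \<odot>\<^bsub>V\<^esub> v) \<in> W" using WD(4) dU by blast
    then show False using smult_assoc1[of "inv d" d v] dU dF v W(3) by simp
  qed
  define \<phi> where "\<phi> x = (THE c. c \<in> carrier F \<and> x \<ominus>\<^bsub>V\<^esub> c \<odot>\<^bsub>V\<^esub> v \<in> W)" for x
  have \<phi>I: "\<phi> x = c" if "x \<in> carrier V" "c \<in> carrier F" "x \<ominus>\<^bsub>V\<^esub> c \<odot>\<^bsub>V\<^esub> v \<in> W" for x c
    unfolding \<phi>_def using that uniq by (intro the_equality) blast+
  have \<phi>: "\<phi> x \<in> carrier F \<and> x \<ominus>\<^bsub>V\<^esub> \<phi> x \<odot>\<^bsub>V\<^esub> v \<in> W" if "x \<in> carrier V" for x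
    using ex[OF that] \<phi>I[OF that] by auto
  have "linear_form F V \<phi>"
    unfolding linear_form_def
  proof (intro conjI ballI)
    show "\<phi> \<in> carrier V \<rightarrow> carrier F" using \<phi> by blast
  next
    fix x y assume xy: "x \<in> carrier V" "y \<in> carrier V"
    have "(x \<oplus>\<^bsub>V\<^esub> y) \<ominus>\<^bsub>V\<^esub> (\<phi> x \<oplus> \<phi> y) \<odot>\<^bsub>V\<^esub> v
        = (x \<ominus>\<^bsub>V\<^esub> \<phi> x \<odot>\<^bsub>V\<^esub> v) \<oplus>\<^bsub>V\<^esub> (y \<ominus>\<^bsub>V\<^esub> \<phi> y \<odot>\<^bsub>V\<^esub> v)"
      using xy \<phi> v by (simp add: a_minus_def smult_l_distr M.minus_add M.a_ac)
    then show "\<phi> (x \<oplus>\<^bsub>V\<^esub> y) = \<phi> x \<oplus> \<phi> y" using \<phi>I \<phi> xy WD(3) by simp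
  next
    fix c x assume cx: "c \<in> carrier F" "x \<in> carrier V"
    have "c \<odot>\<^bsub>V\<^esub> x \<ominus>\<^bsub>V\<^esub> (c \<otimes> \<phi> x) \<odot>\<^bsub>V\<^esub> v = c \<odot>\<^bsub>V\<^esub> (x \<ominus>\<^bsub>V\<^esub> \<phi> x \<odot>\<^bsub>V\<^esub> v)"
      using cx \<phi> v by (simp add: a_minus_def smult_r_distr smult_assoc1 smult_r_minus)
    then show "\<phi> (c \<odot>\<^bsub>V\<^esub> x) = c \<otimes> \<phi> x" using \<phi>I \<phi> cx WD(4) by simp
  qed
  moreover have "\<phi> u = \<zero>" if "u \<in> U" for u
  proof (rule \<phi>I)
    show "u \<ominus>\<^bsub>V\<^esub> \<zero> \<odot>\<^bsub>V\<^esub> v \<in> W" "u \<in> carrier V" using that W(2) WD(1) v by (auto simp: a_minus_def V_minus_zero subset_iff)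
  qed auto
  moreover have "\<phi> v = \<one>"
    by (rule \<phi>I) (use v WD(2) in \<open>auto simp: a_minus_def M.r_neg V_minus_zero\<close>)
  ultimately show thesis using that by blast
qed

end

context vec_space begin

text \<open>A finite set \<open>Y\<close> can be moved into \<open>W N\<close> by successively subtracting rank-one maps
  \<open>x \<mapsto> \<phi> x \<cdot> e\<close>, in each of which \<open>e\<close> lies in some layer \<open>W l\<close> and \<open>\<phi>\<close> kills the next one. In this way a
  basis adapted to the filtration is used without being constructed. The statement is an
  induction principle: any property \<open>A\<close> that holds for the identity and survives one such subtraction
  holds for a map that pushes \<open>Y\<close> into \<open>W N\<close>.\<close>

lemma adapted_projection:
  assumes W: "\<And>a. submodule (W a) F V" and W0: "W 0 = carrier V" and dec: "\<And>a. W (Suc a) \<subseteq> W a"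
    and Y: "finite Y" "Y \<subseteq> carrier V"
    and A_id: "A (\<lambda>x. x)"
    and A_step: "\<And>\<pi> \<phi> e l. A \<pi> \<Longrightarrow> linear_form F V \<phi> \<Longrightarrow> (\<And>v. v \<in> W (Suc l) \<Longrightarrow> \<phi> v = \<zero>)
        \<Longrightarrow> e \<in> W l \<Longrightarrow> l < N \<Longrightarrow> A (\<lambda>x. \<pi> x \<ominus>\<^bsub>V\<^esub> \<phi> x \<odot>\<^bsub>V\<^esub> e)"
  shows "\<exists>\<pi>. A \<pi> \<and> (\<forall>x\<in>Y. \<pi> x \<in> W N)"
proof -
  have mono: "W b \<subseteq> W a" if "a \<le> b" for a b
    using that dec by (rule lift_Suc_antimono_le[rotated])
  have "\<exists>\<pi>. A \<pi> \<and> (\<forall>x\<in>Y. \<pi> x \<in> W N)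
    \<and> (\<forall>x\<in>carrier V. \<forall>y\<in>carrier V. \<pi> (x \<oplus>\<^bsub>V\<^esub> y) = \<pi> x \<oplus>\<^bsub>V\<^esub> \<pi> y)
    \<and> (\<forall>c\<in>carrier F. \<forall>x\<in>carrier V. \<pi> (c \<odot>\<^bsub>V\<^esub> x) = c \<odot>\<^bsub>V\<^esub> \<pi> x)
    \<and> (\<forall>a\<le>N. \<forall>x\<in>W a. \<pi> x \<in> W a)"
    using Y
  proof (induct Y rule: finite_induct)
    case empty
    show ?case using A_id by (intro exI[of _ "\<lambda>x. x"]) simp
  next
    case (insert x Y)
    then obtain \<pi> where \<pi>: "A \<pi>" "\<forall>y\<in>Y. \<pi> y \<in> W N"
      "\<forall>x\<in>carrier V. \<forall>y\<in>carrier V. \<pi> (x \<oplus>\<^bsub>V\<^esub> y) = \<pi> x \<oplus>\<^bsub>V\<^esub> \<pi> y"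
      "\<forall>c\<in>carrier F. \<forall>x\<in>carrier V. \<pi> (c \<odot>\<^bsub>V\<^esub> x) = c \<odot>\<^bsub>V\<^esub> \<pi> x"
      "\<forall>a\<le>N. \<forall>x\<in>W a. \<pi> x \<in> W a" by auto
    have \<pi>c: "\<pi> y \<in> carrier V" if "y \<in> carrier V" for y using \<pi>(5) W0 that by auto
    have x: "x \<in> carrier V" using insert by simp
    show ?case
    proof (cases "\<pi> x \<in> W N")
      case True
      then show ?thesis using \<pi> by (intro exI[of _ \<pi>]) simp
    next
      case False
      obtain l where l: "l < N" "\<pi> x \<in> W l" "\<pi> x \<notin> W (Suc l)"
      proof -
        have "\<exists>l<N. \<pi> x \<in> W l \<and> \<pi> x \<notin> W (Suc l)"
        proof (rule ccontr)
          assume n: "\<not> ?thesis"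
          have "a \<le> N \<Longrightarrow> \<pi> x \<in> W a" for a
          proof (induct a)
            case 0 then show ?case using W0 \<pi>c[OF x] by simp
          next
            case (Suc a) then show ?case using n by auto
          qed
          then show False using False by simp
        qed
        then show thesis using that by blast
      qed
      define e where "e = \<pi> x"
      have e: "e \<in> W l" "e \<in> carrier V" "e \<notin> W (Suc l)" using l \<pi>c[OF x] by (auto simp: e_def)
      obtain \<phi>0 where \<phi>0: "linear_form F V \<phi>0" "\<And>u. u \<in> W (Suc l) \<Longrightarrow> \<phi>0 u = \<zero>" "\<phi>0 e = \<one>"
        using separating_linear_form[OF W e(2,3)] by metis
      note \<phi>D = linear_formD[OF \<phi>0(1)]
      \<comment> \<open>Composing with \<open>\<pi>\<close> keeps the vectors treated before in \<open>W N\<close>: there \<open>\<phi>\<close> vanishes.\<close>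
      define \<phi> where "\<phi> y = \<phi>0 (\<pi> y)" for y
      have \<phi>: "linear_form F V \<phi>"
        unfolding linear_form_def \<phi>_def using \<pi>(3,4) \<pi>c \<phi>D by simp
      have \<phi>c: "\<phi> y \<in> carrier F" if "y \<in> carrier V" for y using linear_formD(1)[OF \<phi> that] .
      have \<phi>W: "\<phi> v = \<zero>" if "v \<in> W (Suc l)" for v
        unfolding \<phi>_def using \<phi>0(2) \<pi>(5) that l(1) by simp
      define \<pi>' where "\<pi>' y = \<pi> y \<ominus>\<^bsub>V\<^esub> \<phi> y \<odot>\<^bsub>V\<^esub> e" for y
      have "A \<pi>'" unfolding \<pi>'_def by (rule A_step[OF \<pi>(1) \<phi> \<phi>W e(1) l(1)])
      moreover have "\<forall>y\<in>insert x Y. \<pi>' y \<in> W N"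
      proof
        fix y assume "y \<in> insert x Y"
        then consider "y = x" | "y \<in> Y" by blast
        then show "\<pi>' y \<in> W N"
        proof cases
          case 1
          then have "\<pi>' y = \<zero>\<^bsub>V\<^esub>" using \<phi>0(3) e(2) by (simp add: \<pi>'_def \<phi>_def e_def a_minus_def M.r_neg)
          then show ?thesis using submoduleD(2)[OF W] by simp
        next
          case 2
          then have yN: "\<pi> y \<in> W N" using \<pi>(2) by blast
          then have "\<pi> y \<in> W (Suc l)" using mono[of "Suc l" N] l(1) by auto
          then have "\<phi> y = \<zero>" unfolding \<phi>_def by (rule \<phi>0(2))
          moreover have "\<pi> y \<in> carrier V" using yN submoduleD(1)[OF W] by blast
          ultimately have "\<pi>' y = \<pi> y" using e(2) by (simp add: \<pi>'_def a_minus_def V_minus_zero)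
          then show ?thesis using yN by simp
        qed
      qed
      moreover have "\<forall>y\<in>carrier V. \<forall>z\<in>carrier V. \<pi>' (y \<oplus>\<^bsub>V\<^esub> z) = \<pi>' y \<oplus>\<^bsub>V\<^esub> \<pi>' z"
        using \<pi>(3) \<pi>c \<phi>c linear_formD(2)[OF \<phi>] e(2)
        by (simp add: \<pi>'_def a_minus_def smult_l_distr M.minus_add M.a_ac)
      moreover have "\<forall>c\<in>carrier F. \<forall>y\<in>carrier V. \<pi>' (c \<odot>\<^bsub>V\<^esub> y) = c \<odot>\<^bsub>V\<^esub> \<pi>' y"
        using \<pi>(4) \<pi>c \<phi>c linear_formD(3)[OF \<phi>] e(2)
        by (simp add: \<pi>'_def a_minus_def smult_r_distr smult_r_minus smult_assoc1)
      moreover have "\<forall>a\<le>N. \<forall>y\<in>W a. \<pi>' y \<in> W a"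
      proof (intro allI impI ballI)
        fix a y assume a: "a \<le> N" and y: "y \<in> W a"
        have yV: "y \<in> carrier V" using y submoduleD(1)[OF W] by blast
        have py: "\<pi> y \<in> W a" using \<pi>(5) a y by blast
        show "\<pi>' y \<in> W a"
        proof (cases "a \<le> l")
          case True
          then have "e \<in> W a" using e(1) mono by blast
          then show ?thesis unfolding \<pi>'_def
            by (intro submoduleD(6)[OF W py] submoduleD(4)[OF W \<phi>c[OF yV]])
        next
          case False
          then have "\<phi> y = \<zero>" using \<phi>W mono[of "Suc l" a] y by auto
          then have "\<pi>' y = \<pi> y" using e(2) \<pi>c[OF yV] by (simp add: \<pi>'_def a_minus_def V_minus_zero)
          then show ?thesis using py by simp
        qed
      qed
      ultimately show ?thesis by blast
    qed
  qed
  then show ?thesis by blast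
qed

lemma linear_form_finsum:
  assumes \<phi>: "linear_form F V \<phi>" and "finite S" "\<And>s. s \<in> S \<Longrightarrow> f s \<in> carrier V"
  shows "\<phi> (\<Oplus>\<^bsub>V\<^esub>s\<in>S. f s) = (\<Oplus>s\<in>S. \<phi> (f s))"
  using assms(2,3)
proof (induct S rule: finite_induct)
  case empty then show ?case using linear_form_zero[OF \<phi>] by simp
next
  case (insert s S)
  have c: "f \<in> S \<rightarrow> carrier V" "f s \<in> carrier V" "(\<lambda>s. \<phi> (f s)) \<in> S \<rightarrow> carrier F" "\<phi> (f s) \<in> carrier F"
    using insert linear_formD(1)[OF \<phi>] by auto
  then have "(\<Oplus>\<^bsub>V\<^esub>s\<in>S. f s) \<in> carrier V" by (intro M.finsum_closed)
  then show ?case using insert c linear_formD(2)[OF \<phi>] by simp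
qed

lemma submodule_finsum:
  assumes U: "submodule U F V" and "finite S" "\<And>s. s \<in> S \<Longrightarrow> f s \<in> U"
  shows "(\<Oplus>\<^bsub>V\<^esub>s\<in>S. f s) \<in> U"
  using assms(2,3)
proof (induct S rule: finite_induct)
  case empty then show ?case using submoduleD(2)[OF U] by simp
next
  case (insert s S)
  have "f \<in> S \<rightarrow> carrier V" "f s \<in> carrier V" using insert submoduleD(1)[OF U] by auto
  then show ?case using insert submoduleD(3)[OF U] by simp
qed

end

section \<open>Points of affine domains\<close>

text \<open>A ring homomorphism \<open>\<psi>\<close> from a subring \<open>A\<close> of \<open>B\<close> to \<open>D\<close>, with a point \<open>\<sigma>\<close> of \<open>D\<close> at which polynomials over \<open>A\<close> are
  evaluated. Polynomials are plain coefficient lists, leading coefficient first; leading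
  zeros are allowed, so that lists of different polynomials can be padded to the same length.\<close>

locale coeff_hom = B: cring B + D: cring D for B (structure) and D (structure) +
  fixes A \<psi> \<sigma>
  assumes A: "subring A B" and \<psi>: "\<psi> \<in> ring_hom (B\<lparr>carrier := A\<rparr>) D" and \<sigma>: "\<sigma> \<in> carrier D"
begin

definition ev where "ev m = D.eval (map \<psi> m) \<sigma>"

lemma A_simps:
  "A \<subseteq> carrier B" "\<zero> \<in> A" "\<one> \<in> A"
  "x \<in> A \<Longrightarrow> y \<in> A \<Longrightarrow> x \<oplus> y \<in> A" "x \<in> A \<Longrightarrow> y \<in> A \<Longrightarrow> x \<otimes> y \<in> A"
  "x \<in> A \<Longrightarrow> \<ominus> x \<in> A" "x \<in> A \<Longrightarrow> y \<in> A \<Longrightarrow> x \<ominus> y \<in> A"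
  "x \<in> A \<Longrightarrow> x [^] (n::nat) \<in> A"
proof -
  note E = subringE[OF A]
  show "A \<subseteq> carrier B" "\<zero> \<in> A" "\<one> \<in> A"
    "x \<in> A \<Longrightarrow> y \<in> A \<Longrightarrow> x \<oplus> y \<in> A" "x \<in> A \<Longrightarrow> y \<in> A \<Longrightarrow> x \<otimes> y \<in> A"
    "x \<in> A \<Longrightarrow> \<ominus> x \<in> A" "x \<in> A \<Longrightarrow> y \<in> A \<Longrightarrow> x \<ominus> y \<in> A"
    using E unfolding a_minus_def by auto
  show "x \<in> A \<Longrightarrow> x [^] (n::nat) \<in> A" using E(3,6) by (induct n) auto
qed

lemma \<psi>_simps:
  "x \<in> A \<Longrightarrow> \<psi> x \<in> carrier D"
  "x \<in> A \<Longrightarrow> y \<in> A \<Longrightarrow> \<psi> (x \<otimes> y) = \<psi> x \<otimes>\<^bsub>D\<^esub> \<psi> y"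
  "x \<in> A \<Longrightarrow> y \<in> A \<Longrightarrow> \<psi> (x \<oplus> y) = \<psi> x \<oplus>\<^bsub>D\<^esub> \<psi> y"
  "\<psi> \<one> = \<one>\<^bsub>D\<^esub>" "\<psi> \<zero> = \<zero>\<^bsub>D\<^esub>" 
  "x \<in> A \<Longrightarrow> \<psi> (\<ominus> x) = \<ominus>\<^bsub>D\<^esub> \<psi> x"
  "x \<in> A \<Longrightarrow> y \<in> A \<Longrightarrow> \<psi> (x \<ominus> y) = \<psi> x \<ominus>\<^bsub>D\<^esub> \<psi> y"
proof -
  show 1: "x \<in> A \<Longrightarrow> \<psi> x \<in> carrier D" for x using ring_hom_memE(1)[OF \<psi>] by simp
  show "x \<in> A \<Longrightarrow> y \<in> A \<Longrightarrow> \<psi> (x \<otimes> y) = \<psi> x \<otimes>\<^bsub>D\<^esub> \<psi> y"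
    using ring_hom_memE(2)[OF \<psi>] by simp
  show 2: "x \<in> A \<Longrightarrow> y \<in> A \<Longrightarrow> \<psi> (x \<oplus> y) = \<psi> x \<oplus>\<^bsub>D\<^esub> \<psi> y" for x y
    using ring_hom_memE(3)[OF \<psi>] by simp
  show "\<psi> \<one> = \<one>\<^bsub>D\<^esub>" using ring_hom_memE(4)[OF \<psi>] by simp
  have "\<psi> \<zero> \<oplus>\<^bsub>D\<^esub> \<psi> \<zero> = \<psi> \<zero>" using 2[OF A_simps(2,2)] by simp
  then show 3: "\<psi> \<zero> = \<zero>\<^bsub>D\<^esub>" using 1[OF A_simps(2)] by (metis D.add.l_cancel_one)
  show 4: "\<psi> (\<ominus> x) = \<ominus>\<^bsub>D\<^esub> \<psi> x" if "x \<in> A" for x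
  proof -
    have "x \<in> carrier B" using that A_simps(1) by auto
    then have "\<psi> (\<ominus> x) \<oplus>\<^bsub>D\<^esub> \<psi> x = \<zero>\<^bsub>D\<^esub>"
      using 2[OF A_simps(6)[OF that] that] 3 by (simp add: B.l_neg)
    then show ?thesis using 1 that A_simps(6) by (metis D.minus_equality)
  qed
  show "x \<in> A \<Longrightarrow> y \<in> A \<Longrightarrow> \<psi> (x \<ominus> y) = \<psi> x \<ominus>\<^bsub>D\<^esub> \<psi> y"
    using 2[OF _ A_simps(6)] 4 unfolding a_minus_def by simp
qed

lemma \<psi>_pow: "x \<in> A \<Longrightarrow> \<psi> (x [^] (n::nat)) = \<psi> x [^]\<^bsub>D\<^esub> n"
  by (induct n) (simp_all add: \<psi>_simps A_simps)

lemma ev_closed [simp]: "set m \<subseteq> A \<Longrightarrow> ev m \<in> carrier D"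
  unfolding ev_def using \<psi>_simps(1) by (intro D.eval_in_carrier) (auto simp: \<sigma>)

lemma ev_Nil [simp]: "ev [] = \<zero>\<^bsub>D\<^esub>" unfolding ev_def by simp

lemma ev_Cons: "ev (c # m) = \<psi> c \<otimes>\<^bsub>D\<^esub> \<sigma> [^]\<^bsub>D\<^esub> length m \<oplus>\<^bsub>D\<^esub> ev m"
  unfolding ev_def by simp

lemma ev_snoc: "set m \<subseteq> A \<Longrightarrow> c \<in> A \<Longrightarrow> ev (m @ [c]) = ev m \<otimes>\<^bsub>D\<^esub> \<sigma> \<oplus>\<^bsub>D\<^esub> \<psi> c"
  unfolding ev_def using \<psi>_simps(1) by (simp, intro D.eval_append_aux) (auto simp: \<sigma>)

lemma ev_zeros: "ev (replicate j \<zero> @ m) = ev m" if "set m \<subseteq> A"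
  using that by (induct j) (simp_all add: ev_Cons \<psi>_simps \<sigma>)

lemma ev_all_zero: "set m \<subseteq> {\<zero>} \<Longrightarrow> ev m = \<zero>\<^bsub>D\<^esub>"
  by (induct m) (simp_all add: ev_Cons \<psi>_simps \<sigma>)

lemma ev_shift: "ev (m @ replicate j \<zero>) = ev m \<otimes>\<^bsub>D\<^esub> \<sigma> [^]\<^bsub>D\<^esub> j" if m: "set m \<subseteq> A"
proof (induct j)
  case (Suc j)
  have s: "set (m @ replicate j \<zero>) \<subseteq> A" using m A_simps(2) by auto
  have "ev (m @ replicate (Suc j) \<zero>) = ev ((m @ replicate j \<zero>) @ [\<zero>])"
    by (simp add: replicate_append_same)
  also have "\<dots> = ev (m @ replicate j \<zero>) \<otimes>\<^bsub>D\<^esub> \<sigma> \<oplus>\<^bsub>D\<^esub> \<zero>\<^bsub>D\<^esub>"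
    using ev_snoc[OF s A_simps(2)] \<psi>_simps(5) by simp
  also have "\<dots> = ev m \<otimes>\<^bsub>D\<^esub> \<sigma> [^]\<^bsub>D\<^esub> Suc j" using Suc m \<sigma> by (simp add: D.m_assoc)
  finally show ?case .
qed (use m in simp)

definition lin_comb where "lin_comb c d = map2 (\<lambda>x y. c \<otimes> x \<oplus> d \<otimes> y)"

lemma lin_comb_in: "set m \<subseteq> A \<Longrightarrow> set l \<subseteq> A \<Longrightarrow> c \<in> A \<Longrightarrow> d \<in> A \<Longrightarrow> set (lin_comb c d m l) \<subseteq> A"
  unfolding lin_comb_def by (force dest: set_zip_leftD set_zip_rightD intro: A_simps(4,5))

lemma ev_lin_comb:
  "length m = length l \<Longrightarrow> set m \<subseteq> A \<Longrightarrow> set l \<subseteq> A \<Longrightarrow> c \<in> A \<Longrightarrow> d \<in> A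
   \<Longrightarrow> ev (lin_comb c d m l) = \<psi> c \<otimes>\<^bsub>D\<^esub> ev m \<oplus>\<^bsub>D\<^esub> \<psi> d \<otimes>\<^bsub>D\<^esub> ev l"
proof (induct m l rule: list_induct2)
  case Nil then show ?case by (simp add: lin_comb_def \<psi>_simps)
next
  case (Cons x m y l)
  have "lin_comb c d (x # m) (y # l) = (c \<otimes> x \<oplus> d \<otimes> y) # lin_comb c d m l"
    by (simp add: lin_comb_def)
  moreover have "length (lin_comb c d m l) = length l" using Cons by (simp add: lin_comb_def)
  moreover have "\<psi> x \<in> carrier D" "\<psi> y \<in> carrier D" "\<psi> c \<in> carrier D" "\<psi> d \<in> carrier D"
    "ev m \<in> carrier D" "ev l \<in> carrier D" "\<sigma> [^]\<^bsub>D\<^esub> length l \<in> carrier D"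
    using Cons \<psi>_simps(1) \<sigma> by auto
  moreover have "(C \<otimes>\<^bsub>D\<^esub> X1 \<oplus>\<^bsub>D\<^esub> E \<otimes>\<^bsub>D\<^esub> Y1) \<otimes>\<^bsub>D\<^esub> S \<oplus>\<^bsub>D\<^esub> (C \<otimes>\<^bsub>D\<^esub> M \<oplus>\<^bsub>D\<^esub> E \<otimes>\<^bsub>D\<^esub> L)
      = C \<otimes>\<^bsub>D\<^esub> (X1 \<otimes>\<^bsub>D\<^esub> S \<oplus>\<^bsub>D\<^esub> M) \<oplus>\<^bsub>D\<^esub> E \<otimes>\<^bsub>D\<^esub> (Y1 \<otimes>\<^bsub>D\<^esub> S \<oplus>\<^bsub>D\<^esub> L)"
    if "C \<in> carrier D" "X1 \<in> carrier D" "E \<in> carrier D" "Y1 \<in> carrier D" "S \<in> carrier D"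
      "M \<in> carrier D" "L \<in> carrier D" for C X1 E Y1 S M L
    using that by (simp add: D.r_distr D.l_distr D.m_assoc D.a_ac)
  ultimately show ?case using Cons(1,2,3,4,5,6)
    by (simp add: ev_Cons \<psi>_simps A_simps)
qed

lemma ev_add:
  assumes "set m \<subseteq> A" "set l \<subseteq> A"
  shows "\<exists>k. set k \<subseteq> A \<and> ev k = ev m \<oplus>\<^bsub>D\<^esub> ev l"
proof -
  define m' l' where "m' = replicate (length l) \<zero> @ m" and "l' = replicate (length m) \<zero> @ l"
  have *: "set m' \<subseteq> A" "set l' \<subseteq> A" "length m' = length l'"
    using assms A_simps(2) unfolding m'_def l'_def by auto
  have "ev (lin_comb \<one> \<one> m' l') = ev m \<oplus>\<^bsub>D\<^esub> ev l"
    using ev_lin_comb[OF *(3,1,2) A_simps(3,3)] assms ev_zeros[OF assms(1)] ev_zeros[OF assms(2)]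
    by (simp add: \<psi>_simps m'_def l'_def)
  then show ?thesis using lin_comb_in[OF *(1,2) A_simps(3,3)] by blast
qed

lemma ev_smult:
  assumes "set m \<subseteq> A" "c \<in> A"
  shows "\<exists>k. set k \<subseteq> A \<and> ev k = \<psi> c \<otimes>\<^bsub>D\<^esub> ev m"
  using ev_lin_comb[OF refl assms(1,1,2) A_simps(2)] lin_comb_in[OF assms(1,1,2) A_simps(2)] assms
  by (intro exI[of _ "lin_comb c \<zero> m m"]) (simp add: \<psi>_simps)

lemma ev_mult:
  assumes "set m \<subseteq> A" "set l \<subseteq> A"
  shows "\<exists>k. set k \<subseteq> A \<and> ev k = ev m \<otimes>\<^bsub>D\<^esub> ev l"
  using assms(2)
proof (induct l rule: rev_induct)
  case Nil
  show ?case using assms(1) by (intro exI[of _ "[]"]) simp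
next
  case (snoc c l)
  then obtain k where k: "set k \<subseteq> A" "ev k = ev m \<otimes>\<^bsub>D\<^esub> ev l" by auto
  obtain k' where k': "set k' \<subseteq> A" "ev k' = \<psi> c \<otimes>\<^bsub>D\<^esub> ev m" using ev_smult[OF assms(1), of c] snoc(2) by auto
  obtain k'' where k'': "set k'' \<subseteq> A" "ev k'' = ev (k @ [\<zero>]) \<oplus>\<^bsub>D\<^esub> ev k'"
    using ev_add[of "k @ [\<zero>]" k'] k k' A_simps(2) by auto
  have c: "c \<in> A" "\<psi> c \<in> carrier D" "set l \<subseteq> A" using snoc(2) \<psi>_simps by auto
  have "ev k'' = ev m \<otimes>\<^bsub>D\<^esub> ev (l @ [c])"
    using k k' k'' c \<sigma> assms(1) A_simps(2)
    by (simp add: ev_snoc \<psi>_simps(5) D.r_distr D.m_assoc D.m_comm[of "\<psi> c"])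
  then show ?case using k'' by blast
qed

lemma values_subring: "subring {ev m | m. set m \<subseteq> A} D"
proof (rule D.subringI)
  show "{ev m |m. set m \<subseteq> A} \<subseteq> carrier D" by auto
  show "\<one>\<^bsub>D\<^esub> \<in> {ev m |m. set m \<subseteq> A}"
    by (intro CollectI exI[of _ "[\<one>]"]) (simp add: ev_Cons \<psi>_simps A_simps)
next
  fix h assume "h \<in> {ev m |m. set m \<subseteq> A}"
  then obtain m where m: "set m \<subseteq> A" "h = ev m" by blast
  then obtain k where k: "set k \<subseteq> A" "ev k = \<psi> (\<ominus> \<one>) \<otimes>\<^bsub>D\<^esub> ev m"
    using ev_smult[OF m(1) A_simps(6)[OF A_simps(3)]] by blast
  then have "ev k = \<ominus>\<^bsub>D\<^esub> h" using m by (simp add: \<psi>_simps A_simps D.l_minus)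
  then show "\<ominus>\<^bsub>D\<^esub> h \<in> {ev m |m. set m \<subseteq> A}" using k by force
next
  fix x y assume "x \<in> {ev m |m. set m \<subseteq> A}" "y \<in> {ev m |m. set m \<subseteq> A}"
  then obtain m l where ml: "set m \<subseteq> A" "x = ev m" "set l \<subseteq> A" "y = ev l" by blast
  show "x \<otimes>\<^bsub>D\<^esub> y \<in> {ev m |m. set m \<subseteq> A}" "x \<oplus>\<^bsub>D\<^esub> y \<in> {ev m |m. set m \<subseteq> A}"
    using ev_mult[OF ml(1,3)] ev_add[OF ml(1,3)] ml by force+
qed

lemma values_generate: "generate_ring D (insert \<sigma> (\<psi> ` A)) = {ev m | m. set m \<subseteq> A}" (is "?G = ?E")
proof
  have sub: "insert \<sigma> (\<psi> ` A) \<subseteq> carrier D" using \<sigma> \<psi>_simps(1) by auto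
  have "\<sigma> \<in> ?E"
    by (intro CollectI exI[of _ "[\<one>, \<zero>]"]) (use \<sigma> in \<open>simp add: ev_Cons \<psi>_simps A_simps\<close>)
  moreover have "\<psi> c \<in> ?E" if "c \<in> A" for c
    by (intro CollectI exI[of _ "[c]"]) (use that in \<open>simp add: ev_Cons \<psi>_simps A_simps\<close>)
  ultimately show "?G \<subseteq> ?E" using D.generate_ring_min_subring1[OF sub values_subring] by auto
  have G: "subring ?G D" using D.generate_ring_is_subring[OF sub] .
  have pw: "\<sigma> [^]\<^bsub>D\<^esub> (n::nat) \<in> ?G" for n
    by (induct n) (auto intro: generate_ring.intros)
  have "ev m \<in> ?G" if "set m \<subseteq> A" for m
    using that
  proof (induct m)
    case Nil then show ?case using D.zero_in_generate by simp
  next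
    case (Cons c m)
    have "\<psi> c \<in> ?G" using Cons(2) by (intro generate_ring.incl) auto
    then show ?case using pw[of "length m"] Cons
      by (simp add: ev_Cons generate_ring.eng_add generate_ring.eng_mult)
  qed
  then show "?E \<subseteq> ?G" by blast
qed

text \<open>Division with remainder of \<open>m\<close> by the polynomial \<open>c # l'\<close> after multiplication with a power of the leading
  coefficient \<open>c\<close>. The leading coefficient of the quotient is recorded because later arguments need it to
  be nonzero.\<close>

lemma pseudo_division:
  assumes "set l' \<subseteq> A" "c \<in> A" "set m \<subseteq> A" "length m = length l' + j"
  shows "\<exists>h r. set h \<subseteq> A \<and> set r \<subseteq> A \<and> length h = j \<and> length r = length l'
     \<and> (0 < j \<longrightarrow> hd h = c [^] (j - 1) \<otimes> hd m)
     \<and> \<psi> c [^]\<^bsub>D\<^esub> j \<otimes>\<^bsub>D\<^esub> ev m = ev (c # l') \<otimes>\<^bsub>D\<^esub> ev h \<oplus>\<^bsub>D\<^esub> ev r"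
  using assms(3,4)
proof (induct j arbitrary: m)
  case 0
  then show ?case using assms by (intro exI[of _ "[]"] exI[of _ m]) simp
next
  case (Suc j)
  then obtain d m' where m: "m = d # m'" by (cases m) auto
  have d: "d \<in> A" "set m' \<subseteq> A" "length m' = length l' + j" using Suc m by auto
  define l'' where "l'' = l' @ replicate j \<zero>"
  have l'': "set l'' \<subseteq> A" "length m' = length l''" using assms A_simps(2) d by (auto simp: l''_def)
  define m'' where "m'' = lin_comb c (\<ominus> d) m' l''"
  have nd: "\<ominus> d \<in> A" by (rule A_simps(6)[OF d(1)])
  have m'': "set m'' \<subseteq> A" "length m'' = length l' + j"
    using lin_comb_in[OF d(2) l''(1) assms(2) nd] l'' d by (auto simp: m''_def lin_comb_def)
  have e'': "ev m'' = \<psi> c \<otimes>\<^bsub>D\<^esub> ev m' \<oplus>\<^bsub>D\<^esub> (\<ominus>\<^bsub>D\<^esub> \<psi> d) \<otimes>\<^bsub>D\<^esub> (ev l' \<otimes>\<^bsub>D\<^esub> \<sigma> [^]\<^bsub>D\<^esub> j)"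
    unfolding m''_def using ev_lin_comb[OF l''(2) d(2) l''(1) assms(2) nd] d assms
    by (simp add: \<psi>_simps l''_def ev_shift)
  obtain h r where hr: "set h \<subseteq> A" "set r \<subseteq> A" "length h = j" "length r = length l'"
     "\<psi> c [^]\<^bsub>D\<^esub> j \<otimes>\<^bsub>D\<^esub> ev m'' = ev (c # l') \<otimes>\<^bsub>D\<^esub> ev h \<oplus>\<^bsub>D\<^esub> ev r"
    using Suc(1)[OF m''] by blast
  define h' where "h' = (c [^] j \<otimes> d) # h"
  have h': "set h' \<subseteq> A" "length h' = Suc j" "hd h' = c [^] (Suc j - 1) \<otimes> hd m"
    using hr assms d A_simps m by (auto simp: h'_def)
  define C E M S L H W T where "C = \<psi> c" and "E = \<psi> d" and "M = ev m'" and "S = \<sigma> [^]\<^bsub>D\<^esub> j"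
    and "L = ev l'" and "H = ev h" and "W = ev r" and "T = \<sigma> [^]\<^bsub>D\<^esub> length l'"
  have car: "C \<in> carrier D" "E \<in> carrier D" "M \<in> carrier D" "S \<in> carrier D" "L \<in> carrier D"
    "H \<in> carrier D" "W \<in> carrier D" "T \<in> carrier D"  "C [^]\<^bsub>D\<^esub> j \<in> carrier D"
    unfolding C_def E_def M_def S_def L_def H_def W_def T_def
    using assms d hr \<psi>_simps(1) \<sigma> by auto
  have evm: "ev m = E \<otimes>\<^bsub>D\<^esub> (T \<otimes>\<^bsub>D\<^esub> S) \<oplus>\<^bsub>D\<^esub> M"
    unfolding E_def T_def S_def M_def m ev_Cons d(3) using \<sigma> by (simp add: D.nat_pow_mult)
  have evl: "ev (c # l') = C \<otimes>\<^bsub>D\<^esub> T \<oplus>\<^bsub>D\<^esub> L"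
    unfolding C_def T_def L_def ev_Cons ..
  have evh: "ev h' = (C [^]\<^bsub>D\<^esub> j \<otimes>\<^bsub>D\<^esub> E) \<otimes>\<^bsub>D\<^esub> S \<oplus>\<^bsub>D\<^esub> H"
    unfolding h'_def ev_Cons hr(3) C_def E_def S_def H_def using assms d
    by (simp add: \<psi>_simps A_simps \<psi>_pow)
  define K where "K = C [^]\<^bsub>D\<^esub> j"
  have Kc: "K \<in> carrier D" using car K_def by simp
  have ih: "K \<otimes>\<^bsub>D\<^esub> (C \<otimes>\<^bsub>D\<^esub> M \<oplus>\<^bsub>D\<^esub> (\<ominus>\<^bsub>D\<^esub> E) \<otimes>\<^bsub>D\<^esub> (L \<otimes>\<^bsub>D\<^esub> S)) = (C \<otimes>\<^bsub>D\<^esub> T \<oplus>\<^bsub>D\<^esub> L) \<otimes>\<^bsub>D\<^esub> H \<oplus>\<^bsub>D\<^esub> W"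
    using hr(5) unfolding e'' evl K_def C_def E_def M_def S_def L_def H_def W_def .
  have "K \<otimes>\<^bsub>D\<^esub> C \<otimes>\<^bsub>D\<^esub> (E \<otimes>\<^bsub>D\<^esub> (T \<otimes>\<^bsub>D\<^esub> S) \<oplus>\<^bsub>D\<^esub> M)
     = K \<otimes>\<^bsub>D\<^esub> (C \<otimes>\<^bsub>D\<^esub> M \<oplus>\<^bsub>D\<^esub> (\<ominus>\<^bsub>D\<^esub> E) \<otimes>\<^bsub>D\<^esub> (L \<otimes>\<^bsub>D\<^esub> S)) \<oplus>\<^bsub>D\<^esub> (C \<otimes>\<^bsub>D\<^esub> T \<oplus>\<^bsub>D\<^esub> L) \<otimes>\<^bsub>D\<^esub> (K \<otimes>\<^bsub>D\<^esub> E \<otimes>\<^bsub>D\<^esub> S)"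
    using car(1-8) Kc by algebra
  also have "\<dots> = (C \<otimes>\<^bsub>D\<^esub> T \<oplus>\<^bsub>D\<^esub> L) \<otimes>\<^bsub>D\<^esub> ((K \<otimes>\<^bsub>D\<^esub> E) \<otimes>\<^bsub>D\<^esub> S \<oplus>\<^bsub>D\<^esub> H) \<oplus>\<^bsub>D\<^esub> W"
    unfolding ih using car(1-8) Kc by algebra
  finally have "\<psi> c [^]\<^bsub>D\<^esub> Suc j \<otimes>\<^bsub>D\<^esub> ev m = ev (c # l') \<otimes>\<^bsub>D\<^esub> ev h' \<oplus>\<^bsub>D\<^esub> ev r"
    unfolding evm evl evh W_def[symmetric] unfolding K_def C_def by simp
  then show ?case using h' hr(2,4) by blast
qed

lemma strip_zeros:
  assumes "set m \<subseteq> A" "\<not> set m \<subseteq> {\<zero>}"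
  obtains c l where "c \<in> A" "c \<noteq> \<zero>" "set l \<subseteq> A" "length (c # l) \<le> length m" "ev (c # l) = ev m"
  using assms
proof (induct m arbitrary: thesis)
  case (Cons x m)
  show ?case
  proof (cases "x = \<zero>")
    case True
    then have "ev (x # m) = ev m" using Cons(3) \<sigma> by (simp add: ev_Cons \<psi>_simps)
    moreover have "set m \<subseteq> A" "\<not> set m \<subseteq> {\<zero>}" using Cons(3,4) True by auto
    ultimately show thesis using Cons(1)[OF _ \<open>set m \<subseteq> A\<close>] Cons(2) by (metis le_Suc_eq length_Cons)
  next
    case False
    then show thesis using Cons(2)[of x m] Cons(3) by simp
  qed
qed simp

end

lemma RDirProd_simps:
  "carrier (RDirProd R S) = carrier R \<times> carrier S"
  "x \<otimes>\<^bsub>RDirProd R S\<^esub> y = (fst x \<otimes>\<^bsub>R\<^esub> fst y, snd x \<otimes>\<^bsub>S\<^esub> snd y)"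
  "x \<oplus>\<^bsub>RDirProd R S\<^esub> y = (fst x \<oplus>\<^bsub>R\<^esub> fst y, snd x \<oplus>\<^bsub>S\<^esub> snd y)"
  "\<one>\<^bsub>RDirProd R S\<^esub> = (\<one>\<^bsub>R\<^esub>, \<one>\<^bsub>S\<^esub>)"
  "\<zero>\<^bsub>RDirProd R S\<^esub> = (\<zero>\<^bsub>R\<^esub>, \<zero>\<^bsub>S\<^esub>)"
  "x [^]\<^bsub>RDirProd R S\<^esub> (n::nat) = (fst x [^]\<^bsub>R\<^esub> n, snd x [^]\<^bsub>S\<^esub> n)"
proof -
  show 1: "x \<otimes>\<^bsub>RDirProd R S\<^esub> y = (fst x \<otimes>\<^bsub>R\<^esub> fst y, snd x \<otimes>\<^bsub>S\<^esub> snd y)" for x y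
    by (simp add: RDirProd_def DirProd_def monoid.defs split_beta)
  show 2: "\<one>\<^bsub>RDirProd R S\<^esub> = (\<one>\<^bsub>R\<^esub>, \<one>\<^bsub>S\<^esub>)"
    by (simp add: RDirProd_def DirProd_def monoid.defs)
  show "x [^]\<^bsub>RDirProd R S\<^esub> (n::nat) = (fst x [^]\<^bsub>R\<^esub> n, snd x [^]\<^bsub>S\<^esub> n)"
    by (induct n) (simp_all add: 1 2)
  show "carrier (RDirProd R S) = carrier R \<times> carrier S" by (rule RDirProd_carrier)
  show "x \<oplus>\<^bsub>RDirProd R S\<^esub> y = (fst x \<oplus>\<^bsub>R\<^esub> fst y, snd x \<oplus>\<^bsub>S\<^esub> snd y)"
    by (simp add: RDirProd_def DirProd_def monoid.defs split_beta)
  show "\<zero>\<^bsub>RDirProd R S\<^esub> = (\<zero>\<^bsub>R\<^esub>, \<zero>\<^bsub>S\<^esub>)"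
    by (simp add: RDirProd_def DirProd_def monoid.defs)
qed

lemma RDirProd_cring:
  assumes "cring R" "cring S" shows "cring (RDirProd R S)"
proof -
  interpret R: cring R by fact
  interpret S: cring S by fact
  interpret D: ring "RDirProd R S" by (rule RDirProd_ring[OF R.ring_axioms S.ring_axioms])
  show ?thesis
  proof (rule cring.intro[OF D.ring_axioms], rule comm_monoid.intro[OF D.monoid_axioms], rule comm_monoid_axioms.intro)
    fix x y assume "x \<in> carrier (RDirProd R S)" "y \<in> carrier (RDirProd R S)"
    then show "x \<otimes>\<^bsub>RDirProd R S\<^esub> y = y \<otimes>\<^bsub>RDirProd R S\<^esub> x"
      using R.m_comm[of "fst x" "fst y"] S.m_comm[of "snd x" "snd y"]
      by (auto simp: RDirProd_simps)
  qed
qed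

text \<open>Evaluating over the product ring \<open>B \<times> F\<close> at the point \<open>(s, \<xi>)\<close> keeps track of the value \<open>p(s)\<close> and of the value
  at \<open>\<xi>\<close> of the polynomial with coefficients transported by \<open>\<phi>\<close> at the same time, so that one pseudo-division
  serves both.\<close>

locale hom_pair = B: cring B + F: cring F for B (structure) and F (structure) +
  fixes A \<phi> s \<xi>
  assumes A: "subring A B" and \<phi>: "\<phi> \<in> ring_hom (B\<lparr>carrier := A\<rparr>) F"
    and s: "s \<in> carrier B" and \<xi>: "\<xi> \<in> carrier F"
begin

sublocale E1: coeff_hom B B A "\<lambda>x. x" s
proof (rule coeff_hom.intro[OF B.cring_axioms B.cring_axioms coeff_hom_axioms.intro[OF A _ s]])
  show "(\<lambda>x. x) \<in> ring_hom (B\<lparr>carrier := A\<rparr>) B"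
    using subringE(1)[OF A] by (intro ring_hom_memI) auto
qed

sublocale E2: coeff_hom B F A \<phi> \<xi>
  by (rule coeff_hom.intro[OF B.cring_axioms F.cring_axioms coeff_hom_axioms.intro[OF A \<phi> \<xi>]])

lemma coeff_hom_prod: "coeff_hom B (RDirProd B F) A (\<lambda>a. (a, \<phi> a)) (s, \<xi>)"
proof -
  interpret D: cring "RDirProd B F" by (rule RDirProd_cring[OF B.cring_axioms F.cring_axioms])
  have "(\<lambda>a. (a, \<phi> a)) \<in> ring_hom (B\<lparr>carrier := A\<rparr>) (RDirProd B F)"
  proof (rule ring_hom_memI)
    fix x assume "x \<in> carrier (B\<lparr>carrier := A\<rparr>)"
    then show "(x, \<phi> x) \<in> carrier (RDirProd B F)"
      using E1.A_simps(1) E2.\<psi>_simps(1)[of x] by (auto simp: RDirProd_simps)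
  qed (simp_all add: RDirProd_simps E2.\<psi>_simps)
  then show ?thesis
    by (rule coeff_hom.intro[OF B.cring_axioms D.cring_axioms coeff_hom_axioms.intro[OF A]])
      (simp add: s \<xi> RDirProd_simps)
qed

sublocale E: coeff_hom B "RDirProd B F" A "\<lambda>a. (a, \<phi> a)" "(s, \<xi>)"
  by (rule coeff_hom_prod)

lemma E_ev: "E.ev m = (E1.ev m, E2.ev m)"
  by (induct m) (simp_all add: E.ev_Cons E1.ev_Cons E2.ev_Cons RDirProd_simps)

text \<open>The extension sends \<open>p(s)\<close> to the value of the transported polynomial at \<open>\<xi>\<close>; the hypothesis says
  that this does not depend on \<open>p\<close>.\<close>

lemma extend_hom:
  assumes wd: "\<And>m. set m \<subseteq> A \<Longrightarrow> E1.ev m = \<zero> \<Longrightarrow> E2.ev m = \<zero>\<^bsub>F\<^esub>"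
  shows "\<exists>\<phi>'\<in>ring_hom (B\<lparr>carrier := generate_ring B (insert s A)\<rparr>) F.
    (\<forall>a\<in>A. \<phi>' a = \<phi> a) \<and> (\<forall>m. set m \<subseteq> A \<longrightarrow> \<phi>' (E1.ev m) = E2.ev m)"
proof -
  have G: "generate_ring B (insert s A) = {E1.ev m | m. set m \<subseteq> A}"
    using E1.values_generate by simp
  have eq: "E2.ev m = E2.ev l" if ml: "set m \<subseteq> A" "set l \<subseteq> A" "E1.ev m = E1.ev l" for m l
  proof -
    have n1: "\<ominus> \<one> \<in> A" by (intro E1.A_simps(6) E1.A_simps(3))
    obtain k where k: "set k \<subseteq> A" "E.ev k = (\<ominus> \<one>, \<phi> (\<ominus> \<one>)) \<otimes>\<^bsub>RDirProd B F\<^esub> E.ev l"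
      using E.ev_smult[OF ml(2) n1] by blast
    obtain k' where k': "set k' \<subseteq> A" "E.ev k' = E.ev m \<oplus>\<^bsub>RDirProd B F\<^esub> E.ev k"
      using E.ev_add[OF ml(1) k(1)] by blast
    have c: "E1.ev l \<in> carrier B" "E2.ev l \<in> carrier F" "E2.ev m \<in> carrier F" using ml by auto
    have "E1.ev k' = \<zero>" using k k' ml c
      by (simp add: E_ev RDirProd_simps B.l_minus B.r_neg)
    then have "E2.ev k' = \<zero>\<^bsub>F\<^esub>" using wd k'(1) by blast
    then have "E2.ev m \<oplus>\<^bsub>F\<^esub> (\<ominus>\<^bsub>F\<^esub> E2.ev l) = \<zero>\<^bsub>F\<^esub>" using k k' c n1
      by (simp add: E_ev RDirProd_simps F.l_minus E2.\<psi>_simps E1.A_simps)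
    then show ?thesis using c by (metis F.minus_equality F.minus_minus F.a_inv_closed)
  qed
  define \<phi>' where "\<phi>' v = E2.ev (SOME m. set m \<subseteq> A \<and> E1.ev m = v)" for v
  have \<phi>': "\<phi>' (E1.ev m) = E2.ev m" if "set m \<subseteq> A" for m
  proof -
    have "set (SOME l. set l \<subseteq> A \<and> E1.ev l = E1.ev m) \<subseteq> A \<and> E1.ev (SOME l. set l \<subseteq> A \<and> E1.ev l = E1.ev m) = E1.ev m"
      by (rule someI[of _ m]) (use that in simp)
    then show ?thesis unfolding \<phi>'_def using eq that by blast
  qed
  have ext: "\<phi>' a = \<phi> a" if "a \<in> A" for a
    using \<phi>'[of "[a]"] that E1.A_simps(1) by (simp add: E1.ev_Cons E2.ev_Cons E2.\<psi>_simps subset_iff)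
  have "\<phi>' \<in> ring_hom (B\<lparr>carrier := generate_ring B (insert s A)\<rparr>) F"
  proof (rule ring_hom_memI)
    fix x assume "x \<in> carrier (B\<lparr>carrier := generate_ring B (insert s A)\<rparr>)"
    then show "\<phi>' x \<in> carrier F" unfolding G using \<phi>' by auto
  next
    fix x y assume "x \<in> carrier (B\<lparr>carrier := generate_ring B (insert s A)\<rparr>)"
      "y \<in> carrier (B\<lparr>carrier := generate_ring B (insert s A)\<rparr>)"
    then obtain m l where ml: "set m \<subseteq> A" "set l \<subseteq> A" "x = E1.ev m" "y = E1.ev l"
      unfolding G by auto
    obtain k where "set k \<subseteq> A" "E.ev k = E.ev m \<otimes>\<^bsub>RDirProd B F\<^esub> E.ev l" using E.ev_mult ml by blast
    then show "\<phi>' (x \<otimes>\<^bsub>B\<lparr>carrier := generate_ring B (insert s A)\<rparr>\<^esub> y) = \<phi>' x \<otimes>\<^bsub>F\<^esub> \<phi>' y"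
      using \<phi>'[of k] \<phi>'[of m] \<phi>'[of l] ml by (simp add: E_ev RDirProd_simps)
    obtain k where "set k \<subseteq> A" "E.ev k = E.ev m \<oplus>\<^bsub>RDirProd B F\<^esub> E.ev l" using E.ev_add ml by blast
    then show "\<phi>' (x \<oplus>\<^bsub>B\<lparr>carrier := generate_ring B (insert s A)\<rparr>\<^esub> y) = \<phi>' x \<oplus>\<^bsub>F\<^esub> \<phi>' y"
      using \<phi>'[of k] \<phi>'[of m] \<phi>'[of l] ml by (simp add: E_ev RDirProd_simps)
  next
    show "\<phi>' \<one>\<^bsub>B\<lparr>carrier := generate_ring B (insert s A)\<rparr>\<^esub> = \<one>\<^bsub>F\<^esub>"
      using ext[OF E1.A_simps(3)] by (simp add: E2.\<psi>_simps)
  qed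
  then show ?thesis using ext \<phi>' by blast
qed

end

lemma (in algebraically_closed) root_exists:
  assumes "c \<in> carrier L" "c \<noteq> \<zero>" "set l \<subseteq> carrier L" "l \<noteq> []"
  shows "\<exists>x\<in>carrier L. eval (c # l) x = \<zero>"
proof -
  have p: "c # l \<in> carrier (poly_ring L)"
    using assms unfolding univ_poly_carrier[symmetric] polynomial_def by auto
  then have "splitted (c # l)" by (rule roots_over_carrier)
  then have "roots (c # l) \<noteq> {#}" using assms(4) unfolding splitted_def by auto
  then obtain x where "x \<in># roots (c # l)" by blast
  then show ?thesis using roots_mem_iff_is_root[OF p] unfolding is_root_def by blast
qed

text \<open>A root of the polynomial minus \<open>1\<close> is a point where the polynomial takes the value \<open>1\<close>.\<close>

lemma (in algebraically_closed) nonroot_exists: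
  assumes "c \<in> carrier L" "c \<noteq> \<zero>" "set l \<subseteq> carrier L"
  shows "\<exists>x\<in>carrier L. eval (c # l) x \<noteq> \<zero>"
proof (cases l rule: rev_cases)
  case Nil
  then show ?thesis using assms by (intro bexI[of _ \<one>]) auto
next
  case (snoc l' d)
  have d: "d \<in> carrier L" "set l' \<subseteq> carrier L" using assms snoc by auto
  obtain x where x: "x \<in> carrier L" "eval (c # (l' @ [d \<ominus> \<one>])) x = \<zero>"
    using root_exists[OF assms(1,2), of "l' @ [d \<ominus> \<one>]"] d by auto
  have e: "eval (c # l') x \<in> carrier L" using eval_in_carrier[of "c # l'" x] assms d x by simp
  have "eval (c # l') x \<otimes> x \<oplus> (d \<ominus> \<one>) = \<zero>"
    using x eval_append_aux[of "c # l'" "d \<ominus> \<one>" x] assms d by simp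
  moreover have "eval (c # l) x = (eval (c # l') x \<otimes> x \<oplus> (d \<ominus> \<one>)) \<oplus> \<one>"
  proof -
    have "eval (c # l) x = eval (c # l') x \<otimes> x \<oplus> d"
      using x eval_append_aux[of "c # l'" d x] assms d snoc by simp
    also have "\<dots> = (eval (c # l') x \<otimes> x \<oplus> (d \<ominus> \<one>)) \<oplus> \<one>"
      using e d x by algebra
    finally show ?thesis .
  qed
  ultimately have "eval (c # l) x = \<one>" by simp
  then have "eval (c # l) x \<noteq> \<zero>" by simp
  then show ?thesis using x(1) by blast
qed

lemma (in domain) nat_pow_nonzero:
  "x \<in> carrier R \<Longrightarrow> x \<noteq> \<zero> \<Longrightarrow> x [^] (n::nat) \<noteq> \<zero>"
  by (induct n) (auto simp: integral_iff)

text \<open>One generator \<open>s\<close> is adjoined to the coefficient ring \<open>A\<close>. If \<open>s\<close> is transcendental over \<open>A\<close>, then \<open>s\<close> may be sent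
  to any point, and \<open>a\<close> is the leading coefficient of a polynomial expressing \<open>b\<close>. If \<open>s\<close> is algebraic, let \<open>p\<close> be
  a relation of least degree, with leading coefficient \<open>d\<close>. As soon as \<open>\<phi> d \<noteq> 0\<close>, pseudo-division by \<open>p\<close> shows that
  every relation of \<open>s\<close> holds at every root of the transported \<open>p\<close>, so \<open>\<phi>\<close> extends. To control \<open>b\<close>, a nonzero multiple
  \<open>e = b w\<close> inside \<open>A\<close> is found, and \<open>a = d e\<close>: then \<open>\<phi>' b\<close> divides \<open>\<phi> e \<noteq> 0\<close>.\<close>

lemma extension_theorem:
  fixes B (structure) and F (structure)
  assumes "domain B" "algebraically_closed F" and A: "subring A B" and s: "s \<in> carrier B"
    and b: "b \<in> generate_ring B (insert s A)" "b \<noteq> \<zero>"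
  shows "\<exists>a\<in>A. a \<noteq> \<zero> \<and> (\<forall>\<phi>\<in>ring_hom (B\<lparr>carrier := A\<rparr>) F. \<phi> a \<noteq> \<zero>\<^bsub>F\<^esub> \<longrightarrow>
     (\<exists>\<phi>'\<in>ring_hom (B\<lparr>carrier := generate_ring B (insert s A)\<rparr>) F.
        (\<forall>x\<in>A. \<phi>' x = \<phi> x) \<and> \<phi>' b \<noteq> \<zero>\<^bsub>F\<^esub>))"
proof -
  interpret B: domain B by fact
  interpret F: algebraically_closed F by fact
  interpret E: coeff_hom B B A "\<lambda>x. x" s
  proof (rule coeff_hom.intro[OF B.cring_axioms B.cring_axioms coeff_hom_axioms.intro[OF A _ s]])
    show "(\<lambda>x. x) \<in> ring_hom (B\<lparr>carrier := A\<rparr>) B"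
      using subringE(1)[OF A] by (intro ring_hom_memI) auto
  qed
  have pair: "hom_pair B F A \<phi> s \<xi>"
    if "\<phi> \<in> ring_hom (B\<lparr>carrier := A\<rparr>) F" "\<xi> \<in> carrier F" for \<phi> \<xi>
    by (rule hom_pair.intro[OF B.cring_axioms F.cring_axioms hom_pair_axioms.intro[OF A that(1) s that(2)]])
  have G: "generate_ring B (insert s A) = {E.ev m | m. set m \<subseteq> A}"
    using E.values_generate by simp
  then obtain m where m: "set m \<subseteq> A" "b = E.ev m" using b by blast
  then have "\<not> set m \<subseteq> {\<zero>}" using b(2) E.ev_all_zero by blast
  then obtain c l where cl: "c \<in> A" "c \<noteq> \<zero>" "set l \<subseteq> A" "E.ev (c # l) = b"
    using E.strip_zeros[OF m(1)] m(2) by metis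
  show ?thesis
  proof (cases "\<forall>m. set m \<subseteq> A \<longrightarrow> E.ev m = \<zero> \<longrightarrow> set m \<subseteq> {\<zero>}")
    case True
    have "\<exists>\<phi>'\<in>ring_hom (B\<lparr>carrier := generate_ring B (insert s A)\<rparr>) F.
        (\<forall>x\<in>A. \<phi>' x = \<phi> x) \<and> \<phi>' b \<noteq> \<zero>\<^bsub>F\<^esub>"
      if \<phi>: "\<phi> \<in> ring_hom (B\<lparr>carrier := A\<rparr>) F" "\<phi> c \<noteq> \<zero>\<^bsub>F\<^esub>" for \<phi>
    proof -
      have "set (map \<phi> l) \<subseteq> carrier F" "\<phi> c \<in> carrier F"
        using ring_hom_memE(1)[OF \<phi>(1)] cl by auto
      then obtain \<xi> where \<xi>: "\<xi> \<in> carrier F" "F.eval (map \<phi> (c # l)) \<xi> \<noteq> \<zero>\<^bsub>F\<^esub>"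
        using F.nonroot_exists[of "\<phi> c" "map \<phi> l"] \<phi>(2) by auto
      interpret P: hom_pair B F A \<phi> s \<xi> by (rule pair[OF \<phi>(1) \<xi>(1)])
      have "\<exists>\<phi>'\<in>ring_hom (B\<lparr>carrier := generate_ring B (insert s A)\<rparr>) F.
         (\<forall>a\<in>A. \<phi>' a = \<phi> a) \<and> (\<forall>m. set m \<subseteq> A \<longrightarrow> \<phi>' (E.ev m) = P.E2.ev m)"
        by (rule P.extend_hom) (use True P.E2.ev_all_zero in blast)
      then show ?thesis using cl \<xi>(2) unfolding P.E2.ev_def by (metis insert_subset list.simps(15))
    qed
    then show ?thesis using cl by blast
  next
    case False
    \<comment> \<open>Relations with nonzero leading coefficient, indexed by degree; \<open>n\<close> will be the least degree.\<close>
    define Rel where "Rel n \<longleftrightarrow> (\<exists>c l. c \<in> A \<and> c \<noteq> \<zero> \<and> set l \<subseteq> A \<and> E.ev (c # l) = \<zero> \<and> length l = n)" for n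
    obtain m0 where "set m0 \<subseteq> A" "E.ev m0 = \<zero>" "\<not> set m0 \<subseteq> {\<zero>}" using False by blast
    then have "\<exists>n. Rel n" unfolding Rel_def using E.strip_zeros[of m0] by metis
    then obtain n where n: "Rel n" "\<And>k. k < n \<Longrightarrow> \<not> Rel k" by (metis exists_least_iff)
    obtain d p where p: "d \<in> A" "d \<noteq> \<zero>" "set p \<subseteq> A" "E.ev (d # p) = \<zero>" "length p = n"
      using n(1) unfolding Rel_def by blast
    have short: "set r \<subseteq> {\<zero>}" if r: "set r \<subseteq> A" "E.ev r = \<zero>" "length r \<le> n" for r
    proof (rule ccontr)
      assume "\<not> ?thesis"
      then obtain c l where "c \<in> A" "c \<noteq> \<zero>" "set l \<subseteq> A" "length (c # l) \<le> length r" "E.ev (c # l) = E.ev r"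
        using E.strip_zeros[OF r(1)] by metis
      then have "Rel (length l) \<and> length l < n" using r unfolding Rel_def
        by (intro conjI exI[of _ c] exI[of _ l]) auto
      then show False using n(2) by blast
    qed
    have dB: "d \<in> carrier B" using p E.A_simps(1) by blast
    have p_ne: "p \<noteq> []"
    proof
      assume "p = []"
      then have "d = \<zero>" using p dB by (simp add: E.ev_Cons)
      then show False using p by simp
    qed
    \<comment> \<open>Degrees of polynomials whose value is a nonzero multiple of \<open>b\<close>; the least degree \<open>k\<close> turns out to be \<open>0\<close>.\<close>
    define Mul where "Mul k \<longleftrightarrow> (\<exists>c l w. c \<in> A \<and> c \<noteq> \<zero> \<and> set l \<subseteq> A \<and> length l = k
      \<and> E.ev (c # l) \<noteq> \<zero> \<and> w \<in> generate_ring B (insert s A) \<and> E.ev (c # l) = b \<otimes> w)" for k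
    have GR: "subring (generate_ring B (insert s A)) B"
      using B.generate_ring_is_subring[of "insert s A"] s E.A_simps(1) by blast
    note GE = subringE[OF GR]
    have bB: "b \<in> carrier B" using b(1) GE(1) by blast
    have "Mul (length l)" unfolding Mul_def
      using cl b bB GE(3) by (intro exI[of _ c] exI[of _ l] exI[of _ "\<one>"]) simp
    then obtain k where k: "Mul k" "\<And>j. j < k \<Longrightarrow> \<not> Mul j" by (metis exists_least_iff)
    have Mul_short: "E.ev r = \<zero>"
      if r: "set r \<subseteq> A" "length r \<le> k" "w \<in> generate_ring B (insert s A)" "E.ev r = b \<otimes> w" for r w
    proof (rule ccontr)
      assume ne: "E.ev r \<noteq> \<zero>"
      then have "\<not> set r \<subseteq> {\<zero>}" using E.ev_all_zero by blast
      then obtain c l where "c \<in> A" "c \<noteq> \<zero>" "set l \<subseteq> A" "length (c # l) \<le> length r" "E.ev (c # l) = E.ev r"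
        using E.strip_zeros[OF r(1)] by metis
      then have "Mul (length l) \<and> length l < k" using r ne unfolding Mul_def
        by (intro conjI exI[of _ c] exI[of _ l] exI[of _ w]) auto
      then show False using k(2) by blast
    qed
    obtain e g w where g: "e \<in> A" "e \<noteq> \<zero>" "set g \<subseteq> A" "length g = k" "E.ev (e # g) \<noteq> \<zero>"
      "w \<in> generate_ring B (insert s A)" "E.ev (e # g) = b \<otimes> w"
      using k(1) unfolding Mul_def by blast
    have wB: "w \<in> carrier B" and eB: "e \<in> carrier B" using g GE(1) E.A_simps(1) by auto
    \<comment> \<open>Otherwise the remainder modulo \<open>p\<close> is a multiple of \<open>b\<close> of smaller degree.\<close>
    have "k < n"
    proof (rule ccontr)
      assume "\<not> k < n"
      then have len: "length (e # g) = length p + (Suc k - n)" using g p by simp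
      have eg: "set (e # g) \<subseteq> A" using g by simp
      obtain h r where hr: "set h \<subseteq> A" "set r \<subseteq> A" "length r = length p"
        "d [^] (Suc k - n) \<otimes> E.ev (e # g) = E.ev (d # p) \<otimes> E.ev h \<oplus> E.ev r"
        using E.pseudo_division[OF p(3,1) eg len] by blast
      have dA: "d [^] (Suc k - n) \<in> A" by (rule E.A_simps(8)[OF p(1)])
      have er: "E.ev r = d [^] (Suc k - n) \<otimes> E.ev (e # g)" using hr p(4) by simp
      also have "\<dots> = b \<otimes> (d [^] (Suc k - n) \<otimes> w)"
        unfolding g(7) using bB wB dB by (simp add: B.m_lcomm)
      finally have "E.ev r = b \<otimes> (d [^] (Suc k - n) \<otimes> w)" .
      moreover have "d [^] (Suc k - n) \<otimes> w \<in> generate_ring B (insert s A)"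
        using dA g(6) by (intro generate_ring.eng_mult) (auto intro: generate_ring.incl)
      ultimately have "E.ev r = \<zero>" using Mul_short[OF hr(2)] hr(3) p(5) \<open>\<not> k < n\<close> by simp
      then have "d [^] (Suc k - n) \<otimes> E.ev (e # g) = \<zero>" using er by simp
      moreover have "d [^] (Suc k - n) \<noteq> \<zero>"
        using B.nat_pow_nonzero[of d] dB p(2) by blast
      moreover have "E.ev (e # g) \<in> carrier B" using E.ev_closed[OF eg] .
      ultimately show False using B.integral g(5) dB by (metis B.nat_pow_closed)
    qed
    \<comment> \<open>Otherwise divide \<open>p\<close> by \<open>e # g\<close>: minimality of \<open>k\<close> makes the remainder vanish at \<open>s\<close>, and the quotient becomes
  a relation of \<open>s\<close> of degree below that of \<open>p\<close>.\<close>
    have "k = 0"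
    proof (rule ccontr)
      assume "k \<noteq> 0"
      have len: "length (d # p) = length g + (Suc n - k)" using g p \<open>k < n\<close> by simp
      have dp: "set (d # p) \<subseteq> A" using p by simp
      obtain h r where hr: "set h \<subseteq> A" "set r \<subseteq> A" "length h = Suc n - k" "length r = length g"
        "0 < Suc n - k \<longrightarrow> hd h = e [^] (Suc n - k - 1) \<otimes> hd (d # p)"
        "e [^] (Suc n - k) \<otimes> E.ev (d # p) = E.ev (e # g) \<otimes> E.ev h \<oplus> E.ev r"
        using E.pseudo_division[OF g(3,1) dp len] by (elim exE conjE) (rule that)
      have hB: "E.ev h \<in> carrier B" "E.ev r \<in> carrier B" "E.ev (e # g) \<in> carrier B"
        using E.ev_closed[OF hr(1)] E.ev_closed[OF hr(2)] bB wB g(7) by auto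
      have "E.ev (e # g) \<otimes> E.ev h \<oplus> E.ev r = \<zero>" using hr(6) p(4) eB by simp
      then have er: "E.ev r = \<ominus> (E.ev (e # g) \<otimes> E.ev h)"
        using hB by (metis B.m_closed B.sum_zero_eq_neg B.a_comm)
      also have "\<dots> = b \<otimes> (\<ominus> (w \<otimes> E.ev h))"
        unfolding g(7) using bB wB hB by (simp add: B.m_assoc B.r_minus)
      finally have "E.ev r = b \<otimes> (\<ominus> (w \<otimes> E.ev h))" .
      moreover have "\<ominus> (w \<otimes> E.ev h) \<in> generate_ring B (insert s A)"
        using GE(5)[OF GE(6)[OF g(6)]] hr(1) unfolding G by blast
      ultimately have "E.ev r = \<zero>" using Mul_short[OF hr(2)] hr(4) g(4) by simp
      then have "E.ev (e # g) \<otimes> E.ev h = \<zero>" using er hB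
        by (metis B.minus_minus B.minus_zero B.m_closed)
      then have "E.ev h = \<zero>" using B.integral hB g(5) by blast
      then have "set h \<subseteq> {\<zero>}" using short[OF hr(1)] hr(3) \<open>k \<noteq> 0\<close> by simp
      moreover have "h \<noteq> []" using hr(3) \<open>k < n\<close> by auto
      ultimately have "hd h = \<zero>" using hd_in_set by blast
      then have "e [^] (Suc n - k - 1) \<otimes> d = \<zero>" using hr(5) \<open>k < n\<close> by simp
      then show False using B.integral[of "e [^] (Suc n - k - 1)" d] B.nat_pow_nonzero[of e] eB dB g(2) p(2)
        by blast
    qed
    then have ew: "e = b \<otimes> w" using g(4,7) eB by (simp add: E.ev_Cons)
    have "\<exists>\<phi>'\<in>ring_hom (B\<lparr>carrier := generate_ring B (insert s A)\<rparr>) F.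
        (\<forall>x\<in>A. \<phi>' x = \<phi> x) \<and> \<phi>' b \<noteq> \<zero>\<^bsub>F\<^esub>"
      if \<phi>: "\<phi> \<in> ring_hom (B\<lparr>carrier := A\<rparr>) F" "\<phi> (d \<otimes> e) \<noteq> \<zero>\<^bsub>F\<^esub>" for \<phi>
    proof -
      have cF: "set (map \<phi> p) \<subseteq> carrier F" "\<phi> d \<in> carrier F" "\<phi> e \<in> carrier F"
        using ring_hom_memE(1)[OF \<phi>(1)] p g by auto
      have "\<phi> (d \<otimes> e) = \<phi> d \<otimes>\<^bsub>F\<^esub> \<phi> e" using ring_hom_memE(2)[OF \<phi>(1)] p(1) g(1) by simp
      then have nz: "\<phi> d \<noteq> \<zero>\<^bsub>F\<^esub>" "\<phi> e \<noteq> \<zero>\<^bsub>F\<^esub>" using \<phi>(2) cF by auto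
      obtain \<xi> where \<xi>: "\<xi> \<in> carrier F" "F.eval (map \<phi> (d # p)) \<xi> = \<zero>\<^bsub>F\<^esub>"
        using F.root_exists[of "\<phi> d" "map \<phi> p"] cF nz p_ne by auto
      interpret P: hom_pair B F A \<phi> s \<xi> by (rule pair[OF \<phi>(1) \<xi>(1)])
      have wd: "P.E2.ev m = \<zero>\<^bsub>F\<^esub>" if m: "set m \<subseteq> A" "E.ev m = \<zero>" for m
      proof (cases "length m \<le> n")
        case True
        then show ?thesis using short m P.E2.ev_all_zero by blast
      next
        case False
        then have len: "length m = length p + (length m - n)" using p(5) by simp
        define j where "j = length m - n"
        obtain h r where hr: "set h \<subseteq> A" "set r \<subseteq> A" "length r = length p"
          "(d, \<phi> d) [^]\<^bsub>RDirProd B F\<^esub> j \<otimes>\<^bsub>RDirProd B F\<^esub> P.E.ev m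
             = P.E.ev (d # p) \<otimes>\<^bsub>RDirProd B F\<^esub> P.E.ev h \<oplus>\<^bsub>RDirProd B F\<^esub> P.E.ev r"
          using P.E.pseudo_division[OF p(3,1) m(1) len] unfolding j_def by blast
        have c: "E.ev h \<in> carrier B" "E.ev r \<in> carrier B" "P.E2.ev h \<in> carrier F" "P.E2.ev m \<in> carrier F"
          using hr m by auto
        have 1: "d [^] j \<otimes> E.ev m = E.ev (d # p) \<otimes> E.ev h \<oplus> E.ev r"
          and 2: "\<phi> d [^]\<^bsub>F\<^esub> j \<otimes>\<^bsub>F\<^esub> P.E2.ev m = P.E2.ev (d # p) \<otimes>\<^bsub>F\<^esub> P.E2.ev h \<oplus>\<^bsub>F\<^esub> P.E2.ev r"
          using hr(4) unfolding P.E_ev RDirProd_simps by simp_all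
        have "E.ev r = \<zero>" using 1 m(2) p(4) c dB by simp
        then have "P.E2.ev r = \<zero>\<^bsub>F\<^esub>" using short[OF hr(2)] hr(3) p(5) P.E2.ev_all_zero by auto
        moreover have "P.E2.ev (d # p) = \<zero>\<^bsub>F\<^esub>" using \<xi>(2) unfolding P.E2.ev_def .
        ultimately have "\<phi> d [^]\<^bsub>F\<^esub> j \<otimes>\<^bsub>F\<^esub> P.E2.ev m = \<zero>\<^bsub>F\<^esub>" using 2 c by simp
        then show ?thesis using F.integral c(4) F.nat_pow_nonzero[OF cF(2) nz(1)] cF(2)
          by (metis F.nat_pow_closed)
      qed
      obtain \<phi>' where \<phi>': "\<phi>' \<in> ring_hom (B\<lparr>carrier := generate_ring B (insert s A)\<rparr>) F"
        "\<And>x. x \<in> A \<Longrightarrow> \<phi>' x = \<phi> x" using P.extend_hom wd by blast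
      have "\<phi> e = \<phi>' b \<otimes>\<^bsub>F\<^esub> \<phi>' w"
        using \<phi>'(2)[OF g(1)] ring_hom_memE(2)[OF \<phi>'(1)] b(1) g(6) ew by simp
      moreover have "\<phi>' w \<in> carrier F" using ring_hom_memE(1)[OF \<phi>'(1)] g(6) by simp
      ultimately have "\<phi>' b \<noteq> \<zero>\<^bsub>F\<^esub>" using nz(2) by auto
      then show ?thesis using \<phi>' by blast
    qed
    moreover have "d \<otimes> e \<in> A" "d \<otimes> e \<noteq> \<zero>"
      using E.A_simps(5) p g B.integral_iff dB eB by auto
    ultimately show ?thesis by blast
  qed
qed

text \<open>The Nullstellensatz, by adjoining the generators one at a time. Every application of the extension
  theorem replaces the element that has to stay nonzero by an element of the smaller ring, until it lies in \<open>F\<close>.\<close>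

lemma points_of_domain:
  fixes B (structure) and F (structure)
  assumes "domain B" "algebraically_closed F" and \<kappa>: "\<kappa> \<in> ring_hom F B"
    and S: "finite S" "S \<subseteq> carrier B"
    and b: "b \<in> generate_ring B (S \<union> \<kappa> ` carrier F)" "b \<noteq> \<zero>"
  shows "\<exists>\<phi>\<in>ring_hom (B\<lparr>carrier := generate_ring B (S \<union> \<kappa> ` carrier F)\<rparr>) F.
    (\<forall>c\<in>carrier F. \<phi> (\<kappa> c) = c) \<and> \<phi> b \<noteq> \<zero>\<^bsub>F\<^esub>"
  using S b
proof (induct S arbitrary: b rule: finite_induct)
  interpret B: domain B by fact
  interpret F: algebraically_closed F by fact
  interpret k: ring_hom_ring F B \<kappa>
    using \<kappa> F.ring_axioms B.ring_axioms by (rule ring_hom_ringI2[rotated 2])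
  have KB: "\<kappa> ` carrier F \<subseteq> carrier B" by auto
  {
    case empty
    have inj: "inj_on \<kappa> (carrier F)"
    proof (rule k.non_trivial_field_hom_imp_inj[OF F.field_axioms])
      have "\<one> \<in> \<kappa> ` carrier F" using k.hom_one by (metis F.one_closed imageI)
      then show "\<kappa> ` carrier F \<noteq> {\<zero>}" using B.one_not_zero by blast
    qed
    have sub: "subring (\<kappa> ` carrier F) B"
      using k.img_is_subring[OF F.carrier_is_subring] .
    have "generate_ring B (\<kappa> ` carrier F) \<subseteq> \<kappa> ` carrier F"
      using B.generate_ring_min_subring1[OF KB sub] by simp
    then have G: "generate_ring B ({} \<union> \<kappa> ` carrier F) = \<kappa> ` carrier F"
      by (auto intro: generate_ring.incl)
    define \<phi> where "\<phi> = inv_into (carrier F) \<kappa>"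
    have \<phi>: "\<phi> (\<kappa> c) = c" if "c \<in> carrier F" for c
      unfolding \<phi>_def using inj that by simp
    have "\<phi> \<in> ring_hom (B\<lparr>carrier := \<kappa> ` carrier F\<rparr>) F"
    proof (rule ring_hom_memI)
      fix x y assume "x \<in> carrier (B\<lparr>carrier := \<kappa> ` carrier F\<rparr>)" "y \<in> carrier (B\<lparr>carrier := \<kappa> ` carrier F\<rparr>)"
      then obtain c d where "x = \<kappa> c" "y = \<kappa> d" "c \<in> carrier F" "d \<in> carrier F" by auto
      then show "\<phi> (x \<otimes>\<^bsub>B\<lparr>carrier := \<kappa> ` carrier F\<rparr>\<^esub> y) = \<phi> x \<otimes>\<^bsub>F\<^esub> \<phi> y"
        "\<phi> (x \<oplus>\<^bsub>B\<lparr>carrier := \<kappa> ` carrier F\<rparr>\<^esub> y) = \<phi> x \<oplus>\<^bsub>F\<^esub> \<phi> y"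
        using \<phi>[of "c \<otimes>\<^bsub>F\<^esub> d"] \<phi>[of "c \<oplus>\<^bsub>F\<^esub> d"] \<phi> by simp_all
    next
      show "\<phi> \<one>\<^bsub>B\<lparr>carrier := \<kappa> ` carrier F\<rparr>\<^esub> = \<one>\<^bsub>F\<^esub>" using \<phi>[of "\<one>\<^bsub>F\<^esub>"] by simp
    qed (auto simp: \<phi>)
    moreover have "\<phi> b \<noteq> \<zero>\<^bsub>F\<^esub>"
    proof -
      obtain c where c: "c \<in> carrier F" "b = \<kappa> c" using empty(2) G by auto
      then show ?thesis using empty(3) \<phi> by auto
    qed
    ultimately show ?case unfolding G using \<phi> by blast
  next
    case (insert s S)
    let ?A = "generate_ring B (S \<union> \<kappa> ` carrier F)"
    have SK: "S \<union> \<kappa> ` carrier F \<subseteq> carrier B" and s: "s \<in> carrier B" using insert(4) KB by auto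
    have A: "subring ?A B" by (rule B.generate_ring_is_subring[OF SK])
    have AB: "?A \<subseteq> carrier B" using subringE(1)[OF A] .
    have "generate_ring B (insert s S \<union> \<kappa> ` carrier F) \<subseteq> generate_ring B (insert s ?A)"
    proof (rule B.generate_ring_min_subring1)
      show "insert s S \<union> \<kappa> ` carrier F \<subseteq> carrier B" using SK s by auto
      show "subring (generate_ring B (insert s ?A)) B"
        by (rule B.generate_ring_is_subring) (use AB s in auto)
      show "insert s S \<union> \<kappa> ` carrier F \<subseteq> generate_ring B (insert s ?A)"
        by (auto intro!: generate_ring.incl)
    qed
    moreover have "generate_ring B (insert s ?A) \<subseteq> generate_ring B (insert s S \<union> \<kappa> ` carrier F)"
    proof (rule B.generate_ring_min_subring1)
      show "insert s ?A \<subseteq> carrier B" using AB s by auto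
      show sr: "subring (generate_ring B (insert s S \<union> \<kappa> ` carrier F)) B"
        by (rule B.generate_ring_is_subring) (use SK s in auto)
      have "?A \<subseteq> generate_ring B (insert s S \<union> \<kappa> ` carrier F)"
        by (rule B.generate_ring_min_subring1[OF SK sr]) (auto intro: generate_ring.incl)
      then show "insert s ?A \<subseteq> generate_ring B (insert s S \<union> \<kappa> ` carrier F)"
        by (auto intro: generate_ring.incl)
    qed
    ultimately have G: "generate_ring B (insert s S \<union> \<kappa> ` carrier F) = generate_ring B (insert s ?A)" ..
    obtain a where a: "a \<in> ?A" "a \<noteq> \<zero>"
      "\<forall>\<phi>\<in>ring_hom (B\<lparr>carrier := ?A\<rparr>) F. \<phi> a \<noteq> \<zero>\<^bsub>F\<^esub> \<longrightarrow>
       (\<exists>\<phi>'\<in>ring_hom (B\<lparr>carrier := generate_ring B (insert s ?A)\<rparr>) F.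
        (\<forall>x\<in>?A. \<phi>' x = \<phi> x) \<and> \<phi>' b \<noteq> \<zero>\<^bsub>F\<^esub>)"
      using extension_theorem[OF assms(1,2) A s, of b] insert(5,6) unfolding G by blast
    have "S \<subseteq> carrier B" using insert(4) by simp
    then obtain \<phi> where \<phi>: "\<phi> \<in> ring_hom (B\<lparr>carrier := ?A\<rparr>) F" "\<forall>c\<in>carrier F. \<phi> (\<kappa> c) = c" "\<phi> a \<noteq> \<zero>\<^bsub>F\<^esub>"
      using insert(3)[OF _ a(1,2)] by blast
    obtain \<phi>' where \<phi>': "\<phi>' \<in> ring_hom (B\<lparr>carrier := generate_ring B (insert s ?A)\<rparr>) F"
      "\<forall>x\<in>?A. \<phi>' x = \<phi> x" "\<phi>' b \<noteq> \<zero>\<^bsub>F\<^esub>"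
      using a(3) \<phi> by blast
    have "\<phi>' (\<kappa> c) = c" if "c \<in> carrier F" for c
    proof -
      have "\<kappa> c \<in> ?A" using that by (intro generate_ring.incl) auto
      then show ?thesis using \<phi>'(2) \<phi>(2) that by simp
    qed
    then show ?case unfolding G using \<phi>' by blast
  }
qed

section \<open>Evaluation on a torsion-free layer of a filtration\<close>

lemma points_of_affine_quotient:
  fixes F (structure) and R (structure)
  assumes aff: "affine_algebra F R" and F: "algebraically_closed F" and P: "primeideal P R"
    and b: "b \<in> carrier (R Quot P)" "b \<noteq> \<zero>\<^bsub>R Quot P\<^esub>"
  shows "\<exists>\<phi>\<in>ring_hom (R Quot P) F.
    (\<forall>c\<in>carrier F. \<phi> (P +>\<^bsub>R\<^esub> (c \<odot>\<^bsub>R\<^esub> \<one>\<^bsub>R\<^esub>)) = c) \<and> \<phi> b \<noteq> \<zero>"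
proof -
  interpret affine_algebra F R by fact
  interpret P: primeideal P R by fact
  interpret D: domain "R Quot P" by (rule P.quotient_is_domain)
  interpret \<pi>: ring_hom_cring R "R Quot P" "(+>\<^bsub>R\<^esub>) P" by (rule P.rcos_ring_hom_cring)
  interpret F: algebraically_closed F by fact
  define \<kappa> where "\<kappa> c = P +>\<^bsub>R\<^esub> (c \<odot>\<^bsub>R\<^esub> \<one>\<^bsub>R\<^esub>)" for c
  have \<kappa>: "\<kappa> \<in> ring_hom F (R Quot P)"
  proof (rule ring_hom_memI)
    fix x y assume xy: "x \<in> carrier F" "y \<in> carrier F"
    have "(x \<otimes> y) \<odot>\<^bsub>R\<^esub> \<one>\<^bsub>R\<^esub> = (x \<odot>\<^bsub>R\<^esub> \<one>\<^bsub>R\<^esub>) \<otimes>\<^bsub>R\<^esub> (y \<odot>\<^bsub>R\<^esub> \<one>\<^bsub>R\<^esub>)"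
      using xy by (simp add: smult_assoc1 smult_assoc2)
    then show "\<kappa> (x \<otimes> y) = \<kappa> x \<otimes>\<^bsub>R Quot P\<^esub> \<kappa> y" unfolding \<kappa>_def using xy by simp
    show "\<kappa> (x \<oplus> y) = \<kappa> x \<oplus>\<^bsub>R Quot P\<^esub> \<kappa> y"
      unfolding \<kappa>_def using xy by (simp add: smult_l_distr)
  qed (simp_all add: \<kappa>_def)
  obtain S where S: "S \<subseteq> carrier R" "finite S"
    "carrier R = generate_ring R (S \<union> {c \<odot>\<^bsub>R\<^esub> \<one>\<^bsub>R\<^esub> | c. c \<in> carrier F})"
    using finite_type by blast
  define G where "G = generate_ring (R Quot P) ((+>\<^bsub>R\<^esub>) P ` S \<union> \<kappa> ` carrier F)"
  have sub: "(+>\<^bsub>R\<^esub>) P ` S \<union> \<kappa> ` carrier F \<subseteq> carrier (R Quot P)"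
    using S(1) ring_hom_memE(1)[OF \<kappa>] by auto
  have "P +>\<^bsub>R\<^esub> x \<in> G" if "x \<in> generate_ring R (S \<union> {c \<odot>\<^bsub>R\<^esub> \<one>\<^bsub>R\<^esub> | c. c \<in> carrier F})" for x
    using that
  proof (induct rule: generate_ring.induct)
    case one
    then show ?case unfolding G_def \<pi>.hom_one by (rule generate_ring.one)
  next
    case (incl h)
    then show ?case unfolding G_def \<kappa>_def by (intro generate_ring.incl) auto
  next
    case (a_inv h)
    then have "h \<in> carrier R" using S(3) by simp
    then show ?case using a_inv(2) unfolding G_def by (simp add: generate_ring.a_inv)
  next
    case (eng_add h1 h2)
    then have "h1 \<in> carrier R" "h2 \<in> carrier R" using S(3) by simp_all
    then show ?case using eng_add(2,4) unfolding G_def by (simp add: generate_ring.eng_add)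
  next
    case (eng_mult h1 h2)
    then have "h1 \<in> carrier R" "h2 \<in> carrier R" using S(3) by simp_all
    then show ?case using eng_mult(2,4) unfolding G_def by (simp add: generate_ring.eng_mult)
  qed
  then have all: "P +>\<^bsub>R\<^esub> x \<in> G" if "x \<in> carrier R" for x using that S(3) by simp
  have "carrier (R Quot P) \<subseteq> G"
    using all unfolding FactRing_def A_RCOSETS_def' by auto
  moreover have "G \<subseteq> carrier (R Quot P)"
    unfolding G_def by (rule D.generate_ring_incl[OF sub])
  ultimately have G: "generate_ring (R Quot P) ((+>\<^bsub>R\<^esub>) P ` S \<union> \<kappa> ` carrier F) = carrier (R Quot P)"
    unfolding G_def by blast
  have "b \<in> generate_ring (R Quot P) ((+>\<^bsub>R\<^esub>) P ` S \<union> \<kappa> ` carrier F)" using b G by simp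
  moreover have "finite ((+>\<^bsub>R\<^esub>) P ` S)" "(+>\<^bsub>R\<^esub>) P ` S \<subseteq> carrier (R Quot P)"
    using S(2) sub by simp_all
  ultimately have "\<exists>\<phi>\<in>ring_hom ((R Quot P)\<lparr>carrier := carrier (R Quot P)\<rparr>) F.
    (\<forall>c\<in>carrier F. \<phi> (\<kappa> c) = c) \<and> \<phi> b \<noteq> \<zero>"
    using points_of_domain[OF D.domain_axioms F \<kappa> _ _ _ b(2), of "(+>\<^bsub>R\<^esub>) P ` S"] unfolding G by blast
  then show ?thesis unfolding \<kappa>_def by simp
qed

lemma zero_FactRing: "\<zero>\<^bsub>R Quot I\<^esub> = I"
  by (simp add: FactRing_def)

lemma idealD:
  fixes R (structure)
  assumes "ideal I R"
  shows "I \<subseteq> carrier R" "x \<in> I \<Longrightarrow> x \<in> carrier R" "\<zero> \<in> I"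
    "x \<in> I \<Longrightarrow> y \<in> I \<Longrightarrow> x \<oplus> y \<in> I" "r \<in> carrier R \<Longrightarrow> x \<in> I \<Longrightarrow> r \<otimes> x \<in> I"
    "x \<in> I \<Longrightarrow> y \<in> I \<Longrightarrow> x \<ominus> y \<in> I"
proof -
  interpret ideal I R by fact
  show "I \<subseteq> carrier R" by (rule a_subset)
  show "x \<in> I \<Longrightarrow> x \<in> carrier R" by (rule Icarr)
  show "\<zero> \<in> I" by (rule additive_subgroup.zero_closed[OF is_additive_subgroup])
  show "x \<in> I \<Longrightarrow> y \<in> I \<Longrightarrow> x \<oplus> y \<in> I" by (rule additive_subgroup.a_closed[OF is_additive_subgroup])
  show "r \<in> carrier R \<Longrightarrow> x \<in> I \<Longrightarrow> r \<otimes> x \<in> I" by (rule I_l_closed)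
  show "x \<in> I \<Longrightarrow> y \<in> I \<Longrightarrow> x \<ominus> y \<in> I"
    unfolding a_minus_def by (intro additive_subgroup.a_closed[OF is_additive_subgroup] additive_subgroup.a_inv_closed[OF is_additive_subgroup])
qed

text \<open>The situation of \<open>V = P\<^sup>(\<^sup>l\<^sup>)\<close> and \<open>V' = P\<^sup>(\<^sup>l\<^sup>+\<^sup>1\<^sup>)\<close>: the quotient \<open>V/V'\<close> is a torsion-free \<open>R/P\<close>-module.\<close>

locale torsion_free_layer = R: cring R for R (structure) +
  fixes P V V'
  assumes P: "primeideal P R" and V: "ideal V R" and V': "ideal V' R" and V'V: "V' \<subseteq> V"
    and PV: "p \<in> P \<Longrightarrow> v \<in> V \<Longrightarrow> p \<otimes> v \<in> V'"
    and torsion_free: "r \<in> carrier R - P \<Longrightarrow> v \<in> V \<Longrightarrow> r \<otimes> v \<in> V' \<Longrightarrow> v \<in> V'"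
begin

lemmas VD = idealD[OF V] and V'D = idealD[OF V']

abbreviation "D \<equiv> R Quot P"
abbreviation \<pi> where "\<pi> r \<equiv> P +> r"

sublocale D: domain D by (rule primeideal.quotient_is_domain[OF P])

lemma \<pi>_hom: "(\<lambda>r. \<pi> r) \<in> ring_hom R D"
  by (rule ideal.rcos_ring_hom[OF primeideal.axioms(1)[OF P]])

lemma \<pi>_simps [simp]:
  "r \<in> carrier R \<Longrightarrow> \<pi> r \<in> carrier D"
  "r \<in> carrier R \<Longrightarrow> r' \<in> carrier R \<Longrightarrow> \<pi> (r \<oplus> r') = \<pi> r \<oplus>\<^bsub>D\<^esub> \<pi> r'"
  "r \<in> carrier R \<Longrightarrow> r' \<in> carrier R \<Longrightarrow> \<pi> (r \<otimes> r') = \<pi> r \<otimes>\<^bsub>D\<^esub> \<pi> r'"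
  "\<pi> \<one> = \<one>\<^bsub>D\<^esub>" "\<pi> \<zero> = \<zero>\<^bsub>D\<^esub>" "r \<in> carrier R \<Longrightarrow> \<pi> (\<ominus> r) = \<ominus>\<^bsub>D\<^esub> \<pi> r"
proof -
  interpret \<pi>: ring_hom_ring R D "\<lambda>r. \<pi> r"
    by (rule ring_hom_ringI2[OF R.ring_axioms D.ring_axioms \<pi>_hom])
  show "r \<in> carrier R \<Longrightarrow> \<pi> r \<in> carrier D" by (rule \<pi>.hom_closed)
  show "r \<in> carrier R \<Longrightarrow> r' \<in> carrier R \<Longrightarrow> \<pi> (r \<oplus> r') = \<pi> r \<oplus>\<^bsub>D\<^esub> \<pi> r'" by (rule \<pi>.hom_add)
  show "r \<in> carrier R \<Longrightarrow> r' \<in> carrier R \<Longrightarrow> \<pi> (r \<otimes> r') = \<pi> r \<otimes>\<^bsub>D\<^esub> \<pi> r'" by (rule \<pi>.hom_mult)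
  show "\<pi> \<one> = \<one>\<^bsub>D\<^esub>" by (rule \<pi>.hom_one)
  show "\<pi> \<zero> = \<zero>\<^bsub>D\<^esub>" by (rule \<pi>.hom_zero)
  show "r \<in> carrier R \<Longrightarrow> \<pi> (\<ominus> r) = \<ominus>\<^bsub>D\<^esub> \<pi> r" by (rule \<pi>.hom_a_inv)
qed

lemma \<pi>_eq_zero_iff: "r \<in> carrier R \<Longrightarrow> \<pi> r = \<zero>\<^bsub>D\<^esub> \<longleftrightarrow> r \<in> P"
proof -
  assume r: "r \<in> carrier R"
  note zero = zero_FactRing[of R P]
  have "ideal P R" by (rule primeideal.axioms(1)[OF P])
  then show ?thesis
    unfolding zero using ideal.rcos_const_imp_mem[of P R r] R.a_rcos_zero[of P r] r by blast
qed

text \<open>An \<open>R\<close>-linear map from \<open>N/V'\<close> to \<open>R/P\<close>, written as a function on \<open>N\<close>.\<close>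

definition partial_form where
  "partial_form N h \<longleftrightarrow> ideal N R \<and> V' \<subseteq> N \<and> N \<subseteq> V \<and> h \<in> N \<rightarrow> carrier D
     \<and> (\<forall>x\<in>N. \<forall>y\<in>N. h (x \<oplus> y) = h x \<oplus>\<^bsub>D\<^esub> h y)
     \<and> (\<forall>r\<in>carrier R. \<forall>x\<in>N. h (r \<otimes> x) = \<pi> r \<otimes>\<^bsub>D\<^esub> h x)
     \<and> (\<forall>x\<in>V'. h x = \<zero>\<^bsub>D\<^esub>)"

lemma partial_formD:
  assumes "partial_form N h"
  shows "ideal N R" "V' \<subseteq> N" "N \<subseteq> V" "x \<in> N \<Longrightarrow> h x \<in> carrier D"
    "x \<in> N \<Longrightarrow> y \<in> N \<Longrightarrow> h (x \<oplus> y) = h x \<oplus>\<^bsub>D\<^esub> h y"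
    "r \<in> carrier R \<Longrightarrow> x \<in> N \<Longrightarrow> h (r \<otimes> x) = \<pi> r \<otimes>\<^bsub>D\<^esub> h x"
    "x \<in> V' \<Longrightarrow> h x = \<zero>\<^bsub>D\<^esub>"
  using assms by (simp_all add: partial_form_def Pi_iff)

definition adjoin where "adjoin N z = {w \<oplus> r \<otimes> z | w r. w \<in> N \<and> r \<in> carrier R}"

lemma adjoin_props:
  assumes N: "ideal N R" and z: "z \<in> carrier R"
  shows "ideal (adjoin N z) R" "N \<subseteq> adjoin N z" "z \<in> adjoin N z"
proof -
  note ND = idealD[OF N]
  have "adjoin N z = N <+>\<^bsub>R\<^esub> PIdl z"
    unfolding adjoin_def cgenideal_def set_add_def' by auto
  then show "ideal (adjoin N z) R"
    using R.add_ideals[OF N R.cgenideal_ideal[OF z]] by simp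
  show "N \<subseteq> adjoin N z"
  proof
    fix w assume w: "w \<in> N"
    then have "w \<oplus> \<zero> \<otimes> z \<in> adjoin N z" unfolding adjoin_def using R.zero_closed by blast
    then show "w \<in> adjoin N z" using z ND(2)[OF w] by simp
  qed
  have "\<zero> \<oplus> \<one> \<otimes> z \<in> adjoin N z" unfolding adjoin_def using ND(3) R.one_closed by blast
  then show "z \<in> adjoin N z" using z by simp
qed

text \<open>If no multiple \<open>c z\<close> with \<open>c \<notin> P\<close> lies in \<open>N\<close>, the value at \<open>z\<close> may be prescribed: whenever \<open>r z \<in> N\<close>, then \<open>r \<in> P\<close>,
  and \<open>r z\<close> lies in \<open>V'\<close>, where the form vanishes.\<close>

lemma extend_free:
  assumes h: "partial_form N h" and z: "z \<in> V" and free: "\<And>c. c \<in> carrier R - P \<Longrightarrow> c \<otimes> z \<notin> N"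
    and t: "t \<in> carrier D"
  obtains N' h' where "partial_form N' h'" "N \<subseteq> N'" "z \<in> N'" "\<And>x. x \<in> N \<Longrightarrow> h' x = h x" "h' z = t"
proof -
  note hD = partial_formD[OF h]
  note ND = idealD[OF hD(1)]
  have zR: "z \<in> carrier R" by (rule VD(2)[OF z])
  note adj = adjoin_props[OF hD(1) zR]
  have wd: "h w \<oplus>\<^bsub>D\<^esub> \<pi> r \<otimes>\<^bsub>D\<^esub> t = h w' \<oplus>\<^bsub>D\<^esub> \<pi> r' \<otimes>\<^bsub>D\<^esub> t"
    if w: "w \<in> N" "w' \<in> N" and r: "r \<in> carrier R" "r' \<in> carrier R" and eq: "w \<oplus> r \<otimes> z = w' \<oplus> r' \<otimes> z"
    for w w' r r'
  proof -
    have wR: "w \<in> carrier R" "w' \<in> carrier R" using w ND(2) by auto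
    have e: "(r \<ominus> r') \<otimes> z = w' \<ominus> w"
    proof -
      have "(r \<ominus> r') \<otimes> z = (w \<oplus> r \<otimes> z) \<ominus> w \<ominus> r' \<otimes> z" using wR r zR by algebra
      also have "\<dots> = w' \<ominus> w" unfolding eq using wR r zR by algebra
      finally show ?thesis .
    qed
    then have "(r \<ominus> r') \<otimes> z \<in> N" using ND(6) w by simp
    then have rP: "r \<ominus> r' \<in> P" using free[of "r \<ominus> r'"] r by auto
    then have "w' \<ominus> w \<in> V'" using PV[OF rP z] e by simp
    moreover have "w' = w \<oplus> (w' \<ominus> w)" using wR by algebra
    ultimately have "h w' = h w" using hD(2,4,5,7) w by (metis D.r_zero subsetD)
    moreover have "\<pi> r = \<pi> r'"
    proof -
      have "\<pi> (r \<ominus> r') = \<zero>\<^bsub>D\<^esub>" using rP r \<pi>_eq_zero_iff[of "r \<ominus> r'"] by blast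
      then have "\<pi> r \<ominus>\<^bsub>D\<^esub> \<pi> r' = \<zero>\<^bsub>D\<^esub>" using r by (simp add: a_minus_def)
      then show ?thesis using r by simp
    qed
    ultimately show ?thesis by simp
  qed
  define h' where "h' x = (SOME v. \<exists>w\<in>N. \<exists>r\<in>carrier R. x = w \<oplus> r \<otimes> z \<and> v = h w \<oplus>\<^bsub>D\<^esub> \<pi> r \<otimes>\<^bsub>D\<^esub> t)" for x
  have h': "h' (w \<oplus> r \<otimes> z) = h w \<oplus>\<^bsub>D\<^esub> \<pi> r \<otimes>\<^bsub>D\<^esub> t" if "w \<in> N" "r \<in> carrier R" for w r
  proof -
    have "\<exists>w'\<in>N. \<exists>r'\<in>carrier R. w \<oplus> r \<otimes> z = w' \<oplus> r' \<otimes> z \<and> h' (w \<oplus> r \<otimes> z) = h w' \<oplus>\<^bsub>D\<^esub> \<pi> r' \<otimes>\<^bsub>D\<^esub> t"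
      unfolding h'_def by (rule someI_ex) (use that in blast)
    then show ?thesis using wd that by metis
  qed
  have adjE: "\<exists>w r. w \<in> N \<and> r \<in> carrier R \<and> x = w \<oplus> r \<otimes> z" if "x \<in> adjoin N z" for x
    using that unfolding adjoin_def by blast
  have ext: "h' w = h w" if "w \<in> N" for w
    using h'[OF that R.zero_closed] zR t hD(4)[OF that] ND(2)[OF that] by simp
  have hz: "h' z = t" using h'[OF ND(3) R.one_closed] zR t hD(7)[OF V'D(3)] by simp
  have "partial_form (adjoin N z) h'"
    unfolding partial_form_def
  proof (intro conjI ballI)
    show "ideal (adjoin N z) R" by (rule adj)
    show "V' \<subseteq> adjoin N z" using adj(2) hD(2) by blast
    show "adjoin N z \<subseteq> V" using hD(3) z unfolding adjoin_def by (auto intro: VD(4,5))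
    show "h' \<in> adjoin N z \<rightarrow> carrier D"
    proof
      fix x assume "x \<in> adjoin N z"
      then obtain w r where "w \<in> N" "r \<in> carrier R" "x = w \<oplus> r \<otimes> z" using adjE by blast
      then show "h' x \<in> carrier D" using h' hD(4) t by simp
    qed
  next
    fix x y assume "x \<in> adjoin N z" "y \<in> adjoin N z"
    then obtain w r w' r' where *: "w \<in> N" "r \<in> carrier R" "x = w \<oplus> r \<otimes> z"
      "w' \<in> N" "r' \<in> carrier R" "y = w' \<oplus> r' \<otimes> z" using adjE by meson
    have "x \<oplus> y = (w \<oplus> w') \<oplus> (r \<oplus> r') \<otimes> z" using * zR ND(2) by (simp add: R.l_distr R.a_ac)
    then have "h' (x \<oplus> y) = h (w \<oplus> w') \<oplus>\<^bsub>D\<^esub> \<pi> (r \<oplus> r') \<otimes>\<^bsub>D\<^esub> t" using h' * ND(4) by simp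
    also have "\<dots> = (h w \<oplus>\<^bsub>D\<^esub> \<pi> r \<otimes>\<^bsub>D\<^esub> t) \<oplus>\<^bsub>D\<^esub> (h w' \<oplus>\<^bsub>D\<^esub> \<pi> r' \<otimes>\<^bsub>D\<^esub> t)"
      using * hD(4,5) t by (simp add: D.l_distr D.a_ac)
    finally show "h' (x \<oplus> y) = h' x \<oplus>\<^bsub>D\<^esub> h' y" using h' * by simp
  next
    fix a x assume a: "a \<in> carrier R" and "x \<in> adjoin N z"
    then obtain w r where *: "w \<in> N" "r \<in> carrier R" "x = w \<oplus> r \<otimes> z" using adjE by blast
    have "a \<otimes> x = a \<otimes> w \<oplus> (a \<otimes> r) \<otimes> z" using * a zR ND(2) by (simp add: R.r_distr R.m_assoc)
    then have "h' (a \<otimes> x) = h (a \<otimes> w) \<oplus>\<^bsub>D\<^esub> \<pi> (a \<otimes> r) \<otimes>\<^bsub>D\<^esub> t" using h' * a ND(5) by simp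
    also have "\<dots> = \<pi> a \<otimes>\<^bsub>D\<^esub> (h w \<oplus>\<^bsub>D\<^esub> \<pi> r \<otimes>\<^bsub>D\<^esub> t)"
      using * a hD(4,6) t by (simp add: D.r_distr D.m_assoc)
    finally show "h' (a \<otimes> x) = \<pi> a \<otimes>\<^bsub>D\<^esub> h' x" using h' * by simp
  next
    fix x assume "x \<in> V'"
    then show "h' x = \<zero>\<^bsub>D\<^esub>" using ext hD(2,7) by auto
  qed
  then show thesis by (rule that[OF _ adj(2,3) ext hz])
qed

text \<open>If \<open>c z\<close> lies in \<open>N\<close>, then multiplication by \<open>c\<close> maps the enlarged module into \<open>N\<close>; the form is extended
  at the price of a factor \<open>c\<close>, which is nonzero in \<open>R/P\<close>.\<close>

lemma extend_torsion:
  assumes h: "partial_form N h" and z: "z \<in> V" and c: "c \<in> carrier R - P" "c \<otimes> z \<in> N"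
  obtains N' h' where "partial_form N' h'" "N \<subseteq> N'" "z \<in> N'" "\<And>x. x \<in> N \<Longrightarrow> h' x = \<pi> c \<otimes>\<^bsub>D\<^esub> h x"
proof -
  note hD = partial_formD[OF h]
  note ND = idealD[OF hD(1)]
  have zR: "z \<in> carrier R" by (rule VD(2)[OF z])
  have cR: "c \<in> carrier R" using c by simp
  note adj = adjoin_props[OF hD(1) zR]
  have cN: "c \<otimes> x \<in> N" if "x \<in> adjoin N z" for x
  proof -
    obtain w r where *: "w \<in> N" "r \<in> carrier R" "x = w \<oplus> r \<otimes> z"
      using \<open>x \<in> adjoin N z\<close> unfolding adjoin_def by blast
    have "c \<otimes> x = c \<otimes> w \<oplus> r \<otimes> (c \<otimes> z)" using * cR zR ND(2) by (simp add: R.r_distr R.m_lcomm)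
    then show ?thesis using * cR c(2) ND(4,5) by simp
  qed
  have aR: "x \<in> carrier R" if "x \<in> adjoin N z" for x
    using that adj(1) by (simp add: ideal.Icarr)
  define h' where "h' x = h (c \<otimes> x)" for x
  have "partial_form (adjoin N z) h'"
    unfolding partial_form_def
  proof (intro conjI ballI)
    show "ideal (adjoin N z) R" by (rule adj)
    show "V' \<subseteq> adjoin N z" using adj(2) hD(2) by blast
    show "adjoin N z \<subseteq> V" using hD(3) z unfolding adjoin_def by (auto intro: VD(4,5))
    show "h' \<in> adjoin N z \<rightarrow> carrier D" unfolding h'_def using cN hD(4) by blast
  next
    fix x y assume "x \<in> adjoin N z" "y \<in> adjoin N z"
    then show "h' (x \<oplus> y) = h' x \<oplus>\<^bsub>D\<^esub> h' y"
      unfolding h'_def using cN hD(5) cR aR by (simp add: R.r_distr)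
  next
    fix a x assume a: "a \<in> carrier R" and "x \<in> adjoin N z"
    then show "h' (a \<otimes> x) = \<pi> a \<otimes>\<^bsub>D\<^esub> h' x"
      unfolding h'_def using cN hD(6) cR aR by (simp add: R.m_lcomm)
  next
    fix x assume "x \<in> V'"
    then show "h' x = \<zero>\<^bsub>D\<^esub>" unfolding h'_def using hD(7) cR V'D(5) by simp
  qed
  moreover have "h' x = \<pi> c \<otimes>\<^bsub>D\<^esub> h x" if "x \<in> N" for x
    unfolding h'_def using hD(6) cR that by simp
  ultimately show thesis by (rule that[OF _ adj(2,3)])
qed

text \<open>Starting from the value \<open>1\<close> at \<open>y\<close>, which is allowed by torsion-freeness, the elements of \<open>Y\<close> are adjoined one by
  one. Each step costs at most a nonzero factor, so finiteness of \<open>Y\<close> keeps the value at \<open>y\<close> nonzero.\<close>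

lemma partial_form_exists:
  assumes y: "y \<in> V" "y \<notin> V'" and Y: "finite Y" "Y \<subseteq> V"
  shows "\<exists>N h. partial_form N h \<and> y \<in> N \<and> Y \<subseteq> N \<and> h y \<noteq> \<zero>\<^bsub>D\<^esub>"
  using Y
proof (induct Y rule: finite_induct)
  case empty
  have "partial_form V' (\<lambda>_. \<zero>\<^bsub>D\<^esub>)"
    unfolding partial_form_def using V' V'V V'D by auto
  then obtain N h where "partial_form N h" "y \<in> N" "h y = \<one>\<^bsub>D\<^esub>"
    using extend_free[of V' "\<lambda>_. \<zero>\<^bsub>D\<^esub>" y "\<one>\<^bsub>D\<^esub>"] torsion_free y by (metis D.one_closed)
  then show ?case by (metis D.one_not_zero empty_subsetI)
next
  case (insert z Y)
  then obtain N h where N: "partial_form N h" "y \<in> N" "Y \<subseteq> N" "h y \<noteq> \<zero>\<^bsub>D\<^esub>" by auto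
  have z: "z \<in> V" using insert by simp
  show ?case
  proof (cases "\<exists>c \<in> carrier R - P. c \<otimes> z \<in> N")
    case True
    then obtain c where c: "c \<in> carrier R - P" "c \<otimes> z \<in> N" by blast
    obtain N' h' where N': "partial_form N' h'" "N \<subseteq> N'" "z \<in> N'" "\<And>x. x \<in> N \<Longrightarrow> h' x = \<pi> c \<otimes>\<^bsub>D\<^esub> h x"
      using extend_torsion[OF N(1) z c] by blast
    have "\<pi> c \<noteq> \<zero>\<^bsub>D\<^esub>" using \<pi>_eq_zero_iff c by blast
    then have "h' y \<noteq> \<zero>\<^bsub>D\<^esub>"
      using N'(4)[OF N(2)] N(4) D.integral_iff partial_formD(4)[OF N(1,2)] c(1) by simp
    moreover have "y \<in> N'" "insert z Y \<subseteq> N'" using N' N by blast+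
    ultimately show ?thesis using N'(1) by blast
  next
    case False
    obtain N' h' where N': "partial_form N' h'" "N \<subseteq> N'" "z \<in> N'" "\<And>x. x \<in> N \<Longrightarrow> h' x = h x"
    proof (rule extend_free[OF N(1) z _ D.zero_closed])
      show "c \<otimes> z \<notin> N" if "c \<in> carrier R - P" for c using False that by blast
    qed (rule that)
    have "y \<in> N'" "insert z Y \<subseteq> N'" using N' N by blast+
    moreover have "h' y \<noteq> \<zero>\<^bsub>D\<^esub>" using N'(4)[OF N(2)] N(4) by simp
    ultimately show ?thesis using N'(1) by blast
  qed
qed

end

lemma algebra_vec_space: "field F \<Longrightarrow> algebra F R \<Longrightarrow> vec_space F R"
  by (simp add: vec_space_def algebra_def)

lemma (in algebra) ideal_submodule:
  assumes "ideal I M" shows "submodule I R M"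
proof -
  interpret I: ideal I M by fact
  show ?thesis
  proof (rule submoduleI)
    fix c x assume c: "c \<in> carrier R" "x \<in> I"
    then have "c \<odot>\<^bsub>M\<^esub> x = (c \<odot>\<^bsub>M\<^esub> \<one>\<^bsub>M\<^esub>) \<otimes>\<^bsub>M\<^esub> x" by (simp add: smult_assoc2)
    then show "c \<odot>\<^bsub>M\<^esub> x \<in> I" using c I.I_l_closed by simp
  qed auto
qed

text \<open>Compose a form \<open>h\<close> on \<open>N/V'\<close> with a point of \<open>R/P\<close> at which neither \<open>h y\<close> nor \<open>b\<close> vanishes. The result is defined on
  \<open>N\<close> only; a linear form that separates \<open>y\<close> from its kernel extends it to all of \<open>R\<close>.\<close>

theorem layer_point:
  fixes F (structure) and R (structure)
  assumes aff: "affine_algebra F R" and F: "algebraically_closed F"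
    and layer: "torsion_free_layer R P V V'"
    and b: "b \<in> carrier R - P" and y: "y \<in> V" "y \<notin> V'" and Y: "finite Y" "Y \<subseteq> V"
  obtains \<epsilon> \<mu> where "\<epsilon> \<in> ring_hom R F" "linear_form F R \<epsilon>" "\<And>p. p \<in> P \<Longrightarrow> \<epsilon> p = \<zero>" "\<epsilon> b \<noteq> \<zero>"
    "linear_form F R \<mu>" "\<And>v. v \<in> V' \<Longrightarrow> \<mu> v = \<zero>" "\<mu> y \<noteq> \<zero>"
    "\<And>r w. r \<in> carrier R \<Longrightarrow> w \<in> Y \<Longrightarrow> \<mu> (r \<otimes>\<^bsub>R\<^esub> w) = \<epsilon> r \<otimes> \<mu> w"
proof -
  interpret F: algebraically_closed F by fact
  interpret torsion_free_layer R P V V' by fact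
  interpret Alg: affine_algebra F R by fact
  interpret VS: vec_space F R
    by (rule algebra_vec_space[OF F.field_axioms Alg.algebra_axioms])
  obtain N h where N: "partial_form N h" "y \<in> N" "Y \<subseteq> N" "h y \<noteq> \<zero>\<^bsub>D\<^esub>"
    using partial_form_exists[OF y Y] by blast
  note ND = idealD[OF partial_formD(1)[OF N(1)]]
  note hD = partial_formD[OF N(1)]
  have bD: "\<pi> b \<in> carrier D" "\<pi> b \<noteq> \<zero>\<^bsub>D\<^esub>" using b \<pi>_eq_zero_iff by auto
  have "h y \<otimes>\<^bsub>D\<^esub> \<pi> b \<in> carrier D" "h y \<otimes>\<^bsub>D\<^esub> \<pi> b \<noteq> \<zero>\<^bsub>D\<^esub>"
    using hD(4)[OF N(2)] N(4) bD D.integral by auto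
  then obtain e where e: "e \<in> ring_hom D F"
    "\<forall>c\<in>carrier F. e (\<pi> (c \<odot>\<^bsub>R\<^esub> \<one>\<^bsub>R\<^esub>)) = c" "e (h y \<otimes>\<^bsub>D\<^esub> \<pi> b) \<noteq> \<zero>"
    using points_of_affine_quotient[OF aff F P] by blast
  interpret e: ring_hom_ring D F e
    by (rule ring_hom_ringI2[OF D.ring_axioms F.ring_axioms e(1)])
  have e_hy: "e (h y) \<in> carrier F" using hD(4)[OF N(2)] by simp
  have prod: "e (h y) \<otimes> e (\<pi> b) \<noteq> \<zero>" using e(3) hD(4)[OF N(2)] bD by simp
  then have nz: "e (h y) \<noteq> \<zero>" "e (\<pi> b) \<noteq> \<zero>" using e_hy bD by auto
  define \<epsilon> where "\<epsilon> r = e (\<pi> r)" for r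
  have \<epsilon>_hom: "\<epsilon> \<in> ring_hom R F"
    unfolding \<epsilon>_def by (rule ring_hom_memI) simp_all
  have smul: "c \<odot>\<^bsub>R\<^esub> x = (c \<odot>\<^bsub>R\<^esub> \<one>\<^bsub>R\<^esub>) \<otimes>\<^bsub>R\<^esub> x" if "c \<in> carrier F" "x \<in> carrier R" for c x
    using that by (simp add: Alg.smult_assoc2)
  have \<epsilon>_lin: "linear_form F R \<epsilon>"
    unfolding linear_form_def
  proof (intro conjI ballI)
    fix c x assume c: "c \<in> carrier F" "x \<in> carrier R"
    have "\<epsilon> (c \<odot>\<^bsub>R\<^esub> x) = \<epsilon> ((c \<odot>\<^bsub>R\<^esub> \<one>\<^bsub>R\<^esub>) \<otimes>\<^bsub>R\<^esub> x)" using smul[OF c] by simp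
    also have "\<dots> = c \<otimes> \<epsilon> x" unfolding \<epsilon>_def using c e(2) by simp
    finally show "\<epsilon> (c \<odot>\<^bsub>R\<^esub> x) = c \<otimes> \<epsilon> x" .
  qed (simp_all add: \<epsilon>_def)
  have \<epsilon>_P: "\<epsilon> p = \<zero>" if "p \<in> P" for p
    using that \<pi>_eq_zero_iff[of p] idealD(2)[OF primeideal.axioms(1)[OF P] that] unfolding \<epsilon>_def by simp
  have eh_smult: "e (h (c \<odot>\<^bsub>R\<^esub> w)) = c \<otimes> e (h w)" if "c \<in> carrier F" "w \<in> N" for c w
  proof -
    have wR: "w \<in> carrier R" using that ND(2) by blast
    have "h (c \<odot>\<^bsub>R\<^esub> w) = \<pi> (c \<odot>\<^bsub>R\<^esub> \<one>\<^bsub>R\<^esub>) \<otimes>\<^bsub>D\<^esub> h w"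
      using smul[OF that(1) wR] hD(6)[OF _ that(2)] that(1) by simp
    then show ?thesis using e(2) that hD(4) by simp
  qed
  have NS: "submodule N F R" by (rule Alg.ideal_submodule[OF hD(1)])
  note NSD = VS.submoduleD[OF NS]
  define U where "U = {w \<in> N. e (h w) = \<zero>}"
  have U: "submodule U F R"
  proof (rule VS.submodule_addI)
    show "U \<subseteq> carrier R" unfolding U_def using ND(1) by blast
    show "\<zero>\<^bsub>R\<^esub> \<in> U" unfolding U_def using hD(7)[OF V'D(3)] ND(3) by simp
    show "x \<oplus>\<^bsub>R\<^esub> w \<in> U" if "x \<in> U" "w \<in> U" for x w
      using that hD(4)[of x] hD(4)[of w] hD(5)[of x w] ND(4)[of x w] unfolding U_def by auto
    show "c \<odot>\<^bsub>R\<^esub> x \<in> U" if "c \<in> carrier F" "x \<in> U" for c x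
      using that eh_smult[of c x] NSD(4)[of c x] unfolding U_def by auto
  qed
  have "y \<in> carrier R" "y \<notin> U" using N(2) nz ND(2) unfolding U_def by auto
  then obtain l where l: "linear_form F R l" "\<And>u. u \<in> U \<Longrightarrow> l u = \<zero>" "l y = \<one>"
    using VS.separating_linear_form[OF U] by metis
  define \<mu> where "\<mu> x = e (h y) \<otimes> l x" for x
  have \<mu>_lin: "linear_form F R \<mu>"
    unfolding linear_form_def \<mu>_def using e_hy linear_formD[OF l(1)]
    by (auto simp: F.r_distr F.m_lcomm)
  have \<mu>_N: "\<mu> w = e (h w)" if w: "w \<in> N" for w
  proof -
    have yU: "e (h y) \<in> Units F" using nz e_hy F.field_Units by blast
    have hw: "e (h w) \<in> carrier F" using hD(4)[OF w] by simp
    \<comment> \<open>Subtracting the right multiple of \<open>y\<close> moves \<open>w\<close> into the kernel \<open>U\<close>, so \<open>\<mu>\<close> is determined on \<open>N\<close> by its value at \<open>y\<close>.\<close>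
    define d where "d = e (h w) \<otimes> inv e (h y)"
    have d: "d \<in> carrier F" "d \<otimes> e (h y) = e (h w)"
      unfolding d_def using yU hw e_hy by (simp_all add: F.m_assoc)
    define x where "x = w \<ominus>\<^bsub>R\<^esub> d \<odot>\<^bsub>R\<^esub> y"
    have dy: "d \<odot>\<^bsub>R\<^esub> y \<in> N" using NSD(4) d N(2) by blast
    have x: "x \<in> N" unfolding x_def using NSD(6)[OF w dy] .
    have wx: "w = x \<oplus>\<^bsub>R\<^esub> d \<odot>\<^bsub>R\<^esub> y" unfolding x_def using ND(2)[OF w] ND(2)[OF dy]
      by (simp add: a_minus_def R.add.m_assoc R.l_neg)
    have "e (h w) = e (h x) \<oplus> d \<otimes> e (h y)"
      using wx hD(4,5) x dy eh_smult[OF d(1) N(2)] by simp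
    then have "e (h x) = \<zero>" using d hD(4)[OF x] hw
      by (metis F.add.r_cancel_one e.hom_closed)
    then have "l x = \<zero>" using l(2) x unfolding U_def by blast
    then have "l w = d"
      using wx linear_formD[OF l(1)] d x dy l(3) N(2) by (simp add: ND(2))
    then show ?thesis unfolding \<mu>_def using d e_hy by (simp add: F.m_comm)
  qed
  show thesis
  proof (rule that[OF \<epsilon>_hom \<epsilon>_lin \<epsilon>_P _ \<mu>_lin])
    show "\<epsilon> b \<noteq> \<zero>" unfolding \<epsilon>_def by (rule nz)
    show "\<mu> v = \<zero>" if "v \<in> V'" for v using that \<mu>_N hD(2,7) by auto
    show "\<mu> y \<noteq> \<zero>" using \<mu>_N N(2) nz by simp
    show "\<mu> (r \<otimes>\<^bsub>R\<^esub> w) = \<epsilon> r \<otimes> \<mu> w" if "r \<in> carrier R" "w \<in> Y" for r w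
    proof -
      have w: "w \<in> N" using that N(3) by blast
      have "r \<otimes>\<^bsub>R\<^esub> w \<in> N" using w that ND(5) by blast
      then show ?thesis using \<mu>_N w hD(4,6) that unfolding \<epsilon>_def by simp
    qed
  qed
qed

section \<open>The monoid algebra and evaluation of coefficients\<close>

lemma (in abelian_monoid) finsum_swap:
  assumes "finite A" "finite B" "\<And>x y. x \<in> A \<Longrightarrow> y \<in> B \<Longrightarrow> f x y \<in> carrier G"
  shows "(\<Oplus>x\<in>A. \<Oplus>y\<in>B. f x y) = (\<Oplus>y\<in>B. \<Oplus>x\<in>A. f x y)"
  using assms(1,3)
proof (induct A rule: finite_induct)
  case (insert a A)
  have c: "(\<lambda>y. f a y) \<in> B \<rightarrow> carrier G" "(\<lambda>y. \<Oplus>x\<in>A. f x y) \<in> B \<rightarrow> carrier G"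
    using insert by (auto intro!: finsum_closed)
  have "(\<Oplus>x\<in>insert a A. \<Oplus>y\<in>B. f x y) = (\<Oplus>y\<in>B. f a y) \<oplus> (\<Oplus>x\<in>A. \<Oplus>y\<in>B. f x y)"
    using insert by (intro finsum_insert) (auto intro!: finsum_closed)
  also have "\<dots> = (\<Oplus>y\<in>B. f a y) \<oplus> (\<Oplus>y\<in>B. \<Oplus>x\<in>A. f x y)" using insert by simp
  also have "\<dots> = (\<Oplus>y\<in>B. f a y \<oplus> (\<Oplus>x\<in>A. f x y))" using finsum_addf[OF c] by simp
  also have "\<dots> = (\<Oplus>y\<in>B. \<Oplus>x\<in>insert a A. f x y)"
    using insert by (intro finsum_cong' refl) (auto intro!: finsum_closed finsum_insert[symmetric])
  finally show ?case .
qed simp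

text \<open>The \<open>F\<close>-linear extension of \<open>\<Phi>\<close> from basis elements to the monoid algebra.\<close>

definition eval_coeffs :: "('f, 'c) ring_scheme \<Rightarrow> ('x \<Rightarrow> 'f) \<Rightarrow> ('x \<Rightarrow> 'f) \<Rightarrow> 'f" where
  "eval_coeffs F \<Phi> g = (\<Oplus>\<^bsub>F\<^esub>x\<in>coeff_support F g. g x \<otimes>\<^bsub>F\<^esub> \<Phi> x)"

locale monoid_alg = F: cring F + M: comm_monoid M for F (structure) and M (structure)
begin

abbreviation "A \<equiv> monoid_algebra F M"
abbreviation "supp \<equiv> coeff_support F"
abbreviation "ev \<equiv> eval_coeffs F"
abbreviation "\<delta> z \<equiv> (\<lambda>x. if x = z then \<one> else \<zero>)"

lemma monoid_algebra_simps:
  "carrier A = {f. (\<forall>x. f x \<in> carrier F) \<and> supp f \<subseteq> carrier M \<and> finite (supp f)}"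
  "g \<otimes>\<^bsub>A\<^esub> h = (\<lambda>z. \<Oplus>x \<in> supp g. \<Oplus>y \<in> supp h.
                       if x \<otimes>\<^bsub>M\<^esub> y = z then g x \<otimes> h y else \<zero>)"
  "\<one>\<^bsub>A\<^esub> = monomial F \<one> \<one>\<^bsub>M\<^esub>" "\<zero>\<^bsub>A\<^esub> = (\<lambda>_. \<zero>)" "g \<oplus>\<^bsub>A\<^esub> h = (\<lambda>z. g z \<oplus> h z)"
  unfolding monoid_algebra_def by simp_all

lemma monoid_algebraD:
  assumes "g \<in> carrier A"
  shows "g x \<in> carrier F" "supp g \<subseteq> carrier M" "x \<in> supp g \<Longrightarrow> x \<in> carrier M" "finite (supp g)"
  using assms unfolding monoid_algebra_simps by auto

lemma monoid_algebraI:
  assumes "\<And>x. g x \<in> carrier F" "finite S" "S \<subseteq> carrier M" "\<And>x. x \<notin> S \<Longrightarrow> g x = \<zero>"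
  shows "g \<in> carrier A"
proof -
  have "supp g \<subseteq> S" unfolding coeff_support_def using assms(4) by blast
  then show ?thesis unfolding monoid_algebra_simps using assms finite_subset by blast
qed

lemma supp_zero: "x \<notin> supp g \<Longrightarrow> g x = \<zero>"
  unfolding coeff_support_def by simp

lemma ev_superset:
  assumes g: "g \<in> carrier A" and S: "finite S" "supp g \<subseteq> S" and \<Phi>: "\<And>x. x \<in> S \<Longrightarrow> \<Phi> x \<in> carrier F"
  shows "ev \<Phi> g = (\<Oplus>x\<in>S. g x \<otimes> \<Phi> x)"
  unfolding eval_coeffs_def
proof (rule F.add.finprod_mono_neutral_cong_left[OF S])
  show "g x \<otimes> \<Phi> x = \<zero>" if "x \<in> S - supp g" for x
    using supp_zero[of x g] \<Phi>[of x] that by simp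
  show "(\<lambda>x. g x \<otimes> \<Phi> x) \<in> S \<rightarrow> carrier F"
    using monoid_algebraD(1)[OF g] \<Phi> by auto
qed simp

lemma ev_closed:
  assumes "g \<in> carrier A" "\<And>x. x \<in> supp g \<Longrightarrow> \<Phi> x \<in> carrier F"
  shows "ev \<Phi> g \<in> carrier F"
  unfolding eval_coeffs_def using assms monoid_algebraD(1)[OF assms(1)] by (intro F.finsum_closed) auto

lemma ev_cong:
  assumes "g \<in> carrier A" "\<And>x. x \<in> supp g \<Longrightarrow> \<Psi> x \<in> carrier F" "\<And>x. x \<in> supp g \<Longrightarrow> \<Phi> x = \<Psi> x"
  shows "ev \<Phi> g = ev \<Psi> g"
  unfolding eval_coeffs_def using assms monoid_algebraD(1)[OF assms(1)] by (intro F.finsum_cong') auto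

lemma ev_eq_zero:
  assumes "g \<in> carrier A" "\<And>x. x \<in> supp g \<Longrightarrow> \<Phi> x = \<zero>"
  shows "ev \<Phi> g = \<zero>"
  unfolding eval_coeffs_def using assms monoid_algebraD(1)[OF assms(1)] by (intro F.add.finprod_one_eqI) auto

lemma ev_add:
  assumes g: "g \<in> carrier A" and h: "h \<in> carrier A" and \<Phi>: "\<And>x. x \<in> carrier M \<Longrightarrow> \<Phi> x \<in> carrier F"
  shows "g \<oplus>\<^bsub>A\<^esub> h \<in> carrier A" "ev \<Phi> (g \<oplus>\<^bsub>A\<^esub> h) = ev \<Phi> g \<oplus> ev \<Phi> h"
proof -
  note gD = monoid_algebraD[OF g] and hD = monoid_algebraD[OF h]
  let ?S = "supp g \<union> supp h"
  have S: "finite ?S" "?S \<subseteq> carrier M" using gD hD by auto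
  show c: "g \<oplus>\<^bsub>A\<^esub> h \<in> carrier A"
    by (rule monoid_algebraI[OF _ S]) (use gD hD in \<open>auto simp: monoid_algebra_simps(5) supp_zero\<close>)
  have "supp (g \<oplus>\<^bsub>A\<^esub> h) \<subseteq> ?S"
  proof
    fix x assume x: "x \<in> supp (g \<oplus>\<^bsub>A\<^esub> h)"
    show "x \<in> ?S"
    proof (rule ccontr)
      assume "x \<notin> ?S"
      then have "(g \<oplus>\<^bsub>A\<^esub> h) x = \<zero>" by (simp add: monoid_algebra_simps(5) supp_zero)
      then show False using x unfolding coeff_support_def by simp
    qed
  qed
  then have "ev \<Phi> (g \<oplus>\<^bsub>A\<^esub> h) = (\<Oplus>x\<in>?S. (g \<oplus>\<^bsub>A\<^esub> h) x \<otimes> \<Phi> x)"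
    using S \<Phi> by (intro ev_superset[OF c]) auto
  also have "\<dots> = (\<Oplus>x\<in>?S. g x \<otimes> \<Phi> x \<oplus> h x \<otimes> \<Phi> x)"
    using S(2) \<Phi> gD(1) hD(1) by (intro F.finsum_cong') (auto simp: monoid_algebra_simps(5) F.l_distr subset_iff)
  also have "\<dots> = (\<Oplus>x\<in>?S. g x \<otimes> \<Phi> x) \<oplus> (\<Oplus>x\<in>?S. h x \<otimes> \<Phi> x)"
    using S(2) \<Phi> gD(1) hD(1) by (intro F.finsum_addf) (auto simp: subset_iff)
  also have "\<dots> = ev \<Phi> g \<oplus> ev \<Phi> h"
  proof -
    have \<Phi>S: "\<Phi> x \<in> carrier F" if "x \<in> ?S" for x using \<Phi> S(2) that by blast
    show ?thesis using ev_superset[OF g S(1) _ \<Phi>S] ev_superset[OF h S(1) _ \<Phi>S] by simp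
  qed
  finally show "ev \<Phi> (g \<oplus>\<^bsub>A\<^esub> h) = ev \<Phi> g \<oplus> ev \<Phi> h" .
qed

lemma ev_add_form:
  assumes g: "g \<in> carrier A" and "\<And>x. x \<in> supp g \<Longrightarrow> \<Phi> x \<in> carrier F" "\<And>x. x \<in> supp g \<Longrightarrow> \<Psi> x \<in> carrier F"
  shows "ev (\<lambda>x. \<Phi> x \<oplus> \<Psi> x) g = ev \<Phi> g \<oplus> ev \<Psi> g"
proof -
  have "ev (\<lambda>x. \<Phi> x \<oplus> \<Psi> x) g = (\<Oplus>x\<in>supp g. g x \<otimes> \<Phi> x \<oplus> g x \<otimes> \<Psi> x)"
    unfolding eval_coeffs_def using assms monoid_algebraD(1)[OF g] by (intro F.finsum_cong') (auto simp: F.r_distr)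
  also have "\<dots> = ev \<Phi> g \<oplus> ev \<Psi> g"
    unfolding eval_coeffs_def using assms monoid_algebraD(1)[OF g] by (intro F.finsum_addf) auto
  finally show ?thesis .
qed

lemma ev_smult_form:
  assumes g: "g \<in> carrier A" and "\<And>x. x \<in> supp g \<Longrightarrow> \<Phi> x \<in> carrier F" "c \<in> carrier F"
  shows "ev (\<lambda>x. c \<otimes> \<Phi> x) g = c \<otimes> ev \<Phi> g"
proof -
  have "ev (\<lambda>x. c \<otimes> \<Phi> x) g = (\<Oplus>x\<in>supp g. c \<otimes> (g x \<otimes> \<Phi> x))"
    unfolding eval_coeffs_def using assms monoid_algebraD(1)[OF g] by (intro F.finsum_cong') (auto simp: F.m_lcomm)
  also have "\<dots> = c \<otimes> ev \<Phi> g"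
    unfolding eval_coeffs_def using assms monoid_algebraD(1,4)[OF g] by (intro F.finsum_rdistr[symmetric]) auto
  finally show ?thesis .
qed

lemma ev_finsum_form:
  assumes g: "g \<in> carrier A" and "finite S" "\<And>s x. s \<in> S \<Longrightarrow> x \<in> supp g \<Longrightarrow> \<Phi> s x \<in> carrier F"
  shows "ev (\<lambda>x. \<Oplus>s\<in>S. \<Phi> s x) g = (\<Oplus>s\<in>S. ev (\<Phi> s) g)"
proof -
  have "ev (\<lambda>x. \<Oplus>s\<in>S. \<Phi> s x) g = (\<Oplus>x\<in>supp g. \<Oplus>s\<in>S. g x \<otimes> \<Phi> s x)"
    unfolding eval_coeffs_def using assms monoid_algebraD(1)[OF g]
    by (intro F.finsum_cong') (auto intro!: F.finsum_closed F.finsum_rdistr)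
  also have "\<dots> = (\<Oplus>s\<in>S. \<Oplus>x\<in>supp g. g x \<otimes> \<Phi> s x)"
    using assms monoid_algebraD(1,4)[OF g] by (intro F.finsum_swap) auto
  finally show ?thesis unfolding eval_coeffs_def .
qed

lemma ev_swap:
  assumes g: "g \<in> carrier A" and h: "h \<in> carrier A"
    and \<Phi>: "\<And>x y. x \<in> supp g \<Longrightarrow> y \<in> supp h \<Longrightarrow> \<Phi> x y \<in> carrier F"
  shows "ev (\<lambda>x. ev (\<lambda>y. \<Phi> x y) h) g = ev (\<lambda>y. ev (\<lambda>x. \<Phi> x y) g) h"
proof -
  have "ev (\<lambda>x. ev (\<lambda>y. \<Phi> x y) h) g = ev (\<lambda>x. \<Oplus>y\<in>supp h. h y \<otimes> \<Phi> x y) g"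
    unfolding eval_coeffs_def[of F _ h] ..
  also have "\<dots> = (\<Oplus>y\<in>supp h. ev (\<lambda>x. h y \<otimes> \<Phi> x y) g)"
    using monoid_algebraD(1,4)[OF h] \<Phi> by (intro ev_finsum_form[OF g]) auto
  also have "\<dots> = (\<Oplus>y\<in>supp h. h y \<otimes> ev (\<lambda>x. \<Phi> x y) g)"
    using monoid_algebraD(1,4)[OF h] \<Phi> ev_smult_form[OF g] ev_closed[OF g] by (intro F.finsum_cong') auto
  finally show ?thesis unfolding eval_coeffs_def[of F _ h] .
qed

lemma ev_delta:
  assumes g: "g \<in> carrier A"
  shows "ev (\<delta> z) g = g z"
proof -
  have "ev (\<delta> z) g = (\<Oplus>x\<in>insert z (supp g). g x \<otimes> \<delta> z x)"
    using monoid_algebraD(4)[OF g] by (intro ev_superset[OF g]) auto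
  also have "\<dots> = (\<Oplus>x\<in>insert z (supp g). if z = x then g x else \<zero>)"
    using monoid_algebraD(1)[OF g] by (intro F.finsum_cong') auto
  also have "\<dots> = g z"
    using monoid_algebraD(1,4)[OF g] by (intro F.finsum_singleton) auto
  finally show ?thesis .
qed

lemma mult_eq_ev:
  assumes g: "g \<in> carrier A" and h: "h \<in> carrier A"
  shows "(g \<otimes>\<^bsub>A\<^esub> h) z = ev (\<lambda>x. ev (\<lambda>y. \<delta> z (x \<otimes>\<^bsub>M\<^esub> y)) h) g"
proof -
  have "g x \<otimes> ev (\<lambda>y. \<delta> z (x \<otimes>\<^bsub>M\<^esub> y)) h
     = (\<Oplus>y \<in> supp h. if x \<otimes>\<^bsub>M\<^esub> y = z then g x \<otimes> h y else \<zero>)" for x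
  proof -
    have "g x \<otimes> ev (\<lambda>y. \<delta> z (x \<otimes>\<^bsub>M\<^esub> y)) h
       = (\<Oplus>y \<in> supp h. g x \<otimes> (h y \<otimes> \<delta> z (x \<otimes>\<^bsub>M\<^esub> y)))"
      unfolding eval_coeffs_def using monoid_algebraD(1)[OF g] monoid_algebraD(1,4)[OF h] by (intro F.finsum_rdistr) auto
    also have "\<dots> = (\<Oplus>y \<in> supp h. if x \<otimes>\<^bsub>M\<^esub> y = z then g x \<otimes> h y else \<zero>)"
      using monoid_algebraD(1)[OF g] monoid_algebraD(1,4)[OF h] by (intro F.finsum_cong') auto
    finally show ?thesis .
  qed
  then show ?thesis unfolding monoid_algebra_simps(2) eval_coeffs_def[of F _ g] by simp
qed

lemma supp_mult:
  assumes g: "g \<in> carrier A" and h: "h \<in> carrier A"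
  shows "supp (g \<otimes>\<^bsub>A\<^esub> h) \<subseteq> (\<lambda>(x, y). x \<otimes>\<^bsub>M\<^esub> y) ` (supp g \<times> supp h)"
proof
  fix z assume z: "z \<in> supp (g \<otimes>\<^bsub>A\<^esub> h)"
  show "z \<in> (\<lambda>(x, y). x \<otimes>\<^bsub>M\<^esub> y) ` (supp g \<times> supp h)"
  proof (rule ccontr)
    assume n: "z \<notin> (\<lambda>(x, y). x \<otimes>\<^bsub>M\<^esub> y) ` (supp g \<times> supp h)"
    have "\<delta> z (x \<otimes>\<^bsub>M\<^esub> y) = \<zero>" if "x \<in> supp g" "y \<in> supp h" for x y
      using n that by auto
    then have "(g \<otimes>\<^bsub>A\<^esub> h) z = \<zero>"
      unfolding mult_eq_ev[OF g h] by (intro ev_eq_zero[OF g] ev_eq_zero[OF h])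
    then show False using z unfolding coeff_support_def by simp
  qed
qed

lemma mult_closed:
  assumes g: "g \<in> carrier A" and h: "h \<in> carrier A"
  shows "g \<otimes>\<^bsub>A\<^esub> h \<in> carrier A"
proof (rule monoid_algebraI)
  show "(g \<otimes>\<^bsub>A\<^esub> h) z \<in> carrier F" for z
    unfolding mult_eq_ev[OF g h] by (intro ev_closed[OF g] ev_closed[OF h]) auto
  show "finite ((\<lambda>(x, y). x \<otimes>\<^bsub>M\<^esub> y) ` (supp g \<times> supp h))" using monoid_algebraD(4)[OF g] monoid_algebraD(4)[OF h] by simp
  show "(\<lambda>(x, y). x \<otimes>\<^bsub>M\<^esub> y) ` (supp g \<times> supp h) \<subseteq> carrier M" using monoid_algebraD(3)[OF g] monoid_algebraD(3)[OF h] by auto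
  show "(g \<otimes>\<^bsub>A\<^esub> h) x = \<zero>" if "x \<notin> (\<lambda>(x, y). x \<otimes>\<^bsub>M\<^esub> y) ` (supp g \<times> supp h)" for x
    by (rule supp_zero) (use that supp_mult[OF g h] in blast)
qed

text \<open>A Fubini formula for the convolution. All ring axioms of the monoid algebra are read off from it,
  because an element is determined by its evaluations at the forms \<open>\<delta> z\<close>.\<close>

theorem ev_mult:
  assumes g: "g \<in> carrier A" and h: "h \<in> carrier A" and \<Phi>: "\<And>x. x \<in> carrier M \<Longrightarrow> \<Phi> x \<in> carrier F"
  shows "ev \<Phi> (g \<otimes>\<^bsub>A\<^esub> h) = ev (\<lambda>x. ev (\<lambda>y. \<Phi> (x \<otimes>\<^bsub>M\<^esub> y)) h) g"
proof -
  define S where "S = (\<lambda>(x, y). x \<otimes>\<^bsub>M\<^esub> y) ` (supp g \<times> supp h)"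
  have S: "finite S" "S \<subseteq> carrier M" "supp (g \<otimes>\<^bsub>A\<^esub> h) \<subseteq> S"
    unfolding S_def using monoid_algebraD(4)[OF g] monoid_algebraD(4)[OF h] monoid_algebraD(3)[OF g] monoid_algebraD(3)[OF h] supp_mult[OF g h] by auto
  have \<Phi>S: "\<Phi> z \<in> carrier F" if "z \<in> S" for z using \<Phi> S(2) that by auto
  have "ev \<Phi> (g \<otimes>\<^bsub>A\<^esub> h) = (\<Oplus>z\<in>S. (g \<otimes>\<^bsub>A\<^esub> h) z \<otimes> \<Phi> z)"
    by (rule ev_superset[OF mult_closed[OF g h] S(1,3) \<Phi>S])
  also have "\<dots> = (\<Oplus>z\<in>S. ev (\<lambda>x. ev (\<lambda>y. \<Phi> z \<otimes> \<delta> z (x \<otimes>\<^bsub>M\<^esub> y)) h) g)"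
  proof (rule F.finsum_cong'[OF refl])
    show "(\<lambda>z. ev (\<lambda>x. ev (\<lambda>y. \<Phi> z \<otimes> \<delta> z (x \<otimes>\<^bsub>M\<^esub> y)) h) g) \<in> S \<rightarrow> carrier F"
      by (intro Pi_I ev_closed[OF g] ev_closed[OF h] F.m_closed \<Phi>S) auto
    fix z assume z: "z \<in> S"
    have "(g \<otimes>\<^bsub>A\<^esub> h) z \<otimes> \<Phi> z = \<Phi> z \<otimes> ev (\<lambda>x. ev (\<lambda>y. \<delta> z (x \<otimes>\<^bsub>M\<^esub> y)) h) g"
      unfolding mult_eq_ev[OF g h]
      by (intro F.m_comm \<Phi>S[OF z] ev_closed[OF g] ev_closed[OF h]) auto
    also have "\<dots> = ev (\<lambda>x. \<Phi> z \<otimes> ev (\<lambda>y. \<delta> z (x \<otimes>\<^bsub>M\<^esub> y)) h) g"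
      by (intro ev_smult_form[OF g, symmetric] \<Phi>S[OF z] ev_closed[OF h]) auto
    also have "\<dots> = ev (\<lambda>x. ev (\<lambda>y. \<Phi> z \<otimes> \<delta> z (x \<otimes>\<^bsub>M\<^esub> y)) h) g"
      by (intro ev_cong[OF g] ev_smult_form[OF h, symmetric] \<Phi>S[OF z] ev_closed[OF h] F.m_closed) auto
    finally show "(g \<otimes>\<^bsub>A\<^esub> h) z \<otimes> \<Phi> z = ev (\<lambda>x. ev (\<lambda>y. \<Phi> z \<otimes> \<delta> z (x \<otimes>\<^bsub>M\<^esub> y)) h) g" .
  qed
  also have "\<dots> = ev (\<lambda>x. \<Oplus>z\<in>S. ev (\<lambda>y. \<Phi> z \<otimes> \<delta> z (x \<otimes>\<^bsub>M\<^esub> y)) h) g"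
    by (intro ev_finsum_form[OF g S(1), symmetric] ev_closed[OF h] F.m_closed \<Phi>S) auto
  also have "\<dots> = ev (\<lambda>x. ev (\<lambda>y. \<Phi> (x \<otimes>\<^bsub>M\<^esub> y)) h) g"
  proof (rule ev_cong[OF g])
    fix x assume x: "x \<in> supp g"
    have xM: "x \<in> carrier M" using monoid_algebraD(3)[OF g x] .
    show "ev (\<lambda>y. \<Phi> (x \<otimes>\<^bsub>M\<^esub> y)) h \<in> carrier F"
      using xM monoid_algebraD(3)[OF h] by (intro ev_closed[OF h] \<Phi>) auto
    have "(\<Oplus>z\<in>S. ev (\<lambda>y. \<Phi> z \<otimes> \<delta> z (x \<otimes>\<^bsub>M\<^esub> y)) h)
        = ev (\<lambda>y. \<Oplus>z\<in>S. \<Phi> z \<otimes> \<delta> z (x \<otimes>\<^bsub>M\<^esub> y)) h"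
      by (intro ev_finsum_form[OF h S(1), symmetric] F.m_closed \<Phi>S) auto
    also have "\<dots> = ev (\<lambda>y. \<Phi> (x \<otimes>\<^bsub>M\<^esub> y)) h"
    proof (rule ev_cong[OF h])
      fix y assume y: "y \<in> supp h"
      have yM: "y \<in> carrier M" using monoid_algebraD(3)[OF h y] .
      have xy: "x \<otimes>\<^bsub>M\<^esub> y \<in> S" unfolding S_def using x y by force
      show "\<Phi> (x \<otimes>\<^bsub>M\<^esub> y) \<in> carrier F" using \<Phi>S[OF xy] .
      have "(\<Oplus>z\<in>S. \<Phi> z \<otimes> \<delta> z (x \<otimes>\<^bsub>M\<^esub> y)) = (\<Oplus>z\<in>S. if x \<otimes>\<^bsub>M\<^esub> y = z then \<Phi> z else \<zero>)"
        using \<Phi>S by (intro F.finsum_cong') auto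
      also have "\<dots> = \<Phi> (x \<otimes>\<^bsub>M\<^esub> y)"
        using \<Phi>S by (intro F.finsum_singleton[OF xy S(1)]) auto
      finally show "(\<Oplus>z\<in>S. \<Phi> z \<otimes> \<delta> z (x \<otimes>\<^bsub>M\<^esub> y)) = \<Phi> (x \<otimes>\<^bsub>M\<^esub> y)" .
    qed
    finally show "(\<Oplus>z\<in>S. ev (\<lambda>y. \<Phi> z \<otimes> \<delta> z (x \<otimes>\<^bsub>M\<^esub> y)) h) = ev (\<lambda>y. \<Phi> (x \<otimes>\<^bsub>M\<^esub> y)) h" .
  qed
  finally show ?thesis .
qed

lemma monomial_closed: "c \<in> carrier F \<Longrightarrow> x \<in> carrier M \<Longrightarrow> monomial F c x \<in> carrier A"
  by (rule monoid_algebraI[of _ "{x}"]) (auto simp: monomial_def)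

lemma ev_monomial:
  assumes "c \<in> carrier F" "x \<in> carrier M" "\<Phi> x \<in> carrier F"
  shows "ev \<Phi> (monomial F c x) = c \<otimes> \<Phi> x"
proof -
  have "ev \<Phi> (monomial F c x) = (\<Oplus>y\<in>{x}. monomial F c x y \<otimes> \<Phi> y)"
    using assms by (intro ev_superset[OF monomial_closed]) (auto simp: monomial_def coeff_support_def)
  also have "\<dots> = c \<otimes> \<Phi> x" using assms by (simp add: monomial_def)
  finally show ?thesis .
qed

lemma delta_closed: "\<delta> z x \<in> carrier F"
  by simp

lemma A_ext:
  assumes "g \<in> carrier A" "h \<in> carrier A" "\<And>z. ev (\<delta> z) g = ev (\<delta> z) h"
  shows "g = h"
  using assms ev_delta by (intro ext) metis

lemma A_mult_assoc:
  assumes g: "g \<in> carrier A" and h: "h \<in> carrier A" and k: "k \<in> carrier A"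
  shows "(g \<otimes>\<^bsub>A\<^esub> h) \<otimes>\<^bsub>A\<^esub> k = g \<otimes>\<^bsub>A\<^esub> (h \<otimes>\<^bsub>A\<^esub> k)"
proof (rule A_ext)
  note gh = mult_closed[OF g h] and hk = mult_closed[OF h k]
  show "(g \<otimes>\<^bsub>A\<^esub> h) \<otimes>\<^bsub>A\<^esub> k \<in> carrier A" "g \<otimes>\<^bsub>A\<^esub> (h \<otimes>\<^bsub>A\<^esub> k) \<in> carrier A"
    using mult_closed[OF gh k] mult_closed[OF g hk] .
  fix z
  have e: "ev (\<lambda>v. \<delta> z (w \<otimes>\<^bsub>M\<^esub> v)) k \<in> carrier F" for w by (rule ev_closed[OF k delta_closed])
  have "ev (\<delta> z) ((g \<otimes>\<^bsub>A\<^esub> h) \<otimes>\<^bsub>A\<^esub> k) = ev (\<lambda>w. ev (\<lambda>v. \<delta> z (w \<otimes>\<^bsub>M\<^esub> v)) k) (g \<otimes>\<^bsub>A\<^esub> h)"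
    by (rule ev_mult[OF gh k delta_closed])
  also have "\<dots> = ev (\<lambda>x. ev (\<lambda>y. ev (\<lambda>v. \<delta> z ((x \<otimes>\<^bsub>M\<^esub> y) \<otimes>\<^bsub>M\<^esub> v)) k) h) g"
    by (rule ev_mult[OF g h e])
  also have "\<dots> = ev (\<lambda>x. ev (\<lambda>y. ev (\<lambda>v. \<delta> z (x \<otimes>\<^bsub>M\<^esub> (y \<otimes>\<^bsub>M\<^esub> v))) k) h) g"
  proof (intro ev_cong[OF g] ev_cong[OF h] ev_cong[OF k] ev_closed[OF h] ev_closed[OF k] delta_closed)
    fix x y v assume "x \<in> supp g" "y \<in> supp h" "v \<in> supp k"
    then have "(x \<otimes>\<^bsub>M\<^esub> y) \<otimes>\<^bsub>M\<^esub> v = x \<otimes>\<^bsub>M\<^esub> (y \<otimes>\<^bsub>M\<^esub> v)"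
      using monoid_algebraD(3)[OF g] monoid_algebraD(3)[OF h] monoid_algebraD(3)[OF k] by (intro M.m_assoc)
    then show "\<delta> z ((x \<otimes>\<^bsub>M\<^esub> y) \<otimes>\<^bsub>M\<^esub> v) = \<delta> z (x \<otimes>\<^bsub>M\<^esub> (y \<otimes>\<^bsub>M\<^esub> v))" by simp
  qed
  also have "\<dots> = ev (\<lambda>x. ev (\<lambda>w. \<delta> z (x \<otimes>\<^bsub>M\<^esub> w)) (h \<otimes>\<^bsub>A\<^esub> k)) g"
  proof (intro ev_cong[OF g] ev_closed[OF hk] delta_closed)
    fix x
    show "ev (\<lambda>y. ev (\<lambda>v. \<delta> z (x \<otimes>\<^bsub>M\<^esub> (y \<otimes>\<^bsub>M\<^esub> v))) k) h = ev (\<lambda>w. \<delta> z (x \<otimes>\<^bsub>M\<^esub> w)) (h \<otimes>\<^bsub>A\<^esub> k)"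
      by (rule ev_mult[OF h k, symmetric]) (rule delta_closed)
  qed
  also have "\<dots> = ev (\<delta> z) (g \<otimes>\<^bsub>A\<^esub> (h \<otimes>\<^bsub>A\<^esub> k))"
    by (rule ev_mult[OF g hk delta_closed, symmetric])
  finally show "ev (\<delta> z) ((g \<otimes>\<^bsub>A\<^esub> h) \<otimes>\<^bsub>A\<^esub> k) = ev (\<delta> z) (g \<otimes>\<^bsub>A\<^esub> (h \<otimes>\<^bsub>A\<^esub> k))" .
qed

lemma A_mult_comm:
  assumes g: "g \<in> carrier A" and h: "h \<in> carrier A"
  shows "g \<otimes>\<^bsub>A\<^esub> h = h \<otimes>\<^bsub>A\<^esub> g"
proof (rule A_ext[OF mult_closed[OF g h] mult_closed[OF h g]])
  fix z
  have "ev (\<delta> z) (g \<otimes>\<^bsub>A\<^esub> h) = ev (\<lambda>x. ev (\<lambda>y. \<delta> z (x \<otimes>\<^bsub>M\<^esub> y)) h) g" by (rule ev_mult[OF g h delta_closed])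
  also have "\<dots> = ev (\<lambda>y. ev (\<lambda>x. \<delta> z (x \<otimes>\<^bsub>M\<^esub> y)) g) h" by (rule ev_swap[OF g h delta_closed])
  also have "\<dots> = ev (\<lambda>y. ev (\<lambda>x. \<delta> z (y \<otimes>\<^bsub>M\<^esub> x)) g) h"
  proof (intro ev_cong[OF g] ev_cong[OF h] ev_closed[OF g] delta_closed)
    fix x y assume "x \<in> supp g" "y \<in> supp h"
    then have "x \<otimes>\<^bsub>M\<^esub> y = y \<otimes>\<^bsub>M\<^esub> x" using monoid_algebraD(3)[OF g] monoid_algebraD(3)[OF h] by (intro M.m_comm)
    then show "\<delta> z (x \<otimes>\<^bsub>M\<^esub> y) = \<delta> z (y \<otimes>\<^bsub>M\<^esub> x)" by simp
  qed
  also have "\<dots> = ev (\<delta> z) (h \<otimes>\<^bsub>A\<^esub> g)" by (rule ev_mult[OF h g delta_closed, symmetric])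
  finally show "ev (\<delta> z) (g \<otimes>\<^bsub>A\<^esub> h) = ev (\<delta> z) (h \<otimes>\<^bsub>A\<^esub> g)" .
qed

lemma A_one: "\<one>\<^bsub>A\<^esub> \<in> carrier A"
  unfolding monoid_algebra_simps(3) by (rule monomial_closed) auto

lemma A_l_one:
  assumes g: "g \<in> carrier A"
  shows "\<one>\<^bsub>A\<^esub> \<otimes>\<^bsub>A\<^esub> g = g"
proof (rule A_ext[OF mult_closed[OF A_one g] g])
  fix z
  have "ev (\<delta> z) (\<one>\<^bsub>A\<^esub> \<otimes>\<^bsub>A\<^esub> g) = ev (\<lambda>x. ev (\<lambda>y. \<delta> z (x \<otimes>\<^bsub>M\<^esub> y)) g) \<one>\<^bsub>A\<^esub>"
    by (rule ev_mult[OF A_one g delta_closed])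
  also have "\<dots> = \<one> \<otimes> ev (\<lambda>y. \<delta> z (\<one>\<^bsub>M\<^esub> \<otimes>\<^bsub>M\<^esub> y)) g"
    unfolding monoid_algebra_simps(3) by (intro ev_monomial ev_closed[OF g] delta_closed) auto
  also have "\<dots> = ev (\<lambda>y. \<delta> z (\<one>\<^bsub>M\<^esub> \<otimes>\<^bsub>M\<^esub> y)) g"
    by (intro F.l_one ev_closed[OF g] delta_closed)
  also have "\<dots> = ev (\<delta> z) g"
    using monoid_algebraD(3)[OF g] by (intro ev_cong[OF g] delta_closed) simp
  finally show "ev (\<delta> z) (\<one>\<^bsub>A\<^esub> \<otimes>\<^bsub>A\<^esub> g) = ev (\<delta> z) g" .
qed

lemma A_l_distr:
  assumes g: "g \<in> carrier A" and h: "h \<in> carrier A" and k: "k \<in> carrier A"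
  shows "(g \<oplus>\<^bsub>A\<^esub> h) \<otimes>\<^bsub>A\<^esub> k = g \<otimes>\<^bsub>A\<^esub> k \<oplus>\<^bsub>A\<^esub> h \<otimes>\<^bsub>A\<^esub> k"
proof (rule A_ext)
  have gh: "g \<oplus>\<^bsub>A\<^esub> h \<in> carrier A" by (rule ev_add(1)[OF g h F.zero_closed])
  note gk = mult_closed[OF g k] and hk = mult_closed[OF h k]
  show "(g \<oplus>\<^bsub>A\<^esub> h) \<otimes>\<^bsub>A\<^esub> k \<in> carrier A" by (rule mult_closed[OF gh k])
  show "g \<otimes>\<^bsub>A\<^esub> k \<oplus>\<^bsub>A\<^esub> h \<otimes>\<^bsub>A\<^esub> k \<in> carrier A" by (rule ev_add(1)[OF gk hk F.zero_closed])
  fix z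
  have e: "ev (\<lambda>y. \<delta> z (x \<otimes>\<^bsub>M\<^esub> y)) k \<in> carrier F" for x by (rule ev_closed[OF k delta_closed])
  show "ev (\<delta> z) ((g \<oplus>\<^bsub>A\<^esub> h) \<otimes>\<^bsub>A\<^esub> k) = ev (\<delta> z) (g \<otimes>\<^bsub>A\<^esub> k \<oplus>\<^bsub>A\<^esub> h \<otimes>\<^bsub>A\<^esub> k)"
    unfolding ev_mult[OF gh k delta_closed] ev_add(2)[OF gk hk delta_closed] ev_mult[OF g k delta_closed] ev_mult[OF h k delta_closed]
    by (rule ev_add(2)[OF g h e])
qed

theorem A_cring: "cring A"
proof (rule cringI)
  have neg: "\<exists>h\<in>carrier A. h \<oplus>\<^bsub>A\<^esub> g = \<zero>\<^bsub>A\<^esub>" if g: "g \<in> carrier A" for g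
  proof (rule bexI[of _ "\<lambda>x. \<ominus> g x"])
    show "(\<lambda>x. \<ominus> g x) \<in> carrier A"
      by (rule monoid_algebraI[of _ "supp g"]) (use monoid_algebraD[OF g] supp_zero in auto)
    show "(\<lambda>x. \<ominus> g x) \<oplus>\<^bsub>A\<^esub> g = \<zero>\<^bsub>A\<^esub>"
      unfolding monoid_algebra_simps(4,5) using monoid_algebraD(1)[OF g] by (simp add: F.l_neg)
  qed
  show "abelian_group A"
  proof (rule abelian_groupI)
    show "g \<oplus>\<^bsub>A\<^esub> h \<in> carrier A" if "g \<in> carrier A" "h \<in> carrier A" for g h
      by (rule ev_add(1)[OF that F.zero_closed])
    show "\<zero>\<^bsub>A\<^esub> \<in> carrier A" unfolding monoid_algebra_simps(4) by (rule monoid_algebraI[of _ "{}"]) auto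
  qed (use neg monoid_algebraD(1) in \<open>auto simp: monoid_algebra_simps(4,5) F.a_ac\<close>)
  show "comm_monoid A"
    by (rule comm_monoidI) (fact mult_closed A_one A_mult_assoc A_l_one A_mult_comm)+
qed (rule A_l_distr)

end

section \<open>Multilinear forms and the tensor relations\<close>

lemma product_comm_monoid:
  assumes "\<And>i. i \<in> I \<Longrightarrow> comm_monoid (R i)"
  shows "comm_monoid (product_group I R)"
proof (rule comm_monoidI)
  note cm = assms[THEN comm_monoid.axioms(1)]
  show "x \<otimes>\<^bsub>product_group I R\<^esub> y \<in> carrier (product_group I R)"
    if "x \<in> carrier (product_group I R)" "y \<in> carrier (product_group I R)" for x y
    using that cm by (auto simp: PiE_iff intro!: monoid.m_closed)
  show "\<one>\<^bsub>product_group I R\<^esub> \<in> carrier (product_group I R)"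
    using cm by (auto intro!: monoid.one_closed)
  show "x \<otimes>\<^bsub>product_group I R\<^esub> y \<otimes>\<^bsub>product_group I R\<^esub> z = x \<otimes>\<^bsub>product_group I R\<^esub> (y \<otimes>\<^bsub>product_group I R\<^esub> z)"
    if "x \<in> carrier (product_group I R)" "y \<in> carrier (product_group I R)" "z \<in> carrier (product_group I R)" for x y z
    using that cm by (auto simp: PiE_iff monoid.m_assoc intro!: restrict_ext)
  show "\<one>\<^bsub>product_group I R\<^esub> \<otimes>\<^bsub>product_group I R\<^esub> x = x" if "x \<in> carrier (product_group I R)" for x
    using that cm by (auto simp: PiE_iff extensional_def fun_eq_iff monoid.l_one)
  show "x \<otimes>\<^bsub>product_group I R\<^esub> y = y \<otimes>\<^bsub>product_group I R\<^esub> x"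
    if "x \<in> carrier (product_group I R)" "y \<in> carrier (product_group I R)" for x y
    using that assms by (auto simp: PiE_iff comm_monoid.m_comm intro!: restrict_ext)
qed

locale tensor_family =
  fixes F (structure) and I :: "'i set" and R :: "'i \<Rightarrow> ('f, 'a, 'm) module_scheme"
  assumes field: "field F" and finite_I: "finite I" and alg: "\<And>i. i \<in> I \<Longrightarrow> algebra F (R i)"
begin

sublocale F: field F by (rule field)

abbreviation "P \<equiv> product_group I R"
abbreviation "tup \<equiv> (\<Pi>\<^sub>E j\<in>I. carrier (R j))"

lemma R_cring: "i \<in> I \<Longrightarrow> cring (R i)"
  using alg by (simp add: algebra_def)

lemma R_vs: "i \<in> I \<Longrightarrow> vec_space F (R i)"
  using alg field by (simp add: algebra_def vec_space_def)

lemma R_monoid: "i \<in> I \<Longrightarrow> comm_monoid (R i)"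
  using R_cring by (simp add: cring_def)

sublocale MA: monoid_alg F P
  by (rule monoid_alg.intro[OF F.cring_axioms product_comm_monoid[OF R_monoid]])

definition linear_at where
  "linear_at i \<Phi> \<longleftrightarrow> (\<forall>x\<in>tup. \<forall>a\<in>carrier (R i). \<forall>b\<in>carrier (R i). \<forall>c\<in>carrier F.
      \<Phi> (x(i := a \<oplus>\<^bsub>R i\<^esub> b)) = \<Phi> (x(i := a)) \<oplus> \<Phi> (x(i := b))
    \<and> \<Phi> (x(i := c \<odot>\<^bsub>R i\<^esub> a)) = c \<otimes> \<Phi> (x(i := a)))"

definition multilinear where
  "multilinear \<Phi> \<longleftrightarrow> \<Phi> \<in> tup \<rightarrow> carrier F \<and> (\<forall>i\<in>I. linear_at i \<Phi>)"

lemma tup_upd: "x \<in> tup \<Longrightarrow> i \<in> I \<Longrightarrow> a \<in> carrier (R i) \<Longrightarrow> x(i := a) \<in> tup"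
  by (auto simp: PiE_iff extensional_def)

lemma tupD: "x \<in> tup \<Longrightarrow> i \<in> I \<Longrightarrow> x i \<in> carrier (R i)"
  by (auto simp: PiE_iff)

lemma tup_ext: "x \<in> tup \<Longrightarrow> y \<in> tup \<Longrightarrow> (\<And>i. i \<in> I \<Longrightarrow> x i = y i) \<Longrightarrow> x = y"
  by (rule PiE_ext)

lemma linear_atD:
  assumes "linear_at i \<Phi>" "x \<in> tup" "a \<in> carrier (R i)"
  shows "b \<in> carrier (R i) \<Longrightarrow> \<Phi> (x(i := a \<oplus>\<^bsub>R i\<^esub> b)) = \<Phi> (x(i := a)) \<oplus> \<Phi> (x(i := b))"
    "c \<in> carrier F \<Longrightarrow> \<Phi> (x(i := c \<odot>\<^bsub>R i\<^esub> a)) = c \<otimes> \<Phi> (x(i := a))"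
proof -
  show "b \<in> carrier (R i) \<Longrightarrow> \<Phi> (x(i := a \<oplus>\<^bsub>R i\<^esub> b)) = \<Phi> (x(i := a)) \<oplus> \<Phi> (x(i := b))"
    using assms F.zero_closed unfolding linear_at_def by blast
  show "c \<in> carrier F \<Longrightarrow> \<Phi> (x(i := c \<odot>\<^bsub>R i\<^esub> a)) = c \<otimes> \<Phi> (x(i := a))"
    using assms unfolding linear_at_def by blast
qed

lemma multilinearD:
  assumes "multilinear \<Phi>"
  shows "x \<in> tup \<Longrightarrow> \<Phi> x \<in> carrier F" "i \<in> I \<Longrightarrow> linear_at i \<Phi>"
  using assms unfolding multilinear_def by blast+

lemma multilinear_translate:
  assumes \<Phi>: "multilinear \<Phi>" and y: "y \<in> tup"
  shows "multilinear (\<lambda>x. \<Phi> (y \<otimes>\<^bsub>P\<^esub> x))"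
proof -
  have yx: "y \<otimes>\<^bsub>P\<^esub> x \<in> tup" if "x \<in> tup" for x
    using MA.M.m_closed[of y x] y that by simp
  have upd: "y \<otimes>\<^bsub>P\<^esub> (x(i := a)) = (y \<otimes>\<^bsub>P\<^esub> x)(i := y i \<otimes>\<^bsub>R i\<^esub> a)" if "i \<in> I" for x i a
    using that by (auto simp: fun_eq_iff)
  show ?thesis
    unfolding multilinear_def linear_at_def
  proof (intro conjI ballI)
    show "(\<lambda>x. \<Phi> (y \<otimes>\<^bsub>P\<^esub> x)) \<in> tup \<rightarrow> carrier F" using multilinearD(1)[OF \<Phi>] yx by blast
  next
    fix i x a b c assume i: "i \<in> I" and x: "x \<in> tup" and a: "a \<in> carrier (R i)" and b: "b \<in> carrier (R i)"
      and c: "c \<in> carrier F"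
    interpret Ri: algebra F "R i" by (rule alg[OF i])
    have yi: "y i \<in> carrier (R i)" by (rule tupD[OF y i])
    have ya: "y i \<otimes>\<^bsub>R i\<^esub> a \<in> carrier (R i)" "y i \<otimes>\<^bsub>R i\<^esub> b \<in> carrier (R i)" using yi a b by simp_all
    note l = linear_atD[OF multilinearD(2)[OF \<Phi> i] yx[OF x]]
    show "\<Phi> (y \<otimes>\<^bsub>P\<^esub> (x(i := a \<oplus>\<^bsub>R i\<^esub> b))) = \<Phi> (y \<otimes>\<^bsub>P\<^esub> (x(i := a))) \<oplus> \<Phi> (y \<otimes>\<^bsub>P\<^esub> (x(i := b)))"
      unfolding upd[OF i] using l(1)[OF ya] yi a b by (simp add: Ri.r_distr del: mult_product_group)
    have "y i \<otimes>\<^bsub>R i\<^esub> (c \<odot>\<^bsub>R i\<^esub> a) = c \<odot>\<^bsub>R i\<^esub> (y i \<otimes>\<^bsub>R i\<^esub> a)"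
      using yi a c Ri.smult_assoc2[of c a "y i"] Ri.m_comm by (metis Ri.smult_closed)
    then show "\<Phi> (y \<otimes>\<^bsub>P\<^esub> (x(i := c \<odot>\<^bsub>R i\<^esub> a))) = c \<otimes> \<Phi> (y \<otimes>\<^bsub>P\<^esub> (x(i := a)))"
      unfolding upd[OF i] using l(2)[OF ya(1) c] by (simp del: mult_product_group)
  qed
qed

abbreviation "J \<equiv> tensor_ideal F I R"

lemma ev_minus:
  assumes g: "g \<in> carrier MA.A" and h: "h \<in> carrier MA.A" and \<Phi>: "\<And>x. x \<in> tup \<Longrightarrow> \<Phi> x \<in> carrier F"
  shows "MA.ev \<Phi> (g \<ominus>\<^bsub>MA.A\<^esub> h) = MA.ev \<Phi> g \<ominus> MA.ev \<Phi> h"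
proof -
  interpret A: cring MA.A by (rule MA.A_cring)
  have \<Phi>': "\<And>x. x \<in> carrier P \<Longrightarrow> \<Phi> x \<in> carrier F" using \<Phi> by simp
  have c: "MA.ev \<Phi> k \<in> carrier F" if "k \<in> carrier MA.A" for k
    using MA.ev_closed[OF that] MA.monoid_algebraD(3)[OF that] \<Phi>' by blast
  have "MA.ev \<Phi> ((g \<ominus>\<^bsub>MA.A\<^esub> h) \<oplus>\<^bsub>MA.A\<^esub> h) = MA.ev \<Phi> (g \<ominus>\<^bsub>MA.A\<^esub> h) \<oplus> MA.ev \<Phi> h"
    by (rule MA.ev_add(2)[OF A.minus_closed[OF g h] h \<Phi>'])
  moreover have "(g \<ominus>\<^bsub>MA.A\<^esub> h) \<oplus>\<^bsub>MA.A\<^esub> h = g"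
    using g h by (simp add: a_minus_def A.a_assoc A.l_neg)
  ultimately have e: "MA.ev \<Phi> g = MA.ev \<Phi> (g \<ominus>\<^bsub>MA.A\<^esub> h) \<oplus> MA.ev \<Phi> h" by simp
  show ?thesis
    unfolding e using c[OF A.minus_closed[OF g h]] c[OF h] by (simp add: a_minus_def F.a_assoc F.r_neg)
qed

lemma tensor_relations_carrier: "tensor_relations F I R \<subseteq> carrier MA.A"
proof
  interpret A: cring MA.A by (rule MA.A_cring)
  fix r assume "r \<in> tensor_relations F I R"
  then show "r \<in> carrier MA.A"
    unfolding tensor_relations_def
  proof (elim UnE CollectE exE conjE)
    fix x i a b assume *: "r = monomial F \<one> (x(i := a \<oplus>\<^bsub>R i\<^esub> b)) \<ominus>\<^bsub>MA.A\<^esub>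
       (monomial F \<one> (x(i := a)) \<oplus>\<^bsub>MA.A\<^esub> monomial F \<one> (x(i := b)))"
      "x \<in> tup" "i \<in> I" "a \<in> carrier (R i)" "b \<in> carrier (R i)"
    interpret Ri: algebra F "R i" by (rule alg[OF *(3)])
    show ?thesis unfolding *(1)
      by (intro A.minus_closed A.a_closed MA.monomial_closed) (use * tup_upd in auto)
  next
    fix x i c a assume *: "r = monomial F \<one> (x(i := c \<odot>\<^bsub>R i\<^esub> a)) \<ominus>\<^bsub>MA.A\<^esub> monomial F c (x(i := a))"
      "x \<in> tup" "i \<in> I" "c \<in> carrier F" "a \<in> carrier (R i)"
    interpret Ri: algebra F "R i" by (rule alg[OF *(3)])
    show ?thesis unfolding *(1)
      by (intro A.minus_closed A.a_closed MA.monomial_closed) (use * tup_upd in auto)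
  qed
qed

lemma J_ideal: "ideal J MA.A"
proof -
  interpret A: cring MA.A by (rule MA.A_cring)
  show ?thesis unfolding tensor_ideal_def by (rule A.genideal_ideal[OF tensor_relations_carrier])
qed

text \<open>The elements killed by all multilinear forms make up an ideal, because translating a multilinear
  form by a tuple gives a multilinear form again. This ideal contains the relations.\<close>

theorem ev_tensor_ideal:
  assumes \<Phi>: "multilinear \<Phi>" and g: "g \<in> J"
  shows "MA.ev \<Phi> g = \<zero>"
proof -
  interpret A: cring MA.A by (rule MA.A_cring)
  define K where "K = {g \<in> carrier MA.A. \<forall>\<Phi>. multilinear \<Phi> \<longrightarrow> MA.ev \<Phi> g = \<zero>}"
  have KD: "g \<in> carrier MA.A" "multilinear \<Phi> \<Longrightarrow> MA.ev \<Phi> g = \<zero>" if "g \<in> K" for g \<Phi>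
    using that unfolding K_def by auto
  have ml: "x \<in> carrier P \<Longrightarrow> \<Phi> x \<in> carrier F" if "multilinear \<Phi>" for x \<Phi>
    using multilinearD(1)[OF that] by simp
  have mult: "h \<otimes>\<^bsub>MA.A\<^esub> g \<in> K" if g: "g \<in> K" and h: "h \<in> carrier MA.A" for g h
  proof -
    have "MA.ev \<Phi> (h \<otimes>\<^bsub>MA.A\<^esub> g) = \<zero>" if "multilinear \<Phi>" for \<Phi>
    proof -
      have "MA.ev \<Phi> (h \<otimes>\<^bsub>MA.A\<^esub> g) = MA.ev (\<lambda>x. MA.ev (\<lambda>y. \<Phi> (x \<otimes>\<^bsub>P\<^esub> y)) g) h"
        by (rule MA.ev_mult[OF h KD(1)[OF g] ml[OF that]])
      also have "\<dots> = \<zero>"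
      proof (rule MA.ev_eq_zero[OF h])
        fix x assume "x \<in> MA.supp h"
        then have "x \<in> tup" using MA.monoid_algebraD(3)[OF h] by simp
        then show "MA.ev (\<lambda>y. \<Phi> (x \<otimes>\<^bsub>P\<^esub> y)) g = \<zero>"
          using KD(2)[OF g multilinear_translate[OF that]] by blast
      qed
      finally show ?thesis .
    qed
    then show ?thesis unfolding K_def using h KD(1)[OF g] by simp
  qed
  have minus: "g \<ominus>\<^bsub>MA.A\<^esub> h \<in> K" if "g \<in> K" "h \<in> K" for g h
    unfolding K_def using ev_minus[OF KD(1)[OF that(1)] KD(1)[OF that(2)]] KD[OF that(1)] KD[OF that(2)]
      multilinearD(1) by simp
  have zero: "\<zero>\<^bsub>MA.A\<^esub> \<in> K"
  proof -
    have "MA.ev \<Phi> \<zero>\<^bsub>MA.A\<^esub> = \<zero>" for \<Phi>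
      by (rule MA.ev_eq_zero[OF A.zero_closed]) (simp add: MA.monoid_algebra_simps(4) coeff_support_def)
    then show ?thesis unfolding K_def using A.zero_closed by blast
  qed
  have "ideal K MA.A"
  proof (rule idealI[OF A.ring_axioms])
    have inv: "\<ominus>\<^bsub>MA.A\<^esub> g \<in> K" if "g \<in> K" for g
      using minus[OF zero that] KD(1)[OF that] by (simp add: a_minus_def)
    have add: "g \<oplus>\<^bsub>MA.A\<^esub> h \<in> K" if "g \<in> K" "h \<in> K" for g h
      using minus[OF that(1) inv[OF that(2)]] KD(1)[OF that(1)] KD(1)[OF that(2)] by (simp add: a_minus_def)
    show "subgroup K (add_monoid MA.A)"
      by (rule A.add.subgroupI) (use zero inv add KD(1) in \<open>auto simp: a_inv_def\<close>)
    show "x \<otimes>\<^bsub>MA.A\<^esub> g \<in> K" "g \<otimes>\<^bsub>MA.A\<^esub> x \<in> K" if "g \<in> K" "x \<in> carrier MA.A" for g x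
      using mult[OF that] A.m_comm[OF that(2) KD(1)[OF that(1)]] by simp_all
  qed
  moreover have "tensor_relations F I R \<subseteq> K"
  proof
    fix r assume r: "r \<in> tensor_relations F I R"
    have "MA.ev \<Phi> r = \<zero>" if \<Phi>: "multilinear \<Phi>" for \<Phi>
    proof -
      note mono = MA.monomial_closed and c = multilinearD(1)[OF \<Phi>]
      show ?thesis using r unfolding tensor_relations_def
      proof (elim UnE CollectE exE conjE)
        fix x i a b assume *: "r = monomial F \<one> (x(i := a \<oplus>\<^bsub>R i\<^esub> b)) \<ominus>\<^bsub>MA.A\<^esub>
           (monomial F \<one> (x(i := a)) \<oplus>\<^bsub>MA.A\<^esub> monomial F \<one> (x(i := b)))"
          "x \<in> tup" "i \<in> I" "a \<in> carrier (R i)" "b \<in> carrier (R i)"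
        interpret Ri: algebra F "R i" by (rule alg[OF *(3)])
        have t: "x(i := a) \<in> carrier P" "x(i := b) \<in> carrier P" "x(i := a \<oplus>\<^bsub>R i\<^esub> b) \<in> carrier P"
          using * tup_upd by auto
        have m: "monomial F \<one> y \<in> carrier MA.A" "MA.ev \<Phi> (monomial F \<one> y) = \<Phi> y"
          if "y \<in> carrier P" for y
          using mono[OF F.one_closed that] MA.ev_monomial[OF F.one_closed that] c that by auto
        have mab: "monomial F \<one> (x(i := a)) \<oplus>\<^bsub>MA.A\<^esub> monomial F \<one> (x(i := b)) \<in> carrier MA.A"
          by (rule MA.ev_add(1)[OF m(1)[OF t(1)] m(1)[OF t(2)] F.zero_closed])
        have e1: "MA.ev \<Phi> r = MA.ev \<Phi> (monomial F \<one> (x(i := a \<oplus>\<^bsub>R i\<^esub> b)))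
            \<ominus> MA.ev \<Phi> (monomial F \<one> (x(i := a)) \<oplus>\<^bsub>MA.A\<^esub> monomial F \<one> (x(i := b)))"
          unfolding *(1) by (rule ev_minus[OF m(1)[OF t(3)] mab c])
        have e2: "MA.ev \<Phi> (monomial F \<one> (x(i := a)) \<oplus>\<^bsub>MA.A\<^esub> monomial F \<one> (x(i := b)))
            = \<Phi> (x(i := a)) \<oplus> \<Phi> (x(i := b))"
          using MA.ev_add(2)[OF m(1)[OF t(1)] m(1)[OF t(2)] ml[OF \<Phi>]] m(2)[OF t(1)] m(2)[OF t(2)] by simp
        have e3: "MA.ev \<Phi> (monomial F \<one> (x(i := a \<oplus>\<^bsub>R i\<^esub> b))) = \<Phi> (x(i := a)) \<oplus> \<Phi> (x(i := b))"
          using linear_atD(1)[OF multilinearD(2)[OF \<Phi> *(3)] *(2,4,5)] m(2)[OF t(3)] by simp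
        have "\<Phi> (x(i := a)) \<oplus> \<Phi> (x(i := b)) \<in> carrier F" using c t by simp
        then show ?thesis unfolding e1 e2 e3 by (simp add: a_minus_def F.r_neg)
      next
        fix x i d a assume *: "r = monomial F \<one> (x(i := d \<odot>\<^bsub>R i\<^esub> a)) \<ominus>\<^bsub>MA.A\<^esub> monomial F d (x(i := a))"
          "x \<in> tup" "i \<in> I" "d \<in> carrier F" "a \<in> carrier (R i)"
        interpret Ri: algebra F "R i" by (rule alg[OF *(3)])
        have t: "x(i := a) \<in> carrier P" "x(i := d \<odot>\<^bsub>R i\<^esub> a) \<in> carrier P"
          using * tup_upd by auto
        have m: "monomial F e y \<in> carrier MA.A" "MA.ev \<Phi> (monomial F e y) = e \<otimes> \<Phi> y"
          if "e \<in> carrier F" "y \<in> carrier P" for e y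
          using mono[OF that] MA.ev_monomial[OF that] c that by auto
        have e1: "MA.ev \<Phi> r = MA.ev \<Phi> (monomial F \<one> (x(i := d \<odot>\<^bsub>R i\<^esub> a)))
            \<ominus> MA.ev \<Phi> (monomial F d (x(i := a)))"
          unfolding *(1) by (rule ev_minus[OF m(1)[OF F.one_closed t(2)] m(1)[OF *(4) t(1)] c])
        have e2: "MA.ev \<Phi> (monomial F \<one> (x(i := d \<odot>\<^bsub>R i\<^esub> a))) = d \<otimes> \<Phi> (x(i := a))"
          using linear_atD(2)[OF multilinearD(2)[OF \<Phi> *(3)] *(2,5,4)] m(2)[OF F.one_closed t(2)] c t *(4) by simp
        have e3: "MA.ev \<Phi> (monomial F d (x(i := a))) = d \<otimes> \<Phi> (x(i := a))"
          by (rule m(2)[OF *(4) t(1)])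
        have "d \<otimes> \<Phi> (x(i := a)) \<in> carrier F" using c t *(4) by simp
        then show ?thesis unfolding e1 e2 e3 by (simp add: a_minus_def F.r_neg)
      qed
    qed
    then show "r \<in> K" unfolding K_def using r tensor_relations_carrier by blast
  qed
  ultimately have "J \<subseteq> K" unfolding tensor_ideal_def by (intro A.genideal_minimal)
  then show ?thesis using g \<Phi> KD(2) by blast
qed

end

section \<open>Product filtrations and products of linear forms\<close>

text \<open>The properties of \<open>V i a = P\<^sub>i\<^sup>(\<^sup>a\<^sup>)\<close> that are used: a decreasing multiplicative filtration by ideals whose
  first term is prime and whose layers are torsion-free modulo this prime.\<close>

locale filtered_tensor = tensor_family F I R
  for F (structure) and I :: "'i set" and R :: "'i \<Rightarrow> ('f, 'a, 'm) module_scheme" +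
  fixes V :: "'i \<Rightarrow> nat \<Rightarrow> 'a set"
  assumes alg_closed: "algebraically_closed F"
    and affine: "i \<in> I \<Longrightarrow> affine_algebra F (R i)"
    and V_ideal: "i \<in> I \<Longrightarrow> ideal (V i a) (R i)"
    and V_zero: "i \<in> I \<Longrightarrow> V i 0 = carrier (R i)"
    and V_dec: "i \<in> I \<Longrightarrow> V i (Suc a) \<subseteq> V i a"
    and V_mult: "i \<in> I \<Longrightarrow> x \<in> V i a \<Longrightarrow> y \<in> V i b \<Longrightarrow> x \<otimes>\<^bsub>R i\<^esub> y \<in> V i (a + b)"
    and V_prime: "i \<in> I \<Longrightarrow> primeideal (V i 1) (R i)"
    and V_torsion_free: "i \<in> I \<Longrightarrow> r \<in> carrier (R i) - V i 1 \<Longrightarrow> v \<in> carrier (R i)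
      \<Longrightarrow> r \<otimes>\<^bsub>R i\<^esub> v \<in> V i a \<Longrightarrow> v \<in> V i a"
begin

lemma V_antimono: "i \<in> I \<Longrightarrow> a \<le> b \<Longrightarrow> V i b \<subseteq> V i a"
  using V_dec by (rule lift_Suc_antimono_le)

lemma V_carrier: "i \<in> I \<Longrightarrow> x \<in> V i a \<Longrightarrow> x \<in> carrier (R i)"
  using idealD(2)[OF V_ideal] .

lemma V_submodule: "i \<in> I \<Longrightarrow> submodule (V i a) F (R i)"
  using algebra.ideal_submodule[OF alg V_ideal] .

lemma V_layer: "i \<in> I \<Longrightarrow> torsion_free_layer (R i) (V i 1) (V i l) (V i (Suc l))"
proof -
  assume i: "i \<in> I"
  show ?thesis
  proof (rule torsion_free_layer.intro[OF R_cring[OF i]], rule torsion_free_layer_axioms.intro)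
    show "p \<otimes>\<^bsub>R i\<^esub> v \<in> V i (Suc l)" if "p \<in> V i 1" "v \<in> V i l" for p v
      using V_mult[OF i that] by simp
    show "v \<in> V i (Suc l)" if "r \<in> carrier (R i) - V i 1" "v \<in> V i l" "r \<otimes>\<^bsub>R i\<^esub> v \<in> V i (Suc l)" for r v
      using V_torsion_free[OF i that(1) V_carrier[OF i that(2)] that(3)] .
  qed (fact V_prime[OF i] V_ideal[OF i] V_dec[OF i])+
qed

definition at_level where "at_level a x \<longleftrightarrow> x \<in> tup \<and> (\<forall>i\<in>I. x i \<in> V i (a i))"

text \<open>The tuples of total level at least \<open>k\<close>. The exponents are existentially quantified because an element of \<open>V i a\<close> also
  lies in all earlier terms.\<close>

definition Tup where "Tup k = {x. \<exists>a. at_level a x \<and> k \<le> (\<Sum>i\<in>I. a i)}"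

definition kills where "kills \<Phi> k \<longleftrightarrow> (\<forall>x\<in>Tup k. \<Phi> x = \<zero>)"

definition prod_form where "prod_form S \<phi> x = finprod F (\<lambda>i. \<phi> i (x i)) S"

text \<open>Linear forms in which \<open>l i\<close> is the last layer that \<open>\<phi> i\<close> can see.\<close>

definition forms_at where
  "forms_at S \<phi> l \<longleftrightarrow> (\<forall>i\<in>S. linear_form F (R i) (\<phi> i) \<and> (\<forall>v\<in>V i (Suc (l i)). \<phi> i v = \<zero>))"

lemma forms_atD:
  assumes "forms_at S \<phi> l" "i \<in> S"
  shows "linear_form F (R i) (\<phi> i)" "v \<in> V i (Suc (l i)) \<Longrightarrow> \<phi> i v = \<zero>"
    "v \<in> carrier (R i) \<Longrightarrow> \<phi> i v \<in> carrier F"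
  using assms linear_formD(1)[of F "R i" "\<phi> i" v] unfolding forms_at_def by auto

lemma Tup_tup: "x \<in> Tup k \<Longrightarrow> x \<in> tup"
  unfolding Tup_def at_level_def by blast

lemma Tup_coord:
  assumes "x \<in> tup" "i \<in> I" "x i \<in> V i k"
  shows "x \<in> Tup k"
proof -
  let ?a = "(\<lambda>_. 0)(i := k)"
  have "at_level ?a x" unfolding at_level_def using assms V_zero tupD by auto
  moreover have "k \<le> (\<Sum>j\<in>I. ?a j)" using assms(2) finite_I by (simp add: sum.remove)
  ultimately show ?thesis unfolding Tup_def mem_Collect_eq by (intro exI[of _ ?a] conjI)
qed

lemma prod_form_closed:
  assumes "\<And>i. i \<in> S \<Longrightarrow> \<phi> i (x i) \<in> carrier F"
  shows "prod_form S \<phi> x \<in> carrier F"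
  unfolding prod_form_def using assms by (intro F.finprod_closed) auto

lemma prod_form_remove:
  assumes "finite S" "i \<in> S" "\<And>j. j \<in> S \<Longrightarrow> \<phi> j (x j) \<in> carrier F"
  shows "prod_form S \<phi> x = \<phi> i (x i) \<otimes> prod_form (S - {i}) \<phi> x"
proof -
  have "prod_form (insert i (S - {i})) \<phi> x = \<phi> i (x i) \<otimes> prod_form (S - {i}) \<phi> x"
    unfolding prod_form_def using assms by (intro F.finprod_insert) auto
  then show ?thesis using assms(2) by (simp add: insert_absorb)
qed

lemma prod_form_eq_zero:
  assumes "finite S" "i \<in> S" "\<And>j. j \<in> S \<Longrightarrow> \<phi> j (x j) \<in> carrier F" "\<phi> i (x i) = \<zero>"
  shows "prod_form S \<phi> x = \<zero>"
  using prod_form_remove[OF assms(1,2), of \<phi> x] assms(4) prod_form_closed[of "S - {i}" \<phi> x] assms(3) by simp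

lemma prod_form_cong:
  assumes "\<And>i. i \<in> S \<Longrightarrow> \<psi> i (y i) \<in> carrier F" "\<And>i. i \<in> S \<Longrightarrow> \<phi> i (x i) = \<psi> i (y i)"
  shows "prod_form S \<phi> x = prod_form S \<psi> y"
  unfolding prod_form_def using assms by (intro F.finprod_cong') auto

lemma exists_exceeding:
  fixes a l :: "'i \<Rightarrow> nat"
  assumes "(\<Sum>i\<in>I. l i) \<le> (\<Sum>i\<in>I. a i)" "i \<in> I" "a i < l i"
  shows "\<exists>j\<in>I - {i}. l j < a j"
proof (rule ccontr)
  assume "\<not> ?thesis"
  then have "\<forall>j\<in>I. a j \<le> l j" using assms(3) by force
  then have "(\<Sum>i\<in>I. a i) < (\<Sum>i\<in>I. l i)"
    using assms finite_I by (intro sum_strict_mono_ex1) auto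
  then show False using assms(1) by simp
qed

lemma prod_form_multilinear:
  assumes "forms_at I \<phi> l"
  shows "multilinear (prod_form I \<phi>)"
  unfolding multilinear_def linear_at_def
proof (intro conjI ballI)
  note fD = forms_atD[OF assms]
  show "prod_form I \<phi> \<in> tup \<rightarrow> carrier F"
    using fD(3) tupD by (intro Pi_I prod_form_closed) blast
  fix i x a b c assume i: "i \<in> I" and x: "x \<in> tup" and a: "a \<in> carrier (R i)" and b: "b \<in> carrier (R i)"
    and c: "c \<in> carrier F"
  interpret Ri: algebra F "R i" by (rule alg[OF i])
  let ?Q = "prod_form (I - {i}) \<phi> x"
  have Q: "?Q \<in> carrier F" using fD(3) tupD[OF x] by (intro prod_form_closed) auto
  have e: "prod_form I \<phi> (x(i := d)) = \<phi> i d \<otimes> ?Q" if "d \<in> carrier (R i)" for d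
  proof -
    have "\<phi> j ((x(i := d)) j) \<in> carrier F" if "j \<in> I" for j
      using fD(3) that tupD[OF tup_upd[OF x i \<open>d \<in> carrier (R i)\<close>]] by blast
    moreover have "prod_form (I - {i}) \<phi> (x(i := d)) = ?Q"
      using fD(3) tupD[OF x] by (intro prod_form_cong) auto
    ultimately show ?thesis using prod_form_remove[OF finite_I i, of \<phi> "x(i := d)"] by simp
  qed
  have \<phi>: "\<phi> i a \<in> carrier F" "\<phi> i b \<in> carrier F" using fD(3) i a b by auto
  note L = linear_formD[OF fD(1)[OF i]]
  show "prod_form I \<phi> (x(i := a \<oplus>\<^bsub>R i\<^esub> b)) = prod_form I \<phi> (x(i := a)) \<oplus> prod_form I \<phi> (x(i := b))"
    using e[OF a] e[OF b] e[OF Ri.a_closed[OF a b]] L(2)[OF a b] \<phi> Q by (simp add: F.l_distr)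
  show "prod_form I \<phi> (x(i := c \<odot>\<^bsub>R i\<^esub> a)) = c \<otimes> prod_form I \<phi> (x(i := a))"
    using e[OF a] e[OF Ri.smult_closed[OF c a]] L(3)[OF c a] \<phi> Q c by (simp add: F.m_assoc)
qed

lemma prod_form_level_zero:
  assumes \<phi>: "forms_at I \<phi> l" and x: "at_level a x" and j: "j \<in> I" "l j < a j"
  shows "prod_form I \<phi> x = \<zero>"
proof (rule prod_form_eq_zero[OF finite_I j(1)])
  show "\<phi> i (x i) \<in> carrier F" if "i \<in> I" for i
    using forms_atD(3)[OF \<phi> that] tupD[of x i] x that unfolding at_level_def by blast
  have "x j \<in> V j (Suc (l j))" using x j V_antimono[of j "Suc (l j)" "a j"] unfolding at_level_def by auto
  then show "\<phi> j (x j) = \<zero>" by (rule forms_atD(2)[OF \<phi> j(1)])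
qed

lemma prod_form_kills:
  assumes \<phi>: "forms_at I \<phi> l" and l: "(\<Sum>i\<in>I. l i) < k"
  shows "kills (prod_form I \<phi>) k"
  unfolding kills_def
proof
  fix x assume "x \<in> Tup k"
  then obtain a where a: "at_level a x" "k \<le> (\<Sum>i\<in>I. a i)" unfolding Tup_def by blast
  have "\<exists>j\<in>I. l j < a j"
  proof (rule ccontr)
    assume "\<not> ?thesis"
    then have "(\<Sum>i\<in>I. a i) \<le> (\<Sum>i\<in>I. l i)" by (intro sum_mono) force
    then show False using a(2) l by simp
  qed
  then show "prod_form I \<phi> x = \<zero>" using prod_form_level_zero[OF \<phi> a(1)] by blast
qed

text \<open>Coordinate \<open>i\<close> of a form is split off: \<open>\<Phi>\<close> is replaced by \<open>x \<mapsto> \<phi> (x i) \<cdot> \<Phi> (x(i := e))\<close>. If all these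
  forms killed \<open>g\<close>, then subtracting \<open>\<phi> (x i) \<cdot> e\<close> from the coordinate \<open>x i\<close> would not change the value of \<open>\<Phi>\<close> on \<open>g\<close>; but
  such subtractions move the finitely many coordinates in question into \<open>V i N\<close>, where \<open>\<Phi>\<close> vanishes.\<close>

lemma split_coordinate:
  assumes g: "g \<in> carrier MA.A" and i: "i \<in> I"
    and \<Phi>c: "\<And>x. x \<in> tup \<Longrightarrow> \<Phi> x \<in> carrier F" and lin: "linear_at i \<Phi>"
    and kill: "\<And>x. x \<in> tup \<Longrightarrow> x i \<in> V i N \<Longrightarrow> \<Phi> x = \<zero>"
    and ne: "MA.ev \<Phi> g \<noteq> \<zero>"
  shows "\<exists>\<phi> e l. linear_form F (R i) \<phi> \<and> (\<forall>v\<in>V i (Suc l). \<phi> v = \<zero>) \<and> e \<in> V i l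
    \<and> MA.ev (\<lambda>x. \<phi> (x i) \<otimes> \<Phi> (x(i := e))) g \<noteq> \<zero>"
proof (rule ccontr)
  assume none: "\<not> ?thesis"
  interpret VS: vec_space F "R i" by (rule R_vs[OF i])
  have st: "x \<in> tup" if "x \<in> MA.supp g" for x using MA.monoid_algebraD(3)[OF g that] by simp
  define A where "A \<pi> \<longleftrightarrow> (\<forall>v\<in>carrier (R i). \<pi> v \<in> carrier (R i))
     \<and> MA.ev (\<lambda>x. \<Phi> (x(i := \<pi> (x i)))) g = MA.ev \<Phi> g" for \<pi>
  have "\<exists>\<pi>. A \<pi> \<and> (\<forall>v\<in>(\<lambda>x. x i) ` MA.supp g. \<pi> v \<in> V i N)"
  proof (rule VS.adapted_projection)
    show "submodule (V i a) F (R i)" for a by (rule V_submodule[OF i])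
    show "V i 0 = carrier (R i)" by (rule V_zero[OF i])
    show "V i (Suc a) \<subseteq> V i a" for a by (rule V_dec[OF i])
    show "finite ((\<lambda>x. x i) ` MA.supp g)" using MA.monoid_algebraD(4)[OF g] by simp
    show "(\<lambda>x. x i) ` MA.supp g \<subseteq> carrier (R i)" using tupD[OF st i] by blast
    show "A (\<lambda>x. x)" unfolding A_def by simp
  next
    fix \<pi> \<phi> e l
    assume \<pi>: "A \<pi>" and \<phi>: "linear_form F (R i) \<phi>" and \<phi>V: "\<And>v. v \<in> V i (Suc l) \<Longrightarrow> \<phi> v = \<zero>"
      and e: "e \<in> V i l"
    have eR: "e \<in> carrier (R i)" by (rule V_carrier[OF i e])
    have z: "MA.ev (\<lambda>x. \<phi> (x i) \<otimes> \<Phi> (x(i := e))) g = \<zero>" using none \<phi> \<phi>V e by blast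
    have \<phi>c: "\<phi> v \<in> carrier F" if "v \<in> carrier (R i)" for v using linear_formD(1)[OF \<phi> that] .
    have \<pi>c: "\<pi> v \<in> carrier (R i)" if "v \<in> carrier (R i)" for v using \<pi> that unfolding A_def by blast
    have eq: "\<Phi> (x(i := \<pi> (x i) \<ominus>\<^bsub>R i\<^esub> \<phi> (x i) \<odot>\<^bsub>R i\<^esub> e))
        = \<Phi> (x(i := \<pi> (x i))) \<oplus> (\<ominus> \<one>) \<otimes> (\<phi> (x i) \<otimes> \<Phi> (x(i := e)))" if x: "x \<in> tup" for x
    proof -
      have xi: "x i \<in> carrier (R i)" by (rule tupD[OF x i])
      have c: "\<phi> (x i) \<in> carrier F" "\<Phi> (x(i := e)) \<in> carrier F"
        using \<phi>c[OF xi] \<Phi>c[OF tup_upd[OF x i eR]] .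
      have "\<pi> (x i) \<ominus>\<^bsub>R i\<^esub> \<phi> (x i) \<odot>\<^bsub>R i\<^esub> e = \<pi> (x i) \<oplus>\<^bsub>R i\<^esub> (\<ominus> \<phi> (x i)) \<odot>\<^bsub>R i\<^esub> e"
        using c(1) eR by (simp add: a_minus_def VS.smult_l_minus)
      then have "\<Phi> (x(i := \<pi> (x i) \<ominus>\<^bsub>R i\<^esub> \<phi> (x i) \<odot>\<^bsub>R i\<^esub> e))
          = \<Phi> (x(i := \<pi> (x i))) \<oplus> (\<ominus> \<phi> (x i)) \<otimes> \<Phi> (x(i := e))"
        using linear_atD(1)[OF lin x \<pi>c[OF xi], of "(\<ominus> \<phi> (x i)) \<odot>\<^bsub>R i\<^esub> e"]
          linear_atD(2)[OF lin x eR, of "\<ominus> \<phi> (x i)"] c(1) eR by simp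
      then show ?thesis using c by (simp add: F.l_minus)
    qed
    have e1: "MA.ev (\<lambda>x. \<Phi> (x(i := \<pi> (x i) \<ominus>\<^bsub>R i\<^esub> \<phi> (x i) \<odot>\<^bsub>R i\<^esub> e))) g
       = MA.ev (\<lambda>x. \<Phi> (x(i := \<pi> (x i))) \<oplus> (\<ominus> \<one>) \<otimes> (\<phi> (x i) \<otimes> \<Phi> (x(i := e)))) g"
      using eq st \<Phi>c tup_upd[OF _ i] \<pi>c \<phi>c tupD[OF _ i] eR
      by (intro MA.ev_cong[OF g]) auto
    have e2: "MA.ev (\<lambda>x. \<Phi> (x(i := \<pi> (x i))) \<oplus> (\<ominus> \<one>) \<otimes> (\<phi> (x i) \<otimes> \<Phi> (x(i := e)))) g
       = MA.ev (\<lambda>x. \<Phi> (x(i := \<pi> (x i)))) g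
        \<oplus> MA.ev (\<lambda>x. (\<ominus> \<one>) \<otimes> (\<phi> (x i) \<otimes> \<Phi> (x(i := e)))) g"
      using st \<Phi>c tup_upd[OF _ i] \<pi>c \<phi>c tupD[OF _ i] eR by (intro MA.ev_add_form[OF g]) auto
    have e3: "MA.ev (\<lambda>x. (\<ominus> \<one>) \<otimes> (\<phi> (x i) \<otimes> \<Phi> (x(i := e)))) g
        = (\<ominus> \<one>) \<otimes> MA.ev (\<lambda>x. \<phi> (x i) \<otimes> \<Phi> (x(i := e))) g"
      using st \<Phi>c tup_upd[OF _ i] \<phi>c tupD[OF _ i] eR by (intro MA.ev_smult_form[OF g]) auto
    have e4: "MA.ev (\<lambda>x. \<Phi> (x(i := \<pi> (x i)))) g = MA.ev \<Phi> g" using \<pi> unfolding A_def by blast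
    have e5: "(\<ominus> \<one>) \<otimes> \<zero> = \<zero>" by simp
    have evc: "MA.ev \<Phi> g \<in> carrier F" using MA.ev_closed[OF g] \<Phi>c st by blast
    have "MA.ev (\<lambda>x. \<Phi> (x(i := \<pi> (x i) \<ominus>\<^bsub>R i\<^esub> \<phi> (x i) \<odot>\<^bsub>R i\<^esub> e))) g = MA.ev \<Phi> g"
      unfolding e1 e2 e3 e4 z e5 by (rule F.r_zero[OF evc])
    moreover have "\<pi> v \<ominus>\<^bsub>R i\<^esub> \<phi> v \<odot>\<^bsub>R i\<^esub> e \<in> carrier (R i)" if "v \<in> carrier (R i)" for v
      using \<pi>c[OF that] \<phi>c[OF that] eR by simp
    ultimately show "A (\<lambda>v. \<pi> v \<ominus>\<^bsub>R i\<^esub> \<phi> v \<odot>\<^bsub>R i\<^esub> e)" unfolding A_def by blast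
  qed
  then obtain \<pi> where \<pi>: "A \<pi>" "\<And>x. x \<in> MA.supp g \<Longrightarrow> \<pi> (x i) \<in> V i N" by blast
  have "MA.ev (\<lambda>x. \<Phi> (x(i := \<pi> (x i)))) g = \<zero>"
  proof (rule MA.ev_eq_zero[OF g])
    fix x assume x: "x \<in> MA.supp g"
    show "\<Phi> (x(i := \<pi> (x i))) = \<zero>"
      by (rule kill[OF tup_upd[OF st[OF x] i V_carrier[OF i \<pi>(2)[OF x]]]]) (simp add: \<pi>(2)[OF x])
  qed
  then show False using \<pi>(1) ne unfolding A_def by simp
qed

text \<open>Splitting off all coordinates turns \<open>\<Phi>\<close> into a product of linear forms times the constant \<open>\<Phi> e\<close>. Since
  \<open>e i \<in> V i (l i)\<close>, and \<open>\<Phi>\<close> kills the tuples of level above \<open>k\<close>, the constant is nonzero only if \<open>\<Sum> l i \<le> k\<close>.\<close>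

theorem detecting_product_form:
  assumes g: "g \<in> carrier MA.A" and \<Phi>: "multilinear \<Phi>" and kill: "kills \<Phi> (Suc k)"
    and ne: "MA.ev \<Phi> g \<noteq> \<zero>"
  shows "\<exists>\<phi> l. forms_at I \<phi> l \<and> (\<Sum>i\<in>I. l i) \<le> k \<and> MA.ev (prod_form I \<phi>) g \<noteq> \<zero>"
proof -
  have st: "x \<in> tup" if "x \<in> MA.supp g" for x using MA.monoid_algebraD(3)[OF g that] by simp
  \<comment> \<open>The form in which the coordinates in \<open>S\<close> have been split off.\<close>
  define \<Phi>S where "\<Phi>S S \<phi> e x = prod_form S \<phi> x \<otimes> \<Phi> (\<lambda>j. if j \<in> S then e j else x j)"
    for S \<phi> and e :: "'i \<Rightarrow> 'a" and x
  have "\<exists>\<phi> e l. forms_at S \<phi> l \<and> (\<forall>i\<in>S. e i \<in> V i (l i)) \<and> MA.ev (\<Phi>S S \<phi> e) g \<noteq> \<zero>"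
    if "S \<subseteq> I" for S
    using finite_subset[OF that finite_I] that
  proof (induct S rule: finite_induct)
    case empty
    have "MA.ev (\<Phi>S {} (\<lambda>_ _. \<zero>) undefined) g = MA.ev \<Phi> g"
      using st multilinearD(1)[OF \<Phi>] by (intro MA.ev_cong[OF g]) (auto simp: \<Phi>S_def prod_form_def)
    then show ?case using ne by (intro exI[of _ "\<lambda>_ _. \<zero>"] exI[of _ undefined] exI[of _ "\<lambda>_. 0"])
        (simp add: forms_at_def)
  next
    case (insert i S)
    then obtain \<phi> e l where IH: "forms_at S \<phi> l" "\<forall>i\<in>S. e i \<in> V i (l i)" "MA.ev (\<Phi>S S \<phi> e) g \<noteq> \<zero>"
      by auto
    have i: "i \<in> I" and SI: "S \<subseteq> I" using insert by auto
    have ov: "(\<lambda>j. if j \<in> S then e j else x j) \<in> tup" if "x \<in> tup" for x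
      using that IH(2) SI V_carrier by (auto simp: PiE_iff extensional_def)
    have pc: "prod_form S \<phi> x \<in> carrier F" if "x \<in> tup" for x
      using forms_atD(3)[OF IH(1)] tupD[OF that] SI by (intro prod_form_closed) blast
    have upd: "(\<lambda>j. if j \<in> S then e j else (x(i := a)) j) = (\<lambda>j. if j \<in> S then e j else x j)(i := a)" for x a
      using insert(2) by auto
    have pupd: "prod_form S \<phi> (x(i := a)) = prod_form S \<phi> x" if "x \<in> tup" for x a
      using insert(2) forms_atD(3)[OF IH(1)] tupD[OF that] SI by (intro prod_form_cong) auto
    have \<Phi>Sc: "\<Phi>S S \<phi> e x \<in> carrier F" if "x \<in> tup" for x
      unfolding \<Phi>S_def using pc[OF that] multilinearD(1)[OF \<Phi> ov[OF that]] by simp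
    have lin: "linear_at i (\<Phi>S S \<phi> e)"
      unfolding linear_at_def
    proof (intro ballI conjI)
      fix x a b c assume x: "x \<in> tup" and a: "a \<in> carrier (R i)" and b: "b \<in> carrier (R i)" and c: "c \<in> carrier F"
      interpret Ri: algebra F "R i" by (rule alg[OF i])
      let ?y = "\<lambda>j. if j \<in> S then e j else x j"
      note l = linear_atD[OF multilinearD(2)[OF \<Phi> i] ov[OF x] a]
      have cc: "\<Phi> (?y(i := a)) \<in> carrier F" "\<Phi> (?y(i := b)) \<in> carrier F" "prod_form S \<phi> x \<in> carrier F"
        using multilinearD(1)[OF \<Phi>] tup_upd[OF ov[OF x] i] a b pc[OF x] by auto
      show "\<Phi>S S \<phi> e (x(i := a \<oplus>\<^bsub>R i\<^esub> b)) = \<Phi>S S \<phi> e (x(i := a)) \<oplus> \<Phi>S S \<phi> e (x(i := b))"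
        unfolding \<Phi>S_def upd pupd[OF x] l(1)[OF b] using cc by (simp add: F.r_distr)
      show "\<Phi>S S \<phi> e (x(i := c \<odot>\<^bsub>R i\<^esub> a)) = c \<otimes> \<Phi>S S \<phi> e (x(i := a))"
        unfolding \<Phi>S_def upd pupd[OF x] l(2)[OF c] using cc c by (simp add: F.m_lcomm)
    qed
    have kS: "\<Phi>S S \<phi> e x = \<zero>" if "x \<in> tup" "x i \<in> V i (Suc k)" for x
    proof -
      have "(\<lambda>j. if j \<in> S then e j else x j) \<in> Tup (Suc k)"
        using that insert(2) by (intro Tup_coord[OF ov[OF that(1)] i]) simp
      then show ?thesis using kill pc[OF that(1)] unfolding \<Phi>S_def kills_def by simp
    qed
    obtain \<phi>i ei li where new: "linear_form F (R i) \<phi>i" "\<forall>v\<in>V i (Suc li). \<phi>i v = \<zero>" "ei \<in> V i li"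
      "MA.ev (\<lambda>x. \<phi>i (x i) \<otimes> \<Phi>S S \<phi> e (x(i := ei))) g \<noteq> \<zero>"
      using split_coordinate[OF g i \<Phi>Sc lin kS IH(3)] by blast
    let ?\<phi> = "\<phi>(i := \<phi>i)" and ?e = "e(i := ei)" and ?l = "l(i := li)"
    have f1: "forms_at (insert i S) ?\<phi> ?l" using IH(1) new insert(2) unfolding forms_at_def by auto
    have f2: "\<forall>j\<in>insert i S. ?e j \<in> V j (?l j)" using IH(2) new(3) by auto
    have f3: "MA.ev (\<Phi>S (insert i S) ?\<phi> ?e) g = MA.ev (\<lambda>x. \<phi>i (x i) \<otimes> \<Phi>S S \<phi> e (x(i := ei))) g"
    proof (rule MA.ev_cong[OF g])
      fix x assume "x \<in> MA.supp g"
      then have x: "x \<in> tup" by (rule st)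
      have eiR: "ei \<in> carrier (R i)" by (rule V_carrier[OF i new(3)])
      have \<phi>ic: "\<phi>i (x i) \<in> carrier F" by (rule linear_formD(1)[OF new(1) tupD[OF x i]])
      have \<Phi>c: "\<Phi>S S \<phi> e (x(i := ei)) \<in> carrier F" by (rule \<Phi>Sc[OF tup_upd[OF x i eiR]])
      show "\<phi>i (x i) \<otimes> \<Phi>S S \<phi> e (x(i := ei)) \<in> carrier F" using \<phi>ic \<Phi>c by simp
      have "prod_form (insert i S) ?\<phi> x = \<phi>i (x i) \<otimes> prod_form S ?\<phi> x"
        unfolding prod_form_def using insert(1,2) forms_atD(3)[OF IH(1)] tupD[OF x] SI \<phi>ic
        by (subst F.finprod_insert) auto
      also have "prod_form S ?\<phi> x = prod_form S \<phi> x"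
        using insert(2) forms_atD(3)[OF IH(1)] tupD[OF x] SI by (intro prod_form_cong) auto
      finally have p: "prod_form (insert i S) ?\<phi> x = \<phi>i (x i) \<otimes> prod_form S \<phi> x" .
      have o: "(\<lambda>j. if j \<in> insert i S then ?e j else x j) = (\<lambda>j. if j \<in> S then e j else x j)(i := ei)"
        using insert(2) by auto
      have "\<Phi> ((\<lambda>j. if j \<in> S then e j else x j)(i := ei)) \<in> carrier F"
        by (rule multilinearD(1)[OF \<Phi> tup_upd[OF ov[OF x] i eiR]])
      then show "\<Phi>S (insert i S) ?\<phi> ?e x = \<phi>i (x i) \<otimes> \<Phi>S S \<phi> e (x(i := ei))"
        unfolding \<Phi>S_def p o upd pupd[OF x] using \<phi>ic pc[OF x] by (simp add: F.m_assoc)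
    qed
    have f4: "MA.ev (\<Phi>S (insert i S) ?\<phi> ?e) g \<noteq> \<zero>" unfolding f3 by (rule new(4))
    show ?case by (intro exI[of _ ?\<phi>] exI[of _ ?e] exI[of _ ?l] conjI f1 f2 f4)
  qed
  then obtain \<phi> e l where *: "forms_at I \<phi> l" "\<forall>i\<in>I. e i \<in> V i (l i)" "MA.ev (\<Phi>S I \<phi> e) g \<noteq> \<zero>"
    by blast
  let ?e = "restrict e I"
  have et: "?e \<in> tup" using *(2) V_carrier by auto
  have ec: "\<Phi> ?e \<in> carrier F" by (rule multilinearD(1)[OF \<Phi> et])
  have pc: "prod_form I \<phi> x \<in> carrier F" if "x \<in> tup" for x
    using multilinearD(1)[OF prod_form_multilinear[OF *(1)] that] .
  have "MA.ev (\<Phi>S I \<phi> e) g = MA.ev (\<lambda>x. \<Phi> ?e \<otimes> prod_form I \<phi> x) g"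
  proof (rule MA.ev_cong[OF g])
    fix x assume "x \<in> MA.supp g"
    then have x: "x \<in> tup" by (rule st)
    show "\<Phi> ?e \<otimes> prod_form I \<phi> x \<in> carrier F" using ec pc[OF x] by simp
    have "(\<lambda>j. if j \<in> I then e j else x j) = ?e"
      using x by (auto simp: fun_eq_iff PiE_iff extensional_def)
    then show "\<Phi>S I \<phi> e x = \<Phi> ?e \<otimes> prod_form I \<phi> x"
      unfolding \<Phi>S_def using ec pc[OF x] by (simp add: F.m_comm)
  qed
  also have "\<dots> = \<Phi> ?e \<otimes> MA.ev (prod_form I \<phi>) g"
    using pc st ec by (intro MA.ev_smult_form[OF g]) auto
  finally have pe: "\<Phi> ?e \<otimes> MA.ev (prod_form I \<phi>) g \<noteq> \<zero>" using *(3) by simp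
  have evc: "MA.ev (prod_form I \<phi>) g \<in> carrier F" using pc st by (intro MA.ev_closed[OF g]) auto
  have ne2: "\<Phi> ?e \<noteq> \<zero>" "MA.ev (prod_form I \<phi>) g \<noteq> \<zero>" using pe ec evc by auto
  have "at_level l ?e" unfolding at_level_def using et *(2) by simp
  then have "?e \<in> Tup (Suc k)" if "Suc k \<le> (\<Sum>i\<in>I. l i)" unfolding Tup_def using that by blast
  then have "(\<Sum>i\<in>I. l i) \<le> k"
    using kill ne2(1) unfolding kills_def by (meson not_less_eq_eq)
  then show ?thesis using * ne2(2) by blast
qed

end

context filtered_tensor begin

text \<open>Contracting \<open>g\<close> with the forms \<open>\<phi> j\<close>, \<open>j \<noteq> i\<close>, leaves an element \<open>y\<close> of \<open>R i\<close>, which represents the value as a function of the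
  form in coordinate \<open>i\<close>. It lies in \<open>V i (l i)\<close>: a term of \<open>g\<close> with too low a level at \<open>i\<close> has too high a level elsewhere and
  is killed by one of the other forms.\<close>

lemma contraction:
  assumes g: "g \<in> carrier MA.A" and i: "i \<in> I" and \<phi>: "forms_at I \<phi> l"
    and w: "\<And>x. x \<in> MA.supp g \<Longrightarrow> x i \<notin> V i (l i) \<Longrightarrow> \<exists>j\<in>I - {i}. x j \<in> V j (Suc (l j))"
  obtains y where "y \<in> V i (l i)"
    "\<And>\<nu>. linear_form F (R i) \<nu> \<Longrightarrow> MA.ev (prod_form I (\<phi>(i := \<nu>))) g = \<nu> y"
proof -
  interpret VS: vec_space F "R i" by (rule R_vs[OF i])
  have st: "x \<in> tup" if "x \<in> MA.supp g" for x using MA.monoid_algebraD(3)[OF g that] by simp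
  define c where "c x = g x \<otimes> prod_form (I - {i}) \<phi> x" for x
  have pc: "prod_form (I - {i}) \<phi> x \<in> carrier F" if "x \<in> tup" for x
    using forms_atD(3)[OF \<phi>] tupD[OF that] by (intro prod_form_closed) blast
  have cc: "c x \<in> carrier F" if "x \<in> MA.supp g" for x
    unfolding c_def using MA.monoid_algebraD(1)[OF g] pc[OF st[OF that]] by simp
  have xi: "x i \<in> carrier (R i)" if "x \<in> MA.supp g" for x by (rule tupD[OF st[OF that] i])
  define y where "y = (\<Oplus>\<^bsub>R i\<^esub>x\<in>MA.supp g. c x \<odot>\<^bsub>R i\<^esub> x i)"
  have "y \<in> V i (l i)"
    unfolding y_def
  proof (rule VS.submodule_finsum[OF V_submodule[OF i] MA.monoid_algebraD(4)[OF g]])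
    fix x assume x: "x \<in> MA.supp g"
    show "c x \<odot>\<^bsub>R i\<^esub> x i \<in> V i (l i)"
    proof (cases "x i \<in> V i (l i)")
      case True
      then show ?thesis using VS.submoduleD(4)[OF V_submodule[OF i] cc[OF x]] by blast
    next
      case False
      then obtain j where j: "j \<in> I - {i}" "x j \<in> V j (Suc (l j))" using w x by blast
      have "prod_form (I - {i}) \<phi> x = \<zero>"
      proof (rule prod_form_eq_zero[OF _ j(1)])
        show "finite (I - {i})" using finite_I by simp
        show "\<phi> j' (x j') \<in> carrier F" if "j' \<in> I - {i}" for j'
          using forms_atD(3)[OF \<phi>] tupD[OF st[OF x]] that by blast
        show "\<phi> j (x j) = \<zero>" using forms_atD(2)[OF \<phi> _ j(2)] j(1) by blast
      qed
      then have "c x = \<zero>" unfolding c_def using MA.monoid_algebraD(1)[OF g] by simp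
      then show ?thesis using xi[OF x] VS.submoduleD(2)[OF V_submodule[OF i]] by simp
    qed
  qed
  moreover have "MA.ev (prod_form I (\<phi>(i := \<nu>))) g = \<nu> y" if L: "linear_form F (R i) \<nu>" for \<nu>
  proof -
    have "\<nu> y = (\<Oplus>x\<in>MA.supp g. \<nu> (c x \<odot>\<^bsub>R i\<^esub> x i))"
      unfolding y_def using cc xi by (intro VS.linear_form_finsum[OF L MA.monoid_algebraD(4)[OF g]]) simp
    also have "\<dots> = (\<Oplus>x\<in>MA.supp g. g x \<otimes> prod_form I (\<phi>(i := \<nu>)) x)"
    proof (rule F.finsum_cong'[OF refl])
      have pc2: "(\<phi>(i := \<nu>)) j (x j) \<in> carrier F" if "x \<in> MA.supp g" "j \<in> I" for x j
        using forms_atD(3)[OF \<phi> that(2)] linear_formD(1)[OF L] tupD[OF st[OF that(1)] that(2)] by auto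
      show "(\<lambda>x. g x \<otimes> prod_form I (\<phi>(i := \<nu>)) x) \<in> MA.supp g \<rightarrow> carrier F"
        using MA.monoid_algebraD(1)[OF g] pc2 by (intro Pi_I F.m_closed prod_form_closed) blast+
      fix x assume x: "x \<in> MA.supp g"
      have p1: "prod_form I (\<phi>(i := \<nu>)) x = \<nu> (x i) \<otimes> prod_form (I - {i}) (\<phi>(i := \<nu>)) x"
        using prod_form_remove[OF finite_I i, of "\<phi>(i := \<nu>)" x] pc2[OF x] by simp
      have p2: "prod_form (I - {i}) (\<phi>(i := \<nu>)) x = prod_form (I - {i}) \<phi> x"
        using forms_atD(3)[OF \<phi>] tupD[OF st[OF x]] by (intro prod_form_cong) auto
      show "\<nu> (c x \<odot>\<^bsub>R i\<^esub> x i) = g x \<otimes> prod_form I (\<phi>(i := \<nu>)) x"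
        unfolding p1 p2 linear_formD(3)[OF L cc[OF x] xi[OF x]]
        using linear_formD(1)[OF L xi[OF x]] MA.monoid_algebraD(1)[OF g, of x] pc[OF st[OF x]]
        unfolding c_def by (simp add: F.m_ac)
    qed
    finally show ?thesis unfolding eval_coeffs_def by simp
  qed
  ultimately show thesis by (rule that)
qed

text \<open>The levels of \<open>x\<close> add up to at least \<open>k\<close>; a deficit against \<open>l\<close> at \<open>i\<close> is compensated by an excess at some \<open>j\<close>.\<close>

lemma Tup_exceed:
  assumes x: "x \<in> Tup k" and l: "(\<Sum>i\<in>I. l i) \<le> k" and i: "i \<in> I" "x i \<notin> V i (l i)"
  shows "\<exists>j\<in>I - {i}. x j \<in> V j (Suc (l j))"
proof -
  obtain a where a: "at_level a x" "k \<le> (\<Sum>i\<in>I. a i)" using x unfolding Tup_def by blast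
  have "a i < l i"
  proof (rule ccontr)
    assume "\<not> a i < l i"
    then have "V i (a i) \<subseteq> V i (l i)" using V_antimono[OF i(1)] by simp
    then show False using a(1) i unfolding at_level_def by blast
  qed
  then obtain j where j: "j \<in> I - {i}" "l j < a j"
    using exists_exceeding[OF order_trans[OF l a(2)] i(1)] by blast
  then have "x j \<in> V j (a j)" using a(1) unfolding at_level_def by blast
  then have "x j \<in> V j (Suc (l j))" using V_antimono[of j "Suc (l j)" "a j"] j by auto
  then show ?thesis using j(1) by blast
qed

text \<open>Detect \<open>g\<close> and \<open>h\<close> by products of linear forms \<open>\<phi> i\<close> and \<open>\<psi> i\<close>; the latter kill \<open>V i 1\<close>. One coordinate at a time,
  contract both elements to \<open>y\<close> and \<open>b\<close> in \<open>R i\<close> and replace \<open>\<phi> i\<close>, \<open>\<psi> i\<close> by a pair \<open>\<mu>\<close>, \<open>\<epsilon>\<close> with \<open>\<mu> y\<close> and \<open>\<epsilon> b\<close> nonzero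
  and \<open>\<mu> (r w) = \<epsilon> r \<cdot> \<mu> w\<close>. When all coordinates are treated, the product form is multiplicative on
  \<open>h \<cdot> g\<close>.\<close>

theorem mult_not_killed:
  assumes g: "g \<in> carrier MA.A" "MA.supp g \<subseteq> Tup k"
    and \<Phi>: "multilinear \<Phi>" "kills \<Phi> (Suc k)" "MA.ev \<Phi> g \<noteq> \<zero>"
    and h: "h \<in> carrier MA.A"
    and \<Psi>: "multilinear \<Psi>" "kills \<Psi> (Suc 0)" "MA.ev \<Psi> h \<noteq> \<zero>"
  shows "\<exists>\<Theta>. multilinear \<Theta> \<and> kills \<Theta> (Suc k) \<and> MA.ev \<Theta> (h \<otimes>\<^bsub>MA.A\<^esub> g) \<noteq> \<zero>"
proof -
  have gt: "x \<in> tup" if "x \<in> MA.supp g" for x using MA.monoid_algebraD(3)[OF g(1) that] by simp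
  have ht: "x \<in> tup" if "x \<in> MA.supp h" for x using MA.monoid_algebraD(3)[OF h that] by simp
  obtain \<phi>0 l where \<phi>0: "forms_at I \<phi>0 l" "(\<Sum>i\<in>I. l i) \<le> k" "MA.ev (prod_form I \<phi>0) g \<noteq> \<zero>"
    using detecting_product_form[OF g(1) \<Phi>] by blast
  obtain \<psi>0 l' where \<psi>0': "forms_at I \<psi>0 l'" "(\<Sum>i\<in>I. l' i) \<le> 0" "MA.ev (prod_form I \<psi>0) h \<noteq> \<zero>"
    using detecting_product_form[OF h \<Psi>] by blast
  have "l' i = 0" if "i \<in> I" for i using \<psi>0'(2) finite_I that by simp
  then have \<psi>0: "forms_at I \<psi>0 (\<lambda>_. 0)" using \<psi>0'(1) unfolding forms_at_def by simp
  \<comment> \<open>The coordinates of \<open>g\<close> on which the form at \<open>i\<close> has to be semilinear.\<close>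
  define Y where "Y i = (\<lambda>x. x i) ` MA.supp g \<inter> V i (l i)" for i
  have exc: "\<exists>j\<in>I - {i}. x j \<in> V j (Suc (l j))" if "x \<in> MA.supp g" "i \<in> I" "x i \<notin> V i (l i)" for x i
    by (rule Tup_exceed[where l=l, OF subsetD[OF g(2) that(1)] \<phi>0(2) that(2,3)])
  define good where "good i \<epsilon> \<mu> \<longleftrightarrow> \<epsilon> \<in> ring_hom (R i) F
     \<and> (\<forall>r\<in>carrier (R i). \<forall>w\<in>Y i. \<mu> (r \<otimes>\<^bsub>R i\<^esub> w) = \<epsilon> r \<otimes> \<mu> w)" for i and \<epsilon> \<mu> :: "'a \<Rightarrow> 'f"
  have "\<exists>\<phi> \<psi>. forms_at I \<phi> l \<and> forms_at I \<psi> (\<lambda>_. 0) \<and> MA.ev (prod_form I \<phi>) g \<noteq> \<zero>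
      \<and> MA.ev (prod_form I \<psi>) h \<noteq> \<zero> \<and> (\<forall>i\<in>S. good i (\<psi> i) (\<phi> i))" if "S \<subseteq> I" for S
    using finite_subset[OF that finite_I] that
  proof (induct S rule: finite_induct)
    case empty
    show ?case using \<phi>0 \<psi>0 \<psi>0'(3) by blast
  next
    case (insert i S)
    then obtain \<phi> \<psi> where IH: "forms_at I \<phi> l" "forms_at I \<psi> (\<lambda>_. 0)" "MA.ev (prod_form I \<phi>) g \<noteq> \<zero>"
      "MA.ev (prod_form I \<psi>) h \<noteq> \<zero>" "\<forall>i\<in>S. good i (\<psi> i) (\<phi> i)" by auto
    have i: "i \<in> I" using insert by simp
    obtain y where y: "y \<in> V i (l i)"
      "\<And>\<nu>. linear_form F (R i) \<nu> \<Longrightarrow> MA.ev (prod_form I (\<phi>(i := \<nu>))) g = \<nu> y"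
      using contraction[OF g(1) i IH(1)] exc[OF _ i] by blast
    have V0: "x i \<in> V i 0" if "x \<in> MA.supp h" for x using V_zero[OF i] tupD[OF ht[OF that] i] by simp
    obtain b where b: "b \<in> V i 0"
      "\<And>\<nu>. linear_form F (R i) \<nu> \<Longrightarrow> MA.ev (prod_form I (\<psi>(i := \<nu>))) h = \<nu> b"
      using contraction[OF h i IH(2)] V0 by blast
    have "\<phi> i y \<noteq> \<zero>" using y(2)[OF forms_atD(1)[OF IH(1) i]] IH(3) by simp
    then have yn: "y \<notin> V i (Suc (l i))" using forms_atD(2)[OF IH(1) i] by blast
    have "\<psi> i b \<noteq> \<zero>" using b(2)[OF forms_atD(1)[OF IH(2) i]] IH(4) by simp
    then have "b \<notin> V i 1" using forms_atD(2)[OF IH(2) i, of b] by auto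
    then have bn: "b \<in> carrier (R i) - V i 1" using b(1) V_zero[OF i] by simp
    have Yf: "finite (Y i)" "Y i \<subseteq> V i (l i)" unfolding Y_def using MA.monoid_algebraD(4)[OF g(1)] by auto
    obtain \<epsilon> \<mu> where em: "\<epsilon> \<in> ring_hom (R i) F" "linear_form F (R i) \<epsilon>" "\<And>p. p \<in> V i 1 \<Longrightarrow> \<epsilon> p = \<zero>"
      "\<epsilon> b \<noteq> \<zero>" "linear_form F (R i) \<mu>" "\<And>v. v \<in> V i (Suc (l i)) \<Longrightarrow> \<mu> v = \<zero>" "\<mu> y \<noteq> \<zero>"
      "\<And>r w. r \<in> carrier (R i) \<Longrightarrow> w \<in> Y i \<Longrightarrow> \<mu> (r \<otimes>\<^bsub>R i\<^esub> w) = \<epsilon> r \<otimes> \<mu> w"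
      by (rule layer_point[OF affine[OF i] alg_closed V_layer[OF i] bn y(1) yn Yf]) (rule that)
    have f1: "forms_at I (\<phi>(i := \<mu>)) l" using IH(1) em(5,6) unfolding forms_at_def by simp
    have f2: "forms_at I (\<psi>(i := \<epsilon>)) (\<lambda>_. 0)" using IH(2) em(2,3) unfolding forms_at_def by simp
    have f3: "MA.ev (prod_form I (\<phi>(i := \<mu>))) g \<noteq> \<zero>" unfolding y(2)[OF em(5)] by (rule em(7))
    have f4: "MA.ev (prod_form I (\<psi>(i := \<epsilon>))) h \<noteq> \<zero>" unfolding b(2)[OF em(2)] by (rule em(4))
    have "good i \<epsilon> \<mu>" unfolding good_def using em(1,8) by blast
    then have f5: "\<forall>j\<in>insert i S. good j ((\<psi>(i := \<epsilon>)) j) ((\<phi>(i := \<mu>)) j)" using IH(5) by simp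
    show ?case by (intro exI[of _ "\<phi>(i := \<mu>)"] exI[of _ "\<psi>(i := \<epsilon>)"] conjI f1 f2 f3 f4 f5)
  qed
  then obtain \<phi> \<psi> where *: "forms_at I \<phi> l" "forms_at I \<psi> (\<lambda>_. 0)" "MA.ev (prod_form I \<phi>) g \<noteq> \<zero>"
      "MA.ev (prod_form I \<psi>) h \<noteq> \<zero>" "\<forall>i\<in>I. good i (\<psi> i) (\<phi> i)" by blast
  note m\<phi> = prod_form_multilinear[OF *(1)] and m\<psi> = prod_form_multilinear[OF *(2)]
  have xy: "x \<otimes>\<^bsub>P\<^esub> y \<in> tup" if "x \<in> tup" "y \<in> tup" for x y
    using MA.M.m_closed[of x y] that by simp
  have split: "prod_form I \<phi> (x \<otimes>\<^bsub>P\<^esub> y) = prod_form I \<psi> x \<otimes> prod_form I \<phi> y"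
    if x: "x \<in> MA.supp h" and y: "y \<in> MA.supp g" for x y
  proof -
    note xt = ht[OF x] and yt = gt[OF y]
    have c: "\<psi> i (x i) \<in> carrier F" "\<phi> i (y i) \<in> carrier F" "\<phi> i ((x \<otimes>\<^bsub>P\<^esub> y) i) \<in> carrier F" if "i \<in> I" for i
      using forms_atD(3)[OF *(2) that tupD[OF xt that]] forms_atD(3)[OF *(1) that tupD[OF yt that]]
        forms_atD(3)[OF *(1) that tupD[OF xy[OF xt yt] that]] .
    have xyi: "(x \<otimes>\<^bsub>P\<^esub> y) i = x i \<otimes>\<^bsub>R i\<^esub> y i" if "i \<in> I" for i using that by simp
    show ?thesis
    proof (cases "\<forall>i\<in>I. y i \<in> V i (l i)")
      case True
      have "\<phi> i ((x \<otimes>\<^bsub>P\<^esub> y) i) = \<psi> i (x i) \<otimes> \<phi> i (y i)" if i: "i \<in> I" for i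
      proof -
        have "y i \<in> Y i" unfolding Y_def using y True i by blast
        then show ?thesis using *(5) i tupD[OF xt i] xyi[OF i] unfolding good_def by simp
      qed
      then have "prod_form I \<phi> (x \<otimes>\<^bsub>P\<^esub> y) = finprod F (\<lambda>i. \<psi> i (x i) \<otimes> \<phi> i (y i)) I"
        unfolding prod_form_def using c by (intro F.finprod_cong') auto
      also have "\<dots> = prod_form I \<psi> x \<otimes> prod_form I \<phi> y"
        unfolding prod_form_def using c by (intro F.finprod_multf) auto
      finally show ?thesis .
    next
      case False
      then obtain i where "i \<in> I" "y i \<notin> V i (l i)" by blast
      then obtain j where j: "j \<in> I" "y j \<in> V j (Suc (l j))" using exc[OF y] by blast
      have "x j \<otimes>\<^bsub>R j\<^esub> y j \<in> V j (Suc (l j))"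
        by (rule idealD(5)[OF V_ideal[OF j(1)] tupD[OF xt j(1)] j(2)])
      then have z: "\<phi> j ((x \<otimes>\<^bsub>P\<^esub> y) j) = \<zero>" using forms_atD(2)[OF *(1) j(1)] xyi[OF j(1)] by simp
      have "prod_form I \<phi> (x \<otimes>\<^bsub>P\<^esub> y) = \<zero>"
        by (rule prod_form_eq_zero[where \<phi>=\<phi> and x="x \<otimes>\<^bsub>P\<^esub> y", OF finite_I j(1) c(3) z])
      moreover have "prod_form I \<phi> y = \<zero>"
        by (rule prod_form_eq_zero[where \<phi>=\<phi> and x=y, OF finite_I j(1) c(2) forms_atD(2)[OF *(1) j(1) j(2)]])
      ultimately show ?thesis using multilinearD(1)[OF m\<psi> xt] by simp
    qed
  qed
  have evg: "MA.ev (prod_form I \<phi>) g \<in> carrier F" using multilinearD(1)[OF m\<phi>] gt by (intro MA.ev_closed[OF g(1)]) blast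
  have evh: "MA.ev (prod_form I \<psi>) h \<in> carrier F" using multilinearD(1)[OF m\<psi>] ht by (intro MA.ev_closed[OF h]) blast
  have "MA.ev (prod_form I \<phi>) (h \<otimes>\<^bsub>MA.A\<^esub> g) = MA.ev (\<lambda>x. MA.ev (\<lambda>y. prod_form I \<phi> (x \<otimes>\<^bsub>P\<^esub> y)) g) h"
    using multilinearD(1)[OF m\<phi>] by (intro MA.ev_mult[OF h g(1)]) simp
  also have "\<dots> = MA.ev (\<lambda>x. MA.ev (prod_form I \<phi>) g \<otimes> prod_form I \<psi> x) h"
  proof (rule MA.ev_cong[OF h])
    fix x assume x: "x \<in> MA.supp h"
    have px: "prod_form I \<psi> x \<in> carrier F" by (rule multilinearD(1)[OF m\<psi> ht[OF x]])
    show "MA.ev (prod_form I \<phi>) g \<otimes> prod_form I \<psi> x \<in> carrier F" using evg px by simp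
    have "MA.ev (\<lambda>y. prod_form I \<phi> (x \<otimes>\<^bsub>P\<^esub> y)) g = MA.ev (\<lambda>y. prod_form I \<psi> x \<otimes> prod_form I \<phi> y) g"
      using px multilinearD(1)[OF m\<phi>] gt split[OF x] by (intro MA.ev_cong[OF g(1)]) simp_all
    also have "\<dots> = prod_form I \<psi> x \<otimes> MA.ev (prod_form I \<phi>) g"
      using px multilinearD(1)[OF m\<phi>] gt by (intro MA.ev_smult_form[OF g(1)]) simp_all
    finally show "MA.ev (\<lambda>y. prod_form I \<phi> (x \<otimes>\<^bsub>P\<^esub> y)) g = MA.ev (prod_form I \<phi>) g \<otimes> prod_form I \<psi> x"
      using px evg by (simp add: F.m_comm)
  qed
  also have "\<dots> = MA.ev (prod_form I \<phi>) g \<otimes> MA.ev (prod_form I \<psi>) h"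
    using evg multilinearD(1)[OF m\<psi>] ht by (intro MA.ev_smult_form[OF h]) simp_all
  finally have "MA.ev (prod_form I \<phi>) (h \<otimes>\<^bsub>MA.A\<^esub> g) \<noteq> \<zero>"
    using *(3,4) evg evh F.integral by force
  moreover have "kills (prod_form I \<phi>) (Suc k)"
    using \<phi>0(2) by (intro prod_form_kills[OF *(1)]) simp
  ultimately show ?thesis using m\<phi> by blast
qed

end

section \<open>Powers and symbolic powers of ideals\<close>

context cring begin

abbreviation ideal_pow where "ideal_pow I n \<equiv> I [^]\<^bsub>ideals_set R\<^esub> (n::nat)"

lemma ideal_pow_simps:
  "ideal_pow I 0 = carrier R" "ideal_pow I (Suc n) = ideal_pow I n \<cdot> I"
  by (simp_all add: ideals_set_def)

lemma ideal_pow_ideal: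
  assumes I: "ideal I R" shows "ideal (ideal_pow I n) R"
proof (induct n)
  case 0
  show ?case unfolding ideal_pow_simps by (rule oneideal)
next
  case (Suc n)
  show ?case unfolding ideal_pow_simps by (rule ideal_prod_is_ideal[OF Suc I])
qed

lemma ideal_pow_one: "ideal I R \<Longrightarrow> ideal_pow I 1 = I"
  unfolding One_nat_def ideal_pow_simps
  using ideal_prod_one[of I] ideal_prod_commute[OF oneideal, of I] by simp

lemma ideal_pow_mult:
  assumes I: "ideal I R" and x: "x \<in> ideal_pow I a" and y: "y \<in> ideal_pow I b"
  shows "x \<otimes> y \<in> ideal_pow I (a + b)"
proof -
  interpret S: comm_monoid "ideals_set R" by (rule ideals_set_is_comm_monoid)
  have IS: "I \<in> carrier (ideals_set R)" using I by (simp add: ideals_set_def)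
  have "x \<otimes> y \<in> ideal_pow I a \<cdot> ideal_pow I b" by (rule ideal_prod.prod[OF x y])
  also have "\<dots> = ideal_pow I (a + b)"
    using S.nat_pow_mult[OF IS, of a b] by (simp add: ideals_set_def)
  finally show ?thesis .
qed

lemma ideal_pow_antimono:
  assumes I: "ideal I R" and "a \<le> b"
  shows "ideal_pow I b \<subseteq> ideal_pow I a"
proof (rule lift_Suc_antimono_le[OF _ assms(2)])
  show "ideal_pow I (Suc n) \<subseteq> ideal_pow I n" for n
    unfolding ideal_pow_simps using ideal_prod_inter[OF ideal_pow_ideal[OF I] I] by blast
qed

lemma symbolic_powerI:
  "f \<in> carrier R \<Longrightarrow> u \<in> carrier R \<Longrightarrow> u \<notin> P \<Longrightarrow> u \<otimes> f \<in> ideal_pow P a \<Longrightarrow> f \<in> symbolic_power R P a"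
  unfolding symbolic_power_def by blast

lemma symbolic_powerE:
  assumes "f \<in> symbolic_power R P a"
  obtains u where "f \<in> carrier R" "u \<in> carrier R" "u \<notin> P" "u \<otimes> f \<in> ideal_pow P a"
  using assms unfolding symbolic_power_def by blast

end

context primeideal begin

lemma symbolic_power_zero: "symbolic_power R I 0 = carrier R"
proof -
  have one: "\<one> \<notin> I" using one_imp_carrier I_notcarr by blast
  have "f \<in> symbolic_power R I 0" if "f \<in> carrier R" for f
    by (rule symbolic_powerI[OF that one_closed one]) (use that ideal_pow_simps(1) in simp)
  then show ?thesis unfolding symbolic_power_def by blast
qed

lemma ideal_pow_symbolic_power: "ideal_pow I a \<subseteq> symbolic_power R I a"
proof
  fix f assume f: "f \<in> ideal_pow I a"
  then have fR: "f \<in> carrier R" using idealD(2)[OF ideal_pow_ideal[OF is_ideal]] by blast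
  have "\<one> \<notin> I" using one_imp_carrier I_notcarr by blast
  then show "f \<in> symbolic_power R I a" using f fR by (intro symbolic_powerI[of f \<one>]) simp_all
qed

lemma not_in_mult: "u \<in> carrier R \<Longrightarrow> v \<in> carrier R \<Longrightarrow> u \<notin> I \<Longrightarrow> v \<notin> I \<Longrightarrow> u \<otimes> v \<notin> I"
  using I_prime by blast

lemma symbolic_power_mult:
  assumes f: "f \<in> symbolic_power R I a" and g: "g \<in> symbolic_power R I b"
  shows "f \<otimes> g \<in> symbolic_power R I (a + b)"
proof -
  obtain u where u: "f \<in> carrier R" "u \<in> carrier R" "u \<notin> I" "u \<otimes> f \<in> ideal_pow I a"
    by (rule symbolic_powerE[OF f])
  obtain v where v: "g \<in> carrier R" "v \<in> carrier R" "v \<notin> I" "v \<otimes> g \<in> ideal_pow I b"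
    by (rule symbolic_powerE[OF g])
  have "(u \<otimes> f) \<otimes> (v \<otimes> g) = (u \<otimes> v) \<otimes> (f \<otimes> g)" using u v by (simp add: m_ac)
  then have "(u \<otimes> v) \<otimes> (f \<otimes> g) \<in> ideal_pow I (a + b)"
    using ideal_pow_mult[OF is_ideal u(4) v(4)] by simp
  then show ?thesis using u v not_in_mult by (intro symbolic_powerI[of _ "u \<otimes> v"]) simp_all
qed

lemma symbolic_power_ideal: "ideal (symbolic_power R I a) R"
proof (rule idealI[OF ring_axioms])
  note PD = idealD[OF ideal_pow_ideal[OF is_ideal, of a]]
  have sub: "f \<in> carrier R" if "f \<in> symbolic_power R I a" for f
    using that unfolding symbolic_power_def by blast
  have mult: "r \<otimes> f \<in> symbolic_power R I a" if f: "f \<in> symbolic_power R I a" and r: "r \<in> carrier R" for f r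
    using symbolic_power_mult[of r 0 f a] f r symbolic_power_zero by simp
  have add: "f \<oplus> g \<in> symbolic_power R I a" if f: "f \<in> symbolic_power R I a" and g: "g \<in> symbolic_power R I a" for f g
  proof -
    obtain u where u: "f \<in> carrier R" "u \<in> carrier R" "u \<notin> I" "u \<otimes> f \<in> ideal_pow I a"
      by (rule symbolic_powerE[OF f])
    obtain v where v: "g \<in> carrier R" "v \<in> carrier R" "v \<notin> I" "v \<otimes> g \<in> ideal_pow I a"
      by (rule symbolic_powerE[OF g])
    have "v \<otimes> (u \<otimes> f) \<oplus> u \<otimes> (v \<otimes> g) \<in> ideal_pow I a"
      by (intro PD(4) PD(5) u v)
    moreover have "v \<otimes> (u \<otimes> f) \<oplus> u \<otimes> (v \<otimes> g) = (u \<otimes> v) \<otimes> (f \<oplus> g)"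
      using u v by (simp add: r_distr m_ac)
    ultimately show ?thesis using u v not_in_mult by (intro symbolic_powerI[of _ "u \<otimes> v"]) simp_all
  qed
  have zero: "\<zero> \<in> symbolic_power R I a"
    using ideal_pow_symbolic_power PD(3) by blast
  have inv: "\<ominus> f \<in> symbolic_power R I a" if "f \<in> symbolic_power R I a" for f
    using mult[OF that, of "\<ominus> \<one>"] sub[OF that] by (simp add: l_minus)
  show "subgroup (symbolic_power R I a) (add_monoid R)"
    by (rule add.subgroupI) (use zero inv add sub in \<open>auto simp: a_inv_def\<close>)
  show "x \<otimes> f \<in> symbolic_power R I a" "f \<otimes> x \<in> symbolic_power R I a"
    if "f \<in> symbolic_power R I a" "x \<in> carrier R" for f x
    using mult[OF that] m_comm[OF that(2) sub[OF that(1)]] by simp_all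
qed

lemma symbolic_power_dec: "symbolic_power R I (Suc a) \<subseteq> symbolic_power R I a"
  unfolding symbolic_power_def using ideal_pow_antimono[OF is_ideal, of a "Suc a"] by auto

lemma symbolic_power_one: "symbolic_power R I 1 = I"
proof
  show "symbolic_power R I 1 \<subseteq> I"
  proof
    fix f assume "f \<in> symbolic_power R I 1"
    then obtain u where u: "f \<in> carrier R" "u \<in> carrier R" "u \<notin> I" "u \<otimes> f \<in> ideal_pow I 1"
      by (rule symbolic_powerE)
    then show "f \<in> I" using I_prime ideal_pow_one[OF is_ideal] by blast
  qed
  show "I \<subseteq> symbolic_power R I 1"
    using ideal_pow_symbolic_power[of 1] ideal_pow_one[OF is_ideal] by simp
qed

lemma symbolic_power_torsion_free:
  assumes r: "r \<in> carrier R" "r \<notin> I" and v: "v \<in> carrier R" and rv: "r \<otimes> v \<in> symbolic_power R I a"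
  shows "v \<in> symbolic_power R I a"
proof -
  obtain u where u: "u \<in> carrier R" "u \<notin> I" "u \<otimes> (r \<otimes> v) \<in> ideal_pow I a"
    by (rule symbolic_powerE[OF rv])
  then show ?thesis using r v not_in_mult by (intro symbolic_powerI[of _ "u \<otimes> r"]) (simp_all add: m_assoc)
qed

end

context cring begin

lemma sum_ideals:
  assumes "finite S" "\<And>i. i \<in> S \<Longrightarrow> ideal (E i) R"
  shows "ideal (\<Oplus>\<^bsub>ideals_set R\<^esub>i\<in>S. E i) R"
    "i \<in> S \<Longrightarrow> E i \<subseteq> (\<Oplus>\<^bsub>ideals_set R\<^esub>i\<in>S. E i)"
    "ideal K R \<Longrightarrow> (\<And>i. i \<in> S \<Longrightarrow> E i \<subseteq> K) \<Longrightarrow> (\<Oplus>\<^bsub>ideals_set R\<^esub>i\<in>S. E i) \<subseteq> K"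
proof -
  interpret S: semiring "ideals_set R" by (rule ideals_set_is_semiring)
  have sc: "carrier (ideals_set R) = {I. ideal I R}" "\<zero>\<^bsub>ideals_set R\<^esub> = {\<zero>}"
    "x \<oplus>\<^bsub>ideals_set R\<^esub> y = x <+>\<^bsub>R\<^esub> y" for x y
    by (simp_all add: ideals_set_def)
  have "ideal (\<Oplus>\<^bsub>ideals_set R\<^esub>i\<in>S. E i) R \<and> (\<forall>i\<in>S. E i \<subseteq> (\<Oplus>\<^bsub>ideals_set R\<^esub>i\<in>S. E i))
    \<and> (\<forall>K. ideal K R \<longrightarrow> (\<forall>i\<in>S. E i \<subseteq> K) \<longrightarrow> (\<Oplus>\<^bsub>ideals_set R\<^esub>i\<in>S. E i) \<subseteq> K)"
    using assms
  proof (induct S rule: finite_induct)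
    case empty
    then show ?case using zeroideal idealD(3) by (auto simp: sc)
  next
    case (insert j S)
    define B where "B = (\<Oplus>\<^bsub>ideals_set R\<^esub>i\<in>S. E i)"
    have B: "ideal B R" "\<forall>i\<in>S. E i \<subseteq> B" "\<forall>K. ideal K R \<longrightarrow> (\<forall>i\<in>S. E i \<subseteq> K) \<longrightarrow> B \<subseteq> K"
      using insert(3,4) unfolding B_def by auto
    have Ej: "ideal (E j) R" using insert(4) by simp
    have eq: "(\<Oplus>\<^bsub>ideals_set R\<^esub>i\<in>insert j S. E i) = E j <+>\<^bsub>R\<^esub> B"
      using S.finsum_insert[OF insert(1,2), of E] insert(4) unfolding B_def sc by auto
    have mem: "x \<in> E j <+>\<^bsub>R\<^esub> B \<longleftrightarrow> (\<exists>a\<in>E j. \<exists>b\<in>B. x = a \<oplus> b)" for x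
      unfolding set_add_def' by blast
    have s1: "E j \<subseteq> E j <+>\<^bsub>R\<^esub> B"
    proof
      fix x assume x: "x \<in> E j"
      show "x \<in> E j <+>\<^bsub>R\<^esub> B" unfolding mem
        using x idealD(3)[OF B(1)] idealD(2)[OF Ej x] by (intro bexI[of _ x] bexI[of _ \<zero>]) simp_all
    qed
    have s2: "B \<subseteq> E j <+>\<^bsub>R\<^esub> B"
    proof
      fix x assume x: "x \<in> B"
      show "x \<in> E j <+>\<^bsub>R\<^esub> B" unfolding mem
        using x idealD(3)[OF Ej] idealD(2)[OF B(1) x] by (intro bexI[of _ \<zero>] bexI[of _ x]) simp_all
    qed
    have s3: "E j <+>\<^bsub>R\<^esub> B \<subseteq> K" if "ideal K R" "E j \<subseteq> K" "B \<subseteq> K" for K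
      using idealD(4)[OF that(1)] that(2,3) unfolding mem subset_iff by blast
    show ?case unfolding eq
    proof (intro conjI)
      show "ideal (E j <+>\<^bsub>R\<^esub> B) R" by (rule add_ideals[OF Ej B(1)])
      show "\<forall>i\<in>insert j S. E i \<subseteq> E j <+>\<^bsub>R\<^esub> B" using s1 s2 B(2) by blast
      show "\<forall>K. ideal K R \<longrightarrow> (\<forall>i\<in>insert j S. E i \<subseteq> K) \<longrightarrow> E j <+>\<^bsub>R\<^esub> B \<subseteq> K"
        using s3 B(3) by simp
    qed
  qed
  then show "ideal (\<Oplus>\<^bsub>ideals_set R\<^esub>i\<in>S. E i) R"
    "i \<in> S \<Longrightarrow> E i \<subseteq> (\<Oplus>\<^bsub>ideals_set R\<^esub>i\<in>S. E i)"
    "ideal K R \<Longrightarrow> (\<And>i. i \<in> S \<Longrightarrow> E i \<subseteq> K) \<Longrightarrow> (\<Oplus>\<^bsub>ideals_set R\<^esub>i\<in>S. E i) \<subseteq> K"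
    by simp_all
qed

end

section \<open>The tensor product as a quotient\<close>

context tensor_family begin

abbreviation "T \<equiv> tensor_product F I R"
abbreviation cl where "cl g \<equiv> J +>\<^bsub>MA.A\<^esub> g"

lemma T_eq: "T = MA.A Quot J"
  by (simp add: tensor_product_def)

lemma T_cring: "cring T"
  unfolding T_eq by (rule ideal.quotient_is_cring[OF J_ideal MA.A_cring])

lemma cl_simps:
  "g \<in> carrier MA.A \<Longrightarrow> cl g \<in> carrier T"
  "g \<in> carrier MA.A \<Longrightarrow> h \<in> carrier MA.A \<Longrightarrow> cl (g \<oplus>\<^bsub>MA.A\<^esub> h) = cl g \<oplus>\<^bsub>T\<^esub> cl h"
  "g \<in> carrier MA.A \<Longrightarrow> h \<in> carrier MA.A \<Longrightarrow> cl (g \<otimes>\<^bsub>MA.A\<^esub> h) = cl g \<otimes>\<^bsub>T\<^esub> cl h"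
  "cl \<one>\<^bsub>MA.A\<^esub> = \<one>\<^bsub>T\<^esub>"
  using ring_hom_memE[OF ideal.rcos_ring_hom[OF J_ideal]] unfolding T_eq by blast+

lemma cl_zero: "cl \<zero>\<^bsub>MA.A\<^esub> = \<zero>\<^bsub>T\<^esub>"
proof -
  interpret A: cring MA.A by (rule MA.A_cring)
  interpret T: cring T by (rule T_cring)
  have "cl \<zero>\<^bsub>MA.A\<^esub> \<oplus>\<^bsub>T\<^esub> cl \<zero>\<^bsub>MA.A\<^esub> = cl \<zero>\<^bsub>MA.A\<^esub>"
    using cl_simps(2)[OF A.zero_closed A.zero_closed] A.r_zero[OF A.zero_closed] by simp
  then show ?thesis using cl_simps(1)[OF A.zero_closed] by (metis T.add.l_cancel_one)
qed

lemma cl_surj: "t \<in> carrier T \<Longrightarrow> \<exists>g\<in>carrier MA.A. t = cl g"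
  unfolding T_eq FactRing_def A_RCOSETS_def' by auto

lemma cl_eq:
  assumes "g \<in> carrier MA.A" "h \<in> carrier MA.A" "cl g = cl h"
  shows "g \<ominus>\<^bsub>MA.A\<^esub> h \<in> J"
  using ring.quotient_eq_iff_same_a_r_cos[OF cring.axioms(1)[OF MA.A_cring] J_ideal assms(1,2)] assms(3) by simp

lemma cl_relation:
  assumes r: "g \<ominus>\<^bsub>MA.A\<^esub> h \<in> tensor_relations F I R" and "g \<in> carrier MA.A" "h \<in> carrier MA.A"
  shows "cl g = cl h"
proof -
  interpret A: cring MA.A by (rule MA.A_cring)
  have "g \<ominus>\<^bsub>MA.A\<^esub> h \<in> J"
    unfolding tensor_ideal_def using A.genideal_self[OF tensor_relations_carrier] r by blast
  then show ?thesis
    using ring.quotient_eq_iff_same_a_r_cos[OF cring.axioms(1)[OF MA.A_cring] J_ideal assms(2,3)] by simp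
qed

abbreviation mon where "mon \<equiv> monomial F"
definition \<tau> where "\<tau> x = cl (mon \<one> x)"
definition \<kappa> where "\<kappa> c = cl (mon c \<one>\<^bsub>P\<^esub>)"

lemma mon_closed: "c \<in> carrier F \<Longrightarrow> x \<in> tup \<Longrightarrow> mon c x \<in> carrier MA.A"
  using MA.monomial_closed by simp

lemma mon_mult:
  assumes "c \<in> carrier F" "d \<in> carrier F" "x \<in> tup" "y \<in> tup"
  shows "mon c x \<otimes>\<^bsub>MA.A\<^esub> mon d y = mon (c \<otimes> d) (x \<otimes>\<^bsub>P\<^esub> y)"
proof (rule MA.A_ext)
  have xP: "x \<in> carrier P" "y \<in> carrier P" "x \<otimes>\<^bsub>P\<^esub> y \<in> carrier P"
    using assms(3,4) MA.M.m_closed[of x y] by simp_all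
  note c = mon_closed[OF assms(1,3)] and d = mon_closed[OF assms(2,4)]
  show "mon c x \<otimes>\<^bsub>MA.A\<^esub> mon d y \<in> carrier MA.A" by (rule MA.mult_closed[OF c d])
  show "mon (c \<otimes> d) (x \<otimes>\<^bsub>P\<^esub> y) \<in> carrier MA.A"
    using MA.monomial_closed[OF _ xP(3)] assms by blast
  fix z
  have e: "MA.ev (\<lambda>y. MA.\<delta> z (x' \<otimes>\<^bsub>P\<^esub> y)) (mon d y) = d \<otimes> MA.\<delta> z (x' \<otimes>\<^bsub>P\<^esub> y)" for x'
    by (rule MA.ev_monomial[OF assms(2) xP(2) MA.delta_closed])
  have "MA.ev (MA.\<delta> z) (mon c x \<otimes>\<^bsub>MA.A\<^esub> mon d y)
      = MA.ev (\<lambda>x. MA.ev (\<lambda>y. MA.\<delta> z (x \<otimes>\<^bsub>P\<^esub> y)) (mon d y)) (mon c x)"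
    by (rule MA.ev_mult[OF c d MA.delta_closed])
  also have "\<dots> = MA.ev (\<lambda>x. d \<otimes> MA.\<delta> z (x \<otimes>\<^bsub>P\<^esub> y)) (mon c x)" unfolding e ..
  also have "\<dots> = c \<otimes> (d \<otimes> MA.\<delta> z (x \<otimes>\<^bsub>P\<^esub> y))"
    by (rule MA.ev_monomial[OF assms(1) xP(1)]) (rule F.m_closed[OF assms(2) MA.delta_closed])
  also have "\<dots> = (c \<otimes> d) \<otimes> MA.\<delta> z (x \<otimes>\<^bsub>P\<^esub> y)"
    by (rule F.m_assoc[symmetric, OF assms(1,2) MA.delta_closed])
  also have "\<dots> = MA.ev (MA.\<delta> z) (mon (c \<otimes> d) (x \<otimes>\<^bsub>P\<^esub> y))"
    by (rule MA.ev_monomial[symmetric, OF F.m_closed[OF assms(1,2)] xP(3) MA.delta_closed])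
  finally show "MA.ev (MA.\<delta> z) (mon c x \<otimes>\<^bsub>MA.A\<^esub> mon d y) = MA.ev (MA.\<delta> z) (mon (c \<otimes> d) (x \<otimes>\<^bsub>P\<^esub> y))" .
qed

lemma mon_add:
  "c \<in> carrier F \<Longrightarrow> d \<in> carrier F \<Longrightarrow> mon c x \<oplus>\<^bsub>MA.A\<^esub> mon d x = mon (c \<oplus> d) x"
  unfolding MA.monoid_algebra_simps(5) by (auto simp: monomial_def)

lemma one_tup: "\<one>\<^bsub>P\<^esub> \<in> tup"
  using MA.M.one_closed by simp

lemma cl_mon: "c \<in> carrier F \<Longrightarrow> x \<in> tup \<Longrightarrow> cl (mon c x) = \<kappa> c \<otimes>\<^bsub>T\<^esub> \<tau> x"
  unfolding \<kappa>_def \<tau>_def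
  using cl_simps(3)[OF mon_closed[OF _ one_tup] mon_closed[OF F.one_closed], of c x]
    mon_mult[OF _ F.one_closed one_tup, of c x] MA.M.l_one[of x] by simp

lemma \<tau>_closed: "x \<in> tup \<Longrightarrow> \<tau> x \<in> carrier T"
  unfolding \<tau>_def by (rule cl_simps(1)[OF mon_closed[OF F.one_closed]])

lemma \<tau>_mult: "x \<in> tup \<Longrightarrow> y \<in> tup \<Longrightarrow> \<tau> (x \<otimes>\<^bsub>P\<^esub> y) = \<tau> x \<otimes>\<^bsub>T\<^esub> \<tau> y"
  unfolding \<tau>_def
  using cl_simps(3)[OF mon_closed[OF F.one_closed] mon_closed[OF F.one_closed], of x y]
    mon_mult[OF F.one_closed F.one_closed, of x y] by simp

lemma \<tau>_one: "\<tau> \<one>\<^bsub>P\<^esub> = \<one>\<^bsub>T\<^esub>"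
  unfolding \<tau>_def using cl_simps(4) unfolding MA.monoid_algebra_simps(3) .

lemma \<kappa>_hom: "\<kappa> \<in> ring_hom F T"
proof (rule ring_hom_memI)
  show "\<kappa> x \<in> carrier T" if "x \<in> carrier F" for x
    unfolding \<kappa>_def by (rule cl_simps(1)[OF mon_closed[OF that one_tup]])
  show "\<kappa> (x \<otimes> y) = \<kappa> x \<otimes>\<^bsub>T\<^esub> \<kappa> y" "\<kappa> (x \<oplus> y) = \<kappa> x \<oplus>\<^bsub>T\<^esub> \<kappa> y"
    if "x \<in> carrier F" "y \<in> carrier F" for x y
    unfolding \<kappa>_def
    using cl_simps(2,3)[OF mon_closed[OF that(1) one_tup] mon_closed[OF that(2) one_tup]]
      mon_mult[OF that one_tup one_tup] mon_add[OF that] MA.M.l_one[OF MA.M.one_closed] by simp_all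
  show "\<kappa> \<one> = \<one>\<^bsub>T\<^esub>" using \<tau>_one unfolding \<kappa>_def \<tau>_def .
qed

lemma \<tau>_add:
  assumes "x \<in> tup" "i \<in> I" "a \<in> carrier (R i)" "b \<in> carrier (R i)"
  shows "\<tau> (x(i := a \<oplus>\<^bsub>R i\<^esub> b)) = \<tau> (x(i := a)) \<oplus>\<^bsub>T\<^esub> \<tau> (x(i := b))"
proof -
  interpret Ri: algebra F "R i" by (rule alg[OF assms(2)])
  note m = mon_closed[OF F.one_closed tup_upd[OF assms(1,2)]]
  have "cl (mon \<one> (x(i := a \<oplus>\<^bsub>R i\<^esub> b))) = cl (mon \<one> (x(i := a)) \<oplus>\<^bsub>MA.A\<^esub> mon \<one> (x(i := b)))"
  proof (rule cl_relation)
    show "mon \<one> (x(i := a \<oplus>\<^bsub>R i\<^esub> b)) \<ominus>\<^bsub>MA.A\<^esub> (mon \<one> (x(i := a)) \<oplus>\<^bsub>MA.A\<^esub> mon \<one> (x(i := b)))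
      \<in> tensor_relations F I R" unfolding tensor_relations_def using assms by blast
    show "mon \<one> (x(i := a \<oplus>\<^bsub>R i\<^esub> b)) \<in> carrier MA.A" by (rule m[OF Ri.a_closed[OF assms(3,4)]])
    show "mon \<one> (x(i := a)) \<oplus>\<^bsub>MA.A\<^esub> mon \<one> (x(i := b)) \<in> carrier MA.A"
      by (rule MA.ev_add(1)[OF m[OF assms(3)] m[OF assms(4)] F.zero_closed])
  qed
  then show ?thesis unfolding \<tau>_def cl_simps(2)[OF m[OF assms(3)] m[OF assms(4)]] .
qed

lemma \<tau>_smult:
  assumes "x \<in> tup" "i \<in> I" "c \<in> carrier F" "a \<in> carrier (R i)"
  shows "\<tau> (x(i := c \<odot>\<^bsub>R i\<^esub> a)) = \<kappa> c \<otimes>\<^bsub>T\<^esub> \<tau> (x(i := a))"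
proof -
  interpret Ri: algebra F "R i" by (rule alg[OF assms(2)])
  have "cl (mon \<one> (x(i := c \<odot>\<^bsub>R i\<^esub> a))) = cl (mon c (x(i := a)))"
  proof (rule cl_relation)
    show "mon \<one> (x(i := c \<odot>\<^bsub>R i\<^esub> a)) \<ominus>\<^bsub>MA.A\<^esub> mon c (x(i := a)) \<in> tensor_relations F I R"
      unfolding tensor_relations_def using assms by blast
    show "mon \<one> (x(i := c \<odot>\<^bsub>R i\<^esub> a)) \<in> carrier MA.A"
      by (rule mon_closed[OF F.one_closed tup_upd[OF assms(1,2) Ri.smult_closed[OF assms(3,4)]]])
    show "mon c (x(i := a)) \<in> carrier MA.A"
      by (rule mon_closed[OF assms(3) tup_upd[OF assms(1,2,4)]])
  qed
  then show ?thesis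
    unfolding cl_mon[OF assms(3) tup_upd[OF assms(1,2,4)]] unfolding \<tau>_def .
qed

text \<open>The tensor product with its scalar multiplication. \<^const>\<open>tensor_product\<close> is a plain ring, and the separation
  theorem is about modules.\<close>

definition T_module :: "('f, (('i \<Rightarrow> 'a) \<Rightarrow> 'f) set) module" where
  "T_module = \<lparr>carrier = carrier T, monoid.mult = monoid.mult T, monoid.one = \<one>\<^bsub>T\<^esub>, ring.zero = \<zero>\<^bsub>T\<^esub>, ring.add = ring.add T,
     smult = (\<lambda>c t. \<kappa> c \<otimes>\<^bsub>T\<^esub> t)\<rparr>"

lemma T_module_simps:
  "carrier T_module = carrier T" "x \<oplus>\<^bsub>T_module\<^esub> y = x \<oplus>\<^bsub>T\<^esub> y" "c \<odot>\<^bsub>T_module\<^esub> t = \<kappa> c \<otimes>\<^bsub>T\<^esub> t" "\<zero>\<^bsub>T_module\<^esub> = \<zero>\<^bsub>T\<^esub>"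
  by (simp_all add: T_module_def)

lemma T_module_vec_space: "vec_space F T_module"
proof -
  interpret T: cring T by (rule T_cring)
  note k = ring_hom_memE[OF \<kappa>_hom]
  have "abelian_group T_module"
    by (rule abelian_groupI) (auto simp: T_module_simps T.a_ac intro: T.l_neg T.a_inv_closed)
  then have "module F T_module"
    by (rule moduleI[OF F.cring_axioms]) (auto simp: T_module_simps k T.l_distr T.r_distr T.m_assoc)
  then show ?thesis using field by (simp add: vec_space_def)
qed

lemma ideal_T_submodule:
  assumes "ideal K T" shows "submodule K F T_module"
proof -
  interpret VS: vec_space F T_module by (rule T_module_vec_space)
  note KD = idealD[OF assms]
  show ?thesis
    by (rule VS.submodule_addI) (use KD ring_hom_memE(1)[OF \<kappa>_hom] in \<open>auto simp: T_module_simps\<close>)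
qed

text \<open>Induction over the monomials of \<open>g\<close> itself, so that information on its support is available.\<close>

lemma A_decomp:
  assumes g: "g \<in> carrier MA.A" and zero: "Z \<zero>\<^bsub>MA.A\<^esub>"
    and mono: "\<And>x. x \<in> MA.supp g \<Longrightarrow> Z (mon (g x) x)"
    and add: "\<And>a b. a \<in> carrier MA.A \<Longrightarrow> b \<in> carrier MA.A \<Longrightarrow> Z a \<Longrightarrow> Z b \<Longrightarrow> Z (a \<oplus>\<^bsub>MA.A\<^esub> b)"
  shows "Z g"
proof -
  define res where "res S = (\<lambda>x. if x \<in> S then g x else \<zero>)" for S
  have resA: "res S \<in> carrier MA.A" for S
    by (rule MA.monoid_algebraI[OF _ MA.monoid_algebraD(4,2)[OF g]]) (simp_all add: res_def MA.monoid_algebraD(1)[OF g] MA.supp_zero)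
  have "Z (res S)" if "S \<subseteq> MA.supp g" for S
    using finite_subset[OF that MA.monoid_algebraD(4)[OF g]] that
  proof (induct S rule: finite_induct)
    case empty
    have "res {} = \<zero>\<^bsub>MA.A\<^esub>" unfolding res_def MA.monoid_algebra_simps(4) by simp
    then show ?case using zero by simp
  next
    case (insert x S)
    have "res (insert x S) = mon (g x) x \<oplus>\<^bsub>MA.A\<^esub> res S"
      using insert(2) MA.monoid_algebraD(1)[OF g] unfolding MA.monoid_algebra_simps(5) res_def monomial_def by auto
    moreover have "mon (g x) x \<in> carrier MA.A"
      by (rule MA.monomial_closed[OF MA.monoid_algebraD(1)[OF g] MA.monoid_algebraD(3)[OF g]]) (use insert in blast)
    ultimately show ?case using add[OF _ resA] mono insert by simp
  qed
  moreover have "res (MA.supp g) = g" unfolding res_def by (auto simp: MA.supp_zero)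
  ultimately show ?thesis by (metis order_refl)
qed

lemma linear_form_multilinear:
  assumes L: "linear_form F T_module \<Lambda>"
  shows "multilinear (\<lambda>x. \<Lambda> (\<tau> x))" "g \<in> carrier MA.A \<Longrightarrow> MA.ev (\<lambda>x. \<Lambda> (\<tau> x)) g = \<Lambda> (cl g)"
proof -
  interpret T: cring T by (rule T_cring)
  interpret VS: vec_space F T_module by (rule T_module_vec_space)
  note LD = linear_formD[OF L, unfolded T_module_simps]
  show ml: "multilinear (\<lambda>x. \<Lambda> (\<tau> x))"
    unfolding multilinear_def linear_at_def
    using LD \<tau>_closed tup_upd \<tau>_add \<tau>_smult by auto
  assume g: "g \<in> carrier MA.A"
  have \<Phi>: "\<And>x. x \<in> carrier P \<Longrightarrow> \<Lambda> (\<tau> x) \<in> carrier F" using LD(1) \<tau>_closed by simp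
  show "MA.ev (\<lambda>x. \<Lambda> (\<tau> x)) g = \<Lambda> (cl g)"
  proof (rule A_decomp[OF g])
    have "MA.ev (\<lambda>x. \<Lambda> (\<tau> x)) \<zero>\<^bsub>MA.A\<^esub> = \<zero>"
      unfolding eval_coeffs_def coeff_support_def MA.monoid_algebra_simps(4) by simp
    then show "MA.ev (\<lambda>x. \<Lambda> (\<tau> x)) \<zero>\<^bsub>MA.A\<^esub> = \<Lambda> (cl \<zero>\<^bsub>MA.A\<^esub>)"
      using VS.linear_form_zero[OF L] unfolding T_module_simps cl_zero by simp
  next
    fix x assume x: "x \<in> MA.supp g"
    have gx: "g x \<in> carrier F" "x \<in> tup" using MA.monoid_algebraD(1,3)[OF g] x by auto
    show "MA.ev (\<lambda>x. \<Lambda> (\<tau> x)) (mon (g x) x) = \<Lambda> (cl (mon (g x) x))"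
      using MA.ev_monomial[OF gx(1), of x "\<lambda>x. \<Lambda> (\<tau> x)"] gx(2) \<Phi> LD(3)[OF gx(1) \<tau>_closed[OF gx(2)]]
      unfolding cl_mon[OF gx] by simp
  next
    fix a b assume ab: "a \<in> carrier MA.A" "b \<in> carrier MA.A"
      "MA.ev (\<lambda>x. \<Lambda> (\<tau> x)) a = \<Lambda> (cl a)" "MA.ev (\<lambda>x. \<Lambda> (\<tau> x)) b = \<Lambda> (cl b)"
    have "MA.ev (\<lambda>x. \<Lambda> (\<tau> x)) (a \<oplus>\<^bsub>MA.A\<^esub> b)
        = MA.ev (\<lambda>x. \<Lambda> (\<tau> x)) a \<oplus> MA.ev (\<lambda>x. \<Lambda> (\<tau> x)) b"
      by (rule MA.ev_add(2)[OF ab(1,2)]) (rule \<Phi>)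
    then show "MA.ev (\<lambda>x. \<Lambda> (\<tau> x)) (a \<oplus>\<^bsub>MA.A\<^esub> b) = \<Lambda> (cl (a \<oplus>\<^bsub>MA.A\<^esub> b))"
      using ab(3,4) cl_simps(2)[OF ab(1,2)] LD(2)[OF cl_simps(1)[OF ab(1)] cl_simps(1)[OF ab(2)]] by simp
  qed
qed

lemma \<tau>_single:
  assumes "i \<in> I" "a \<in> carrier (R i)"
  shows "tensor_incl F I R i a = \<tau> (\<one>\<^bsub>P\<^esub>(i := a))"
  unfolding tensor_incl_def pure_tensor_def \<tau>_def by simp

lemma tensor_incl_hom:
  assumes i: "i \<in> I"
  shows "tensor_incl F I R i \<in> ring_hom (R i) T"
proof (rule ring_hom_memI)
  interpret Ri: algebra F "R i" by (rule alg[OF i])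
  note t = tup_upd[OF one_tup i]
  show "tensor_incl F I R i x \<in> carrier T" if "x \<in> carrier (R i)" for x
    unfolding \<tau>_single[OF i that] by (rule \<tau>_closed[OF t[OF that]])
  fix x y assume xy: "x \<in> carrier (R i)" "y \<in> carrier (R i)"
  show "tensor_incl F I R i (x \<oplus>\<^bsub>R i\<^esub> y) = tensor_incl F I R i x \<oplus>\<^bsub>T\<^esub> tensor_incl F I R i y"
    unfolding \<tau>_single[OF i xy(1)] \<tau>_single[OF i xy(2)] \<tau>_single[OF i Ri.a_closed[OF xy]]
    by (rule \<tau>_add[OF one_tup i xy])
  have "\<one>\<^bsub>P\<^esub>(i := x) \<otimes>\<^bsub>P\<^esub> \<one>\<^bsub>P\<^esub>(i := y) = \<one>\<^bsub>P\<^esub>(i := x \<otimes>\<^bsub>R i\<^esub> y)"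
    using i R_monoid by (auto simp: fun_eq_iff comm_monoid_def monoid.l_one monoid.one_closed)
  then show "tensor_incl F I R i (x \<otimes>\<^bsub>R i\<^esub> y) = tensor_incl F I R i x \<otimes>\<^bsub>T\<^esub> tensor_incl F I R i y"
    unfolding \<tau>_single[OF i xy(1)] \<tau>_single[OF i xy(2)] \<tau>_single[OF i Ri.m_closed[OF xy]]
    using \<tau>_mult[OF t[OF xy(1)] t[OF xy(2)]] by simp
next
  interpret Ri: algebra F "R i" by (rule alg[OF i])
  have "\<one>\<^bsub>P\<^esub>(i := \<one>\<^bsub>R i\<^esub>) = \<one>\<^bsub>P\<^esub>" using i by (auto simp: fun_eq_iff)
  then show "tensor_incl F I R i \<one>\<^bsub>R i\<^esub> = \<one>\<^bsub>T\<^esub>"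
    unfolding \<tau>_single[OF i Ri.one_closed] using \<tau>_one by simp
qed

end

section \<open>The product filtration of the tensor product\<close>

context filtered_tensor begin

definition W where "W k = {cl g | g. g \<in> carrier MA.A \<and> MA.supp g \<subseteq> Tup k}"

lemma W_I: "g \<in> carrier MA.A \<Longrightarrow> MA.supp g \<subseteq> Tup k \<Longrightarrow> cl g \<in> W k"
  unfolding W_def by blast

lemma W_E:
  assumes "t \<in> W k"
  obtains g where "g \<in> carrier MA.A" "MA.supp g \<subseteq> Tup k" "t = cl g"
  using assms unfolding W_def by blast

lemma Tup_mult:
  assumes "x \<in> Tup k" "y \<in> Tup m"
  shows "x \<otimes>\<^bsub>P\<^esub> y \<in> Tup (k + m)"
proof -
  obtain a where a: "at_level a x" "k \<le> (\<Sum>i\<in>I. a i)" using assms(1) unfolding Tup_def by blast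
  obtain b where b: "at_level b y" "m \<le> (\<Sum>i\<in>I. b i)" using assms(2) unfolding Tup_def by blast
  have "x \<otimes>\<^bsub>P\<^esub> y \<in> tup"
    using MA.M.m_closed[of x y] a(1) b(1) unfolding at_level_def by simp
  moreover have "(x \<otimes>\<^bsub>P\<^esub> y) i \<in> V i (a i + b i)" if "i \<in> I" for i
    using V_mult[OF that] a(1) b(1) that unfolding at_level_def by simp
  ultimately have "at_level (\<lambda>i. a i + b i) (x \<otimes>\<^bsub>P\<^esub> y)" unfolding at_level_def by blast
  moreover have "k + m \<le> (\<Sum>i\<in>I. a i + b i)" using a(2) b(2) by (simp add: sum.distrib)
  ultimately show ?thesis unfolding Tup_def mem_Collect_eq by (intro exI conjI)
qed

lemma Tup_zero: "Tup 0 = tup"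
proof
  show "Tup 0 \<subseteq> tup" using Tup_tup by blast
  show "tup \<subseteq> Tup 0"
  proof
    fix x assume x: "x \<in> tup"
    have "at_level (\<lambda>_. 0) x" unfolding at_level_def using x V_zero tupD by blast
    then show "x \<in> Tup 0" unfolding Tup_def by auto
  qed
qed

lemma Tup_antimono: "k \<le> m \<Longrightarrow> Tup m \<subseteq> Tup k"
  unfolding Tup_def using order_trans by blast

lemma W_mult:
  assumes "s \<in> W k" "t \<in> W m"
  shows "s \<otimes>\<^bsub>T\<^esub> t \<in> W (k + m)"
proof -
  obtain g where g: "g \<in> carrier MA.A" "MA.supp g \<subseteq> Tup k" "s = cl g" by (rule W_E[OF assms(1)])
  obtain h where h: "h \<in> carrier MA.A" "MA.supp h \<subseteq> Tup m" "t = cl h" by (rule W_E[OF assms(2)])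
  have "MA.supp (g \<otimes>\<^bsub>MA.A\<^esub> h) \<subseteq> Tup (k + m)"
  proof
    fix z assume "z \<in> MA.supp (g \<otimes>\<^bsub>MA.A\<^esub> h)"
    then obtain x y where "x \<in> MA.supp g" "y \<in> MA.supp h" "z = x \<otimes>\<^bsub>P\<^esub> y"
      using MA.supp_mult[OF g(1) h(1)] by fast
    then show "z \<in> Tup (k + m)" using Tup_mult g(2) h(2) by blast
  qed
  then have "cl (g \<otimes>\<^bsub>MA.A\<^esub> h) \<in> W (k + m)" by (rule W_I[OF MA.mult_closed[OF g(1) h(1)]])
  then show ?thesis unfolding g(3) h(3) cl_simps(3)[OF g(1) h(1)] .
qed

lemma W_zero: "W 0 = carrier T"
proof
  show "W 0 \<subseteq> carrier T" unfolding W_def using cl_simps(1) by blast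
  show "carrier T \<subseteq> W 0"
  proof
    fix t assume "t \<in> carrier T"
    then obtain g where g: "g \<in> carrier MA.A" "t = cl g" using cl_surj by blast
    have "MA.supp g \<subseteq> Tup 0" using MA.monoid_algebraD(2)[OF g(1)] unfolding Tup_zero by simp
    then show "t \<in> W 0" unfolding g(2) by (rule W_I[OF g(1)])
  qed
qed

lemma W_antimono: "k \<le> m \<Longrightarrow> W m \<subseteq> W k"
  unfolding W_def using Tup_antimono by blast

lemma W_ideal: "ideal (W k) T"
proof -
  interpret A: cring MA.A by (rule MA.A_cring)
  interpret T: cring T by (rule T_cring)
  have sub: "t \<in> carrier T" if "t \<in> W k" for t using that W_antimono[of 0 k] W_zero by auto
  have mult: "r \<otimes>\<^bsub>T\<^esub> t \<in> W k" if "t \<in> W k" "r \<in> carrier T" for r t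
    using W_mult[of r 0 t k] that W_zero by simp
  have zero: "\<zero>\<^bsub>T\<^esub> \<in> W k"
  proof -
    have "cl \<zero>\<^bsub>MA.A\<^esub> \<in> W k"
      by (rule W_I[OF A.zero_closed]) (simp add: coeff_support_def MA.monoid_algebra_simps(4))
    then show ?thesis by (simp only: cl_zero)
  qed
  have add: "s \<oplus>\<^bsub>T\<^esub> t \<in> W k" if st: "s \<in> W k" "t \<in> W k" for s t
  proof -
    obtain g where g: "g \<in> carrier MA.A" "MA.supp g \<subseteq> Tup k" "s = cl g" by (rule W_E[OF st(1)])
    obtain h where h: "h \<in> carrier MA.A" "MA.supp h \<subseteq> Tup k" "t = cl h" by (rule W_E[OF st(2)])
    have "MA.supp (g \<oplus>\<^bsub>MA.A\<^esub> h) \<subseteq> MA.supp g \<union> MA.supp h"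
    proof
      fix x assume x: "x \<in> MA.supp (g \<oplus>\<^bsub>MA.A\<^esub> h)"
      show "x \<in> MA.supp g \<union> MA.supp h"
      proof (rule ccontr)
        assume "x \<notin> MA.supp g \<union> MA.supp h"
        then have "(g \<oplus>\<^bsub>MA.A\<^esub> h) x = \<zero>" by (simp add: MA.monoid_algebra_simps(5) MA.supp_zero)
        then show False using x unfolding coeff_support_def by simp
      qed
    qed
    then have "cl (g \<oplus>\<^bsub>MA.A\<^esub> h) \<in> W k" using g(2) h(2) by (intro W_I[OF A.a_closed[OF g(1) h(1)]]) blast
    then show ?thesis unfolding g(3) h(3) cl_simps(2)[OF g(1) h(1)] .
  qed
  have inv: "\<ominus>\<^bsub>T\<^esub> t \<in> W k" if "t \<in> W k" for t
    using mult[OF that, of "\<ominus>\<^bsub>T\<^esub> \<one>\<^bsub>T\<^esub>"] sub[OF that] by (simp add: T.l_minus)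
  show ?thesis
  proof (rule idealI[OF T.ring_axioms])
    show "subgroup (W k) (add_monoid T)"
      by (rule T.add.subgroupI) (use zero inv add sub in \<open>auto simp: a_inv_def\<close>)
    show "x \<otimes>\<^bsub>T\<^esub> t \<in> W k" "t \<otimes>\<^bsub>T\<^esub> x \<in> W k" if "t \<in> W k" "x \<in> carrier T" for t x
      using mult[OF that] T.m_comm[OF that(2) sub[OF that(1)]] by simp_all
  qed
qed

lemma ev_killed:
  assumes g: "g \<in> carrier MA.A" "MA.supp g \<subseteq> Tup k" and \<Phi>: "kills \<Phi> k"
  shows "MA.ev \<Phi> g = \<zero>"
  using g(2) \<Phi> unfolding kills_def by (intro MA.ev_eq_zero[OF g(1)]) blast

lemma separate_W:
  assumes g: "g \<in> carrier MA.A" and n: "cl g \<notin> W k"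
  shows "\<exists>\<Phi>. multilinear \<Phi> \<and> kills \<Phi> k \<and> MA.ev \<Phi> g \<noteq> \<zero>"
proof -
  interpret VS: vec_space F T_module by (rule T_module_vec_space)
  have "cl g \<in> carrier T_module" unfolding T_module_simps by (rule cl_simps(1)[OF g])
  then obtain L where L: "linear_form F T_module L" "\<And>u. u \<in> W k \<Longrightarrow> L u = \<zero>" "L (cl g) = \<one>"
    using VS.separating_linear_form[OF ideal_T_submodule[OF W_ideal[of k]] _ n] by metis
  have "L (\<tau> x) = \<zero>" if x: "x \<in> Tup k" for x
  proof (rule L(2))
    have "MA.supp (mon \<one> x) \<subseteq> Tup k" using x by (auto simp: monomial_def coeff_support_def)
    then show "\<tau> x \<in> W k" unfolding \<tau>_def by (rule W_I[OF mon_closed[OF F.one_closed Tup_tup[OF x]]])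
  qed
  then have "kills (\<lambda>x. L (\<tau> x)) k" unfolding kills_def by blast
  moreover have "MA.ev (\<lambda>x. L (\<tau> x)) g = \<one>" using linear_form_multilinear(2)[OF L(1) g] L(3) by simp
  ultimately show ?thesis using linear_form_multilinear(1)[OF L(1)] F.one_not_zero by metis
qed

text \<open>Separate \<open>f\<close> from \<open>W (k + 1)\<close> and \<open>u\<close> from \<open>W 1\<close> by multilinear forms. The form obtained from \<open>mult_not_killed\<close>
  kills \<open>W (k + 1)\<close> but not \<open>u f\<close>.\<close>

theorem graded_nonzerodivisor:
  assumes u: "u \<in> carrier T" "u \<notin> W 1" and f: "f \<in> W k" and uf: "u \<otimes>\<^bsub>T\<^esub> f \<in> W (Suc k)"
  shows "f \<in> W (Suc k)"
proof (rule ccontr)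
  assume n: "f \<notin> W (Suc k)"
  obtain g where g: "g \<in> carrier MA.A" "MA.supp g \<subseteq> Tup k" "f = cl g" by (rule W_E[OF f])
  obtain h where h: "h \<in> carrier MA.A" "u = cl h" using cl_surj[OF u(1)] by blast
  obtain \<Phi> where \<Phi>: "multilinear \<Phi>" "kills \<Phi> (Suc k)" "MA.ev \<Phi> g \<noteq> \<zero>"
    using separate_W[OF g(1)] n g(3) by blast
  obtain \<Psi> where \<Psi>: "multilinear \<Psi>" "kills \<Psi> (Suc 0)" "MA.ev \<Psi> h \<noteq> \<zero>"
    using separate_W[OF h(1), of 1] u(2) h(2) by auto
  obtain \<Theta> where \<Theta>: "multilinear \<Theta>" "kills \<Theta> (Suc k)" "MA.ev \<Theta> (h \<otimes>\<^bsub>MA.A\<^esub> g) \<noteq> \<zero>"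
    using mult_not_killed[OF g(1,2) \<Phi> h(1) \<Psi>] by blast
  obtain w where w: "w \<in> carrier MA.A" "MA.supp w \<subseteq> Tup (Suc k)" "u \<otimes>\<^bsub>T\<^esub> f = cl w" by (rule W_E[OF uf])
  have hg: "h \<otimes>\<^bsub>MA.A\<^esub> g \<in> carrier MA.A" by (rule MA.mult_closed[OF h(1) g(1)])
  have "cl (h \<otimes>\<^bsub>MA.A\<^esub> g) = cl w" using cl_simps(3)[OF h(1) g(1)] w(3) h(2) g(3) by simp
  then have J: "h \<otimes>\<^bsub>MA.A\<^esub> g \<ominus>\<^bsub>MA.A\<^esub> w \<in> J" by (rule cl_eq[OF hg w(1)])
  have "MA.ev \<Theta> (h \<otimes>\<^bsub>MA.A\<^esub> g) \<ominus> MA.ev \<Theta> w = MA.ev \<Theta> (h \<otimes>\<^bsub>MA.A\<^esub> g \<ominus>\<^bsub>MA.A\<^esub> w)"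
    by (rule ev_minus[symmetric, OF hg w(1)]) (rule multilinearD(1)[OF \<Theta>(1)])
  also have "\<dots> = \<zero>" by (rule ev_tensor_ideal[OF \<Theta>(1) J])
  finally have e: "MA.ev \<Theta> (h \<otimes>\<^bsub>MA.A\<^esub> g) \<ominus> MA.ev \<Theta> w = \<zero>" .
  have "MA.ev \<Theta> (h \<otimes>\<^bsub>MA.A\<^esub> g) \<in> carrier F"
    using multilinearD(1)[OF \<Theta>(1)] MA.monoid_algebraD(3)[OF hg] by (intro MA.ev_closed[OF hg]) simp
  then show False using e ev_killed[OF w(1,2) \<Theta>(2)] \<Theta>(3) by (simp add: a_minus_def)
qed

text \<open>Climb the filtration: \<open>f\<close> lies in \<open>W 0\<close>, and each step from \<open>W k\<close> to \<open>W (k + 1)\<close> uses \<open>u f \<in> W N \<subseteq> W (k + 1)\<close>.\<close>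

corollary W_torsion_free:
  assumes u: "u \<in> carrier T" "u \<notin> W 1" and f: "f \<in> carrier T" and uf: "u \<otimes>\<^bsub>T\<^esub> f \<in> W N"
  shows "f \<in> W N"
proof -
  have "k \<le> N \<Longrightarrow> f \<in> W k" for k
  proof (induct k)
    case 0
    show ?case using f W_zero by simp
  next
    case (Suc k)
    then show ?case using graded_nonzerodivisor[OF u, of f k] uf W_antimono[of "Suc k" N] by auto
  qed
  then show ?thesis by simp
qed

end

section \<open>Symbolic powers of a sum of expanded primes\<close>

locale tensor_of_primes = tensor_family F I R
  for F (structure) and I :: "'i set" and R :: "'i \<Rightarrow> ('f, 'a, 'm) module_scheme" +
  fixes p :: "'i \<Rightarrow> 'a set"
  assumes alg_closed: "algebraically_closed F"
    and affine: "i \<in> I \<Longrightarrow> affine_algebra F (R i)"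
    and prime: "i \<in> I \<Longrightarrow> primeideal (p i) (R i)"
begin

lemma filtered: "filtered_tensor F I R (\<lambda>i. symbolic_power (R i) (p i))"
proof (rule filtered_tensor.intro[OF tensor_family_axioms], rule filtered_tensor_axioms.intro)
  show "v \<in> symbolic_power (R i) (p i) a" if "i \<in> I" "r \<in> carrier (R i) - symbolic_power (R i) (p i) 1"
    "v \<in> carrier (R i)" "r \<otimes>\<^bsub>R i\<^esub> v \<in> symbolic_power (R i) (p i) a" for i r v a
    using primeideal.symbolic_power_torsion_free[OF prime[OF that(1)] _ _ that(3,4)] that(2)
      primeideal.symbolic_power_one[OF prime[OF that(1)]] by simp
  show "primeideal (symbolic_power (R i) (p i) 1) (R i)" if "i \<in> I" for i
    using primeideal.symbolic_power_one[OF prime[OF that]] prime[OF that] by simp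
qed (simp_all add: alg_closed affine primeideal.symbolic_power_ideal primeideal.symbolic_power_zero
    primeideal.symbolic_power_dec primeideal.symbolic_power_mult prime)

sublocale filtered_tensor F I R "\<lambda>i. symbolic_power (R i) (p i)"
  by (rule filtered)

definition Q where
  "Q = (\<Oplus>\<^bsub>ideals_set T\<^esub>i\<in>I. extended_ideal T (tensor_incl F I R i) (p i))"

lemma p_ideal: "i \<in> I \<Longrightarrow> ideal (p i) (R i)"
  using primeideal.axioms(1)[OF prime] .

lemma image_carrier: "i \<in> I \<Longrightarrow> tensor_incl F I R i ` p i \<subseteq> carrier T"
  using ring_hom_memE(1)[OF tensor_incl_hom] idealD(2)[OF p_ideal] by blast

lemma extended_ideal_ideal: "i \<in> I \<Longrightarrow> ideal (extended_ideal T (tensor_incl F I R i) (p i)) T"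
  unfolding extended_ideal_def by (rule ring.genideal_ideal[OF cring.axioms(1)[OF T_cring] image_carrier])

lemma Q_ideal: "ideal Q T"
  unfolding Q_def by (rule cring.sum_ideals(1)[OF T_cring finite_I extended_ideal_ideal])

lemma incl_Q:
  assumes i: "i \<in> I" and a: "a \<in> p i"
  shows "tensor_incl F I R i a \<in> Q"
proof -
  have "tensor_incl F I R i ` p i \<subseteq> extended_ideal T (tensor_incl F I R i) (p i)"
    unfolding extended_ideal_def
    by (rule ring.genideal_self[OF cring.axioms(1)[OF T_cring] image_carrier[OF i]])
  also have "\<dots> \<subseteq> Q"
    unfolding Q_def by (rule cring.sum_ideals(2)[OF T_cring finite_I extended_ideal_ideal i])
  finally show ?thesis using a by blast
qed

lemma Q_W: "Q \<subseteq> W 1"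
  unfolding Q_def
proof (rule cring.sum_ideals(3)[OF T_cring finite_I extended_ideal_ideal W_ideal])
  fix i assume i: "i \<in> I"
  show "extended_ideal T (tensor_incl F I R i) (p i) \<subseteq> W 1"
    unfolding extended_ideal_def
  proof (rule ring.genideal_minimal[OF cring.axioms(1)[OF T_cring] W_ideal], rule image_subsetI)
    fix a assume a: "a \<in> p i"
    have aR: "a \<in> carrier (R i)" by (rule idealD(2)[OF p_ideal[OF i] a])
    have t: "\<one>\<^bsub>P\<^esub>(i := a) \<in> tup" by (rule tup_upd[OF one_tup i aR])
    have "\<one>\<^bsub>P\<^esub>(i := a) \<in> Tup 1"
      by (rule Tup_coord[OF t i]) (use a primeideal.symbolic_power_one[OF prime[OF i]] in simp)
    then have "MA.supp (mon \<one> (\<one>\<^bsub>P\<^esub>(i := a))) \<subseteq> Tup 1"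
      by (auto simp: monomial_def coeff_support_def)
    then show "tensor_incl F I R i a \<in> W 1"
      unfolding \<tau>_single[OF i aR] \<tau>_def by (rule W_I[OF mon_closed[OF F.one_closed t]])
  qed
qed

abbreviation "Qpow n \<equiv> Q [^]\<^bsub>ideals_set T\<^esub> (n::nat)"

lemma Qpow_W: "Qpow n \<subseteq> W n"
proof (induct n)
  case 0
  show ?case unfolding cring.ideal_pow_simps[OF T_cring] W_zero by blast
next
  case (Suc n)
  show ?case unfolding cring.ideal_pow_simps[OF T_cring]
  proof
    fix t assume "t \<in> Qpow n \<cdot>\<^bsub>T\<^esub> Q"
    then show "t \<in> W (Suc n)"
    proof (induct rule: ideal_prod.induct)
      case (prod i j)
      then show ?case using W_mult[of i n j 1] Suc Q_W by auto
    next
      case (sum s t)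
      then show ?case using idealD(4)[OF W_ideal] by blast
    qed
  qed
qed

lemma incl_pow:
  assumes i: "i \<in> I" and a: "a \<in> p i [^]\<^bsub>ideals_set (R i)\<^esub> (n::nat)"
  shows "tensor_incl F I R i a \<in> Qpow n"
  using a
proof (induct n arbitrary: a)
  case 0
  then show ?case
    using ring_hom_memE(1)[OF tensor_incl_hom[OF i]]
    unfolding cring.ideal_pow_simps[OF T_cring] cring.ideal_pow_simps[OF R_cring[OF i]] by blast
next
  case (Suc n)
  note hom = ring_hom_memE[OF tensor_incl_hom[OF i]]
  note pc = idealD(2)[OF cring.ideal_pow_ideal[OF R_cring[OF i] p_ideal[OF i]]]
  have "a \<in> (p i [^]\<^bsub>ideals_set (R i)\<^esub> n) \<cdot>\<^bsub>R i\<^esub> p i"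
    using Suc(2) unfolding cring.ideal_pow_simps[OF R_cring[OF i]] .
  then have "a \<in> carrier (R i) \<and> tensor_incl F I R i a \<in> Qpow n \<cdot>\<^bsub>T\<^esub> Q"
  proof (induct rule: ideal_prod.induct)
    case (prod x y)
    have c: "x \<in> carrier (R i)" "y \<in> carrier (R i)"
      using pc[OF prod(1)] idealD(2)[OF p_ideal[OF i] prod(2)] .
    have "tensor_incl F I R i x \<otimes>\<^bsub>T\<^esub> tensor_incl F I R i y \<in> Qpow n \<cdot>\<^bsub>T\<^esub> Q"
      by (rule ideal_prod.prod[OF Suc(1)[OF prod(1)] incl_Q[OF i prod(2)]])
    then show ?case using hom(2)[OF c] c cring.cring_simprules(5)[OF R_cring[OF i]] by simp
  next
    case (sum x y)
    then show ?case using hom(3)[of x y] ideal_prod.sum[of _ T "Qpow n" Q]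
        cring.cring_simprules(1)[OF R_cring[OF i]] by simp
  qed
  then show ?case unfolding cring.ideal_pow_simps[OF T_cring] by blast
qed

text \<open>A pure tensor is the product of the images of its coordinates, and the \<open>i\<close>-th image lies in \<open>Q\<close> to the power \<open>q i\<close>.\<close>

lemma tensor_in_Qpow:
  assumes x: "x \<in> tup" and q: "\<And>i. i \<in> I \<Longrightarrow> x i \<in> p i [^]\<^bsub>ideals_set (R i)\<^esub> (q i :: nat)"
  shows "\<tau> x \<in> Qpow (\<Sum>i\<in>I. q i)"
proof -
  interpret T: cring T by (rule T_cring)
  define r where "r S = (\<lambda>i\<in>I. if i \<in> S then x i else \<one>\<^bsub>R i\<^esub>)" for S
  have one: "\<one>\<^bsub>R i\<^esub> \<in> carrier (R i)" if "i \<in> I" for i using cring.cring_simprules(6)[OF R_cring[OF that]] .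
  have rt: "r S \<in> tup" for S unfolding r_def using x one by (auto simp: PiE_iff)
  have "\<tau> (r S) \<in> Qpow (\<Sum>i\<in>S. q i)" if "S \<subseteq> I" for S
    using finite_subset[OF that finite_I] that
  proof (induct S rule: finite_induct)
    case empty
    show ?case unfolding sum.empty cring.ideal_pow_simps[OF T_cring] by (rule \<tau>_closed[OF rt])
  next
    case (insert i S)
    have i: "i \<in> I" using insert by simp
    have xi: "x i \<in> carrier (R i)" by (rule tupD[OF x i])
    note lo = cring.cring_simprules(12)[OF R_cring] and co = cring.cring_simprules(14)[OF R_cring]
    have "r (insert i S) = \<one>\<^bsub>P\<^esub>(i := x i) \<otimes>\<^bsub>P\<^esub> r S"
    proof (rule tup_ext[OF rt])
      show "\<one>\<^bsub>P\<^esub>(i := x i) \<otimes>\<^bsub>P\<^esub> r S \<in> tup"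
        using MA.M.m_closed[of "\<one>\<^bsub>P\<^esub>(i := x i)" "r S"] tup_upd[OF one_tup i xi] rt by simp
      fix j assume j: "j \<in> I"
      have xj: "x j \<in> carrier (R j)" by (rule tupD[OF x j])
      show "r (insert i S) j = (\<one>\<^bsub>P\<^esub>(i := x i) \<otimes>\<^bsub>P\<^esub> r S) j"
        using j insert(2) lo[OF j xj] lo[OF j one[OF j]] co[OF j xj one[OF j]] unfolding r_def by auto
    qed
    then have "\<tau> (r (insert i S)) = tensor_incl F I R i (x i) \<otimes>\<^bsub>T\<^esub> \<tau> (r S)"
      using \<tau>_mult[OF tup_upd[OF one_tup i xi] rt] \<tau>_single[OF i xi] by simp
    moreover have "tensor_incl F I R i (x i) \<otimes>\<^bsub>T\<^esub> \<tau> (r S) \<in> Qpow (q i + (\<Sum>i\<in>S. q i))"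
      by (rule T.ideal_pow_mult[OF Q_ideal incl_pow[OF i q[OF i]]]) (use insert in blast)
    ultimately show ?case using insert(1,2) by simp
  qed
  then have "\<tau> (r I) \<in> Qpow (\<Sum>i\<in>I. q i)" by blast
  moreover have "r I = x" unfolding r_def using x by (intro tup_ext[OF _ x]) (auto simp: PiE_iff)
  ultimately show ?thesis by simp
qed

lemma W_Qpow:
  assumes "\<And>x. x \<in> Tup N \<Longrightarrow> \<exists>q::'i \<Rightarrow> nat. (\<forall>i\<in>I. x i \<in> p i [^]\<^bsub>ideals_set (R i)\<^esub> q i) \<and> r \<le> (\<Sum>i\<in>I. q i)"
  shows "W N \<subseteq> Qpow r"
proof
  interpret T: cring T by (rule T_cring)
  note QD = idealD[OF T.ideal_pow_ideal[OF Q_ideal, of r]]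
  fix t assume "t \<in> W N"
  then obtain g where g: "g \<in> carrier MA.A" "MA.supp g \<subseteq> Tup N" "t = cl g" by (rule W_E)
  show "t \<in> Qpow r" unfolding g(3)
  proof (rule A_decomp[OF g(1), where Z="\<lambda>g. cl g \<in> Qpow r"])
    show "cl \<zero>\<^bsub>MA.A\<^esub> \<in> Qpow r" unfolding cl_zero by (rule QD(3))
  next
    fix x assume x: "x \<in> MA.supp g"
    then have xT: "x \<in> Tup N" using g(2) by blast
    then obtain q where q: "\<forall>i\<in>I. x i \<in> p i [^]\<^bsub>ideals_set (R i)\<^esub> q i" "r \<le> (\<Sum>i\<in>I. q i)"
      using assms by blast
    have "\<tau> x \<in> Qpow (\<Sum>i\<in>I. q i)" by (rule tensor_in_Qpow[OF Tup_tup[OF xT]]) (use q in blast)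
    then have tx: "\<tau> x \<in> Qpow r" using T.ideal_pow_antimono[OF Q_ideal q(2)] by blast
    have gx: "g x \<in> carrier F" by (rule MA.monoid_algebraD(1)[OF g(1)])
    show "cl (mon (g x) x) \<in> Qpow r"
      unfolding cl_mon[OF gx Tup_tup[OF xT]] by (rule QD(5)[OF ring_hom_memE(1)[OF \<kappa>_hom gx] tx])
  next
    fix a b assume "a \<in> carrier MA.A" "b \<in> carrier MA.A" "cl a \<in> Qpow r" "cl b \<in> Qpow r"
    then show "cl (a \<oplus>\<^bsub>MA.A\<^esub> b) \<in> Qpow r" using QD(4) cl_simps(2) by simp
  qed
qed

text \<open>For \<open>u \<notin> Q\<close> and \<open>u f \<in> Q\<^sup>N \<subseteq> W N\<close>, torsion-freeness of the filtration applies as soon as \<open>u \<notin> W 1\<close>, that is,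
  \<open>W 1 \<subseteq> Q\<close>: a tuple of positive total level has a coordinate in its prime.\<close>

theorem symbolic_power_subset_W: "symbolic_power T Q N \<subseteq> W N"
proof
  have WQ: "W 1 \<subseteq> Q"
  proof -
    have "W 1 \<subseteq> Qpow 1"
    proof (rule W_Qpow)
      fix x assume "x \<in> Tup 1"
      then obtain a where a: "at_level a x" "1 \<le> (\<Sum>i\<in>I. a i)" unfolding Tup_def by blast
      then obtain j where j: "j \<in> I" "1 \<le> a j" by (metis One_nat_def Suc_leI not_one_le_zero sum.neutral zero_less_iff_neq_zero)
      have xt: "x \<in> tup" using a(1) unfolding at_level_def by blast
      have "x j \<in> symbolic_power (R j) (p j) 1" using a(1) j V_antimono[OF j] unfolding at_level_def by blast
      then have xj: "x j \<in> p j" using primeideal.symbolic_power_one[OF prime[OF j(1)]] by simp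
      let ?q = "\<lambda>i. if i = j then 1 else 0 :: nat"
      have "\<forall>i\<in>I. x i \<in> p i [^]\<^bsub>ideals_set (R i)\<^esub> ?q i"
      proof
        fix i assume i: "i \<in> I"
        show "x i \<in> p i [^]\<^bsub>ideals_set (R i)\<^esub> ?q i"
          using xj tupD[OF xt i] cring.ideal_pow_one[OF R_cring[OF i] p_ideal[OF i]]
            cring.ideal_pow_simps(1)[OF R_cring[OF i], of "p i"] by (cases "i = j") (simp_all only: if_True if_False simp_thms)
      qed
      moreover have "1 \<le> (\<Sum>i\<in>I. ?q i)" using j(1) finite_I by simp
      ultimately show "\<exists>q::'i \<Rightarrow> nat. (\<forall>i\<in>I. x i \<in> p i [^]\<^bsub>ideals_set (R i)\<^esub> q i) \<and> 1 \<le> (\<Sum>i\<in>I. q i)"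
        by (intro exI[of _ ?q] conjI)
    qed
    then show ?thesis using cring.ideal_pow_one[OF T_cring Q_ideal] by simp
  qed
  fix f assume "f \<in> symbolic_power T Q N"
  then obtain u where u: "f \<in> carrier T" "u \<in> carrier T" "u \<notin> Q" "u \<otimes>\<^bsub>T\<^esub> f \<in> Qpow N"
    by (rule cring.symbolic_powerE[OF T_cring])
  have "u \<notin> W 1" using u(3) WQ by blast
  then show "f \<in> W N" using W_torsion_free[OF u(2) _ u(1)] Qpow_W u(4) by blast
qed

end

theorem theorem1p2:
  fixes F :: "('f, 'c) ring_scheme"
    and R :: "nat \<Rightarrow> ('f, 'a, 'm) module_scheme"
    and n :: nat
    and D :: "nat \<Rightarrow> nat"
    and P :: "nat \<Rightarrow> 'a set"
  defines "T \<equiv> tensor_product F {1..n} R"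
  defines "Q \<equiv> (\<Oplus>\<^bsub>ideals_set T\<^esub>i\<in>{1..n}. extended_ideal T (tensor_incl F {1..n} R i) (P i))"
  assumes "algebraically_closed F"
    and "n \<ge> 2"
    and "\<And>i. i \<in> {1..n} \<Longrightarrow> affine_algebra F (R i)"
    and "\<And>i. i \<in> {1..n} \<Longrightarrow> domain (R i)"
    and "\<And>i. i \<in> {1..n} \<Longrightarrow> D i > 0"
    and "\<And>i. i \<in> {1..n} \<Longrightarrow> primeideal (P i) (R i)"
  shows "((\<forall>i\<in>{1..n}. \<forall>p. primeideal p (R i) \<longrightarrow>
             (\<forall>r>0. symbolic_power (R i) p (D i * r) \<subseteq> p [^]\<^bsub>ideals_set (R i)\<^esub> r))
          \<longrightarrow> (\<forall>r>0. symbolic_power T Q ((\<Sum>i\<in>{1..n}. D i) * r) \<subseteq> Q [^]\<^bsub>ideals_set T\<^esub> r))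
       \<and> ((\<forall>i\<in>{1..n}. \<forall>p. primeideal p (R i) \<longrightarrow>
             (\<forall>r>0. symbolic_power (R i) p (D i * (r - 1) + 1) \<subseteq> p [^]\<^bsub>ideals_set (R i)\<^esub> r))
          \<longrightarrow> (\<forall>r>0. symbolic_power T Q (Max (D ` {1..n}) * (r - 1) + 1)
                      \<subseteq> Q [^]\<^bsub>ideals_set T\<^esub> r))"
proof -
  let ?I = "{1..n}"
  interpret X: tensor_of_primes F ?I R P
  proof (rule tensor_of_primes.intro, rule tensor_family.intro)
    show "field F" using assms(3) by (simp add: algebraically_closed_def)
    show "algebra F (R i)" if "i \<in> ?I" for i using assms(5)[OF that] by (simp add: affine_algebra_def)
    show "tensor_of_primes_axioms F ?I R P"
      by (rule tensor_of_primes_axioms.intro) (use assms(3,5,8) in blast)+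
  qed simp
  have TQ: "T = X.T" "Q = X.Q" unfolding T_def Q_def X.Q_def by simp_all
  have pow0: "x i \<in> P i [^]\<^bsub>ideals_set (R i)\<^esub> (0::nat)" if "x \<in> X.tup" "i \<in> ?I" for x i
    using X.tupD[OF that] cring.ideal_pow_simps(1)[OF X.R_cring[OF that(2)], of "P i"] by blast
  show ?thesis
  proof (intro conjI impI allI)
    fix r :: nat
    assume H: "\<forall>i\<in>?I. \<forall>p. primeideal p (R i) \<longrightarrow>
             (\<forall>r>0. symbolic_power (R i) p (D i * r) \<subseteq> p [^]\<^bsub>ideals_set (R i)\<^esub> r)" and r: "r > 0"
    have "X.W ((\<Sum>i\<in>?I. D i) * r) \<subseteq> X.Qpow r"
    proof (rule X.W_Qpow)
      fix x assume "x \<in> X.Tup ((\<Sum>i\<in>?I. D i) * r)"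
      then obtain a where a: "X.at_level a x" "(\<Sum>i\<in>?I. D i) * r \<le> (\<Sum>i\<in>?I. a i)"
        unfolding X.Tup_def by blast
      have xt: "x \<in> X.tup" using a(1) unfolding X.at_level_def by blast
      \<comment> \<open>Pigeonhole: otherwise the exponents add up to less than \<open>(\<Sum> D i) * r\<close>.\<close>
      have "\<exists>j\<in>?I. D j * r \<le> a j"
      proof (rule ccontr)
        assume "\<not> ?thesis"
        then have "\<forall>i\<in>?I. a i < D i * r" by force
        moreover have "?I \<noteq> {}" using assms(4) by simp
        ultimately have "(\<Sum>i\<in>?I. a i) < (\<Sum>i\<in>?I. D i * r)" by (intro sum_strict_mono) auto
        then show False using a(2) by (simp add: sum_distrib_right)
      qed
      then obtain j where j: "j \<in> ?I" "D j * r \<le> a j" by blast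
      have "x j \<in> symbolic_power (R j) (P j) (D j * r)"
        using a(1) X.V_antimono[OF j] j(1) unfolding X.at_level_def by blast
      then have xj: "x j \<in> P j [^]\<^bsub>ideals_set (R j)\<^esub> r" using H j(1) assms(8)[OF j(1)] r by blast
      let ?q = "\<lambda>i. if i = j then r else 0"
      have "\<forall>i\<in>?I. x i \<in> P i [^]\<^bsub>ideals_set (R i)\<^esub> ?q i"
      proof
        fix i assume i: "i \<in> ?I"
        show "x i \<in> P i [^]\<^bsub>ideals_set (R i)\<^esub> ?q i"
          using xj pow0[OF xt i] by (cases "i = j") (simp_all only: if_True if_False simp_thms)
      qed
      moreover have "r \<le> (\<Sum>i\<in>?I. ?q i)" using j(1) by simp
      ultimately show "\<exists>q. (\<forall>i\<in>?I. x i \<in> P i [^]\<^bsub>ideals_set (R i)\<^esub> q i) \<and> r \<le> (\<Sum>i\<in>?I. q i)"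
        by (intro exI[of _ ?q] conjI)
    qed
    then show "symbolic_power T Q ((\<Sum>i\<in>?I. D i) * r) \<subseteq> Q [^]\<^bsub>ideals_set T\<^esub> r"
      unfolding TQ using X.symbolic_power_subset_W by blast
  next
    fix r :: nat
    assume H: "\<forall>i\<in>?I. \<forall>p. primeideal p (R i) \<longrightarrow>
             (\<forall>r>0. symbolic_power (R i) p (D i * (r - 1) + 1) \<subseteq> p [^]\<^bsub>ideals_set (R i)\<^esub> r)" and r: "r > 0"
    define M where "M = Max (D ` ?I)"
    have M: "D i \<le> M" if "i \<in> ?I" for i unfolding M_def using that by (intro Max_ge) auto
    have "X.W (M * (r - 1) + 1) \<subseteq> X.Qpow r"
    proof (rule X.W_Qpow)
      fix x assume "x \<in> X.Tup (M * (r - 1) + 1)"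
      then obtain a where a: "X.at_level a x" "M * (r - 1) + 1 \<le> (\<Sum>i\<in>?I. a i)"
        unfolding X.Tup_def by blast
      have xt: "x \<in> X.tup" using a(1) unfolding X.at_level_def by blast
      \<comment> \<open>The quotient \<open>a i / D i\<close> rounded up: the largest \<open>q\<close> for which the hypothesis applies to level \<open>a i\<close>.\<close>
      define q where "q i = (if a i = 0 then 0 else (a i - 1) div D i + 1)" for i
      have q1: "x i \<in> P i [^]\<^bsub>ideals_set (R i)\<^esub> q i" if i: "i \<in> ?I" for i
      proof (cases "a i = 0")
        case True
        then have "q i = 0" unfolding q_def by simp
        then show ?thesis using pow0[OF xt i] by (simp only:)
      next
        case False
        define d where "d = (a i - 1) div D i"
        have "D i * d \<le> a i - 1" unfolding d_def by (rule times_div_less_eq_dividend)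
        moreover have "q i - 1 = d" unfolding q_def d_def using False by simp
        ultimately have "D i * (q i - 1) + 1 \<le> a i" using False by simp
        then have "x i \<in> symbolic_power (R i) (P i) (D i * (q i - 1) + 1)"
          using a(1) X.V_antimono[OF i] i unfolding X.at_level_def by blast
        moreover have "0 < q i" unfolding q_def using False by simp
        ultimately show ?thesis using H i assms(8)[OF i] by blast
      qed
      have q2: "a i \<le> M * q i" if i: "i \<in> ?I" for i
      proof (cases "a i = 0")
        case False
        have "a i - 1 < D i * ((a i - 1) div D i + 1)"
          using assms(7)[OF i] by (metis Suc_eq_plus1 dividend_less_times_div mult_Suc_right add.commute)
        then have "a i \<le> D i * q i" using False unfolding q_def by simp
        also have "\<dots> \<le> M * q i" by (rule mult_le_mono1[OF M[OF i]])
        finally show ?thesis .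
      qed simp
      have "(\<Sum>i\<in>?I. a i) \<le> M * (\<Sum>i\<in>?I. q i)"
        unfolding sum_distrib_left by (rule sum_mono[OF q2])
      then have "M * (r - 1) < M * (\<Sum>i\<in>?I. q i)" using a(2) by linarith
      then have "r - 1 < (\<Sum>i\<in>?I. q i)" by simp
      then have "r \<le> (\<Sum>i\<in>?I. q i)" using r by simp
      then show "\<exists>q. (\<forall>i\<in>?I. x i \<in> P i [^]\<^bsub>ideals_set (R i)\<^esub> q i) \<and> r \<le> (\<Sum>i\<in>?I. q i)"
        using q1 by blast
    qed
    then show "symbolic_power T Q (Max (D ` ?I) * (r - 1) + 1) \<subseteq> Q [^]\<^bsub>ideals_set T\<^esub> r"
      unfolding TQ M_def using X.symbolic_power_subset_W by blast
  qed
qed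

end
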